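(* Let $X$ be a connected type with points $a,b:X$ and let $n\ge 1$. There exists a change-of-basepoint isomorphism $\varphi : \pi_n(X,a)\cong\pi_n(X,b)$ which is canonical, in the sense that for all $p : a =_X b$ it holds that $\varphi = \mathsf{transport}^{\pi_n(X,-)}(p,-)$, if and only if the $\pi_1(X,a)$-action on $\pi_n(X,a)$ is trivial.
   Context: We work in homotopy type theory (Martin-Löf type theory with a univalent universe $\mathsf{Type}$, function extensionality and higher inductive types). $\|A\|$ is propositional truncation and $\|A\|_0$ is set truncation with constructor $|\cdot|_0$. A type $X$ is connected if $\|x =_X y\|$ is inhabited for all $x,y:X$. For a type family $P : X\to\mathsf{Type}$, $p : a =_X b$ and $u:P(a)$, $\mathsf{transport}^P(p,u) : P(b)$ is transport. $\Omega(X,x_0) := (x_0=_X x_0)$ pointed at $\mathsf{refl}_{x_0}$, $\Omega^{n+1}(X,x_0):=\Omega(\Omega^n(X,x_0))$, and $\pi_n(X,x_0):=\|\Omega^n(X,x_0)\|_0$ with the group structure induced by path concatenation. The (left) action of $\pi_1(X,x_0)$ on $\pi_n(X,x_0)$ is defined on truncated loops $|p|_0:\pi_1(X,x_0)$ by $|p|_0 . u := \mathsf{transport}^{\pi_n(X,-)}(p^{-1},u)$ for $u:\pi_n(X,x_0)$. The action is trivial if $p'.u=u$ for all $p':\pi_1(X,x_0)$ and $u:\pi_n(X,x_0)$. *)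

theory Defs
  imports Main
begin

text \<open>
  A deep embedding of homotopy type theory: Martin-Loef type theory with a cumulative hierarchy of
  universes a la Russell, \<open>\<Pi>\<close>, \<open>\<Sigma>\<close>, \<open>\<zero>\<close>, \<open>\<one>\<close>, \<open>+\<close>, \<open>\<nat>\<close> and identity types, function extensionality,
  univalence, and the higher inductive types \<open>\<parallel>A\<parallel>\<close> and \<open>\<parallel>A\<parallel>\<^sub>0\<close>.  The rules follow the natural-deduction
  presentation in the appendix of the HoTT book.

  Terms use de Bruijn indices.  A context is a list of types, the most recent hypothesis first, so
  \<open>Var 0\<close> is the most recently bound variable.  The comments give the named form of binding arguments.
\<close>

section \<open>Raw terms and substitution\<close>

datatype tm =
    Var nat
  | Univ nat
  | Pi tm tm                 (* Pi A (x. B) *)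
  | Lam tm tm                (* Lam A (x. b) *)
  | App tm tm
  | Sig tm tm                (* Sig A (x. B) *)
  | Tup tm tm
  | Split tm tm tm           (* Split (z. C) (x y. g) p *)
  | Empty
  | Abort tm tm              (* Abort (z. C) e *)
  | One
  | Star
  | OneInd tm tm tm          (* OneInd (z. C) c e *)
  | Plus tm tm
  | Inl tm
  | Inr tm
  | Cases tm tm tm tm        (* Cases (z. C) (x. c) (y. d) e *)
  | Nat
  | Zero
  | Succ tm
  | NatInd tm tm tm tm       (* NatInd (n. C) c0 (n u. cs) n *)
  | Eql tm tm tm             (* Eql A a b is the identity type of a and b in A *)
  | Refl tm
  | J tm tm tm tm tm         (* J (x y p. C) (z. c) a b p *)
  | PTr tm                   (* propositional truncation *)
  | PIn tm
  | PEq tm tm                (* PEq x y : x = y for x, y in PTr A *)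
  | PInd tm tm tm tm         (* PInd (z. C) (a. c) (z. h) t, with h proving each C a proposition *)
  | STr tm                   (* set truncation *)
  | SIn tm
  | SEq tm tm tm tm          (* SEq x y p q : p = q for p, q : x = y in STr A *)
  | SInd tm tm tm tm         (* SInd (z. C) (a. c) (z. h) t, with h proving each C a set *)
  | FunExt tm tm
  | UA nat tm tm

primrec upr :: "(nat \<Rightarrow> nat) \<Rightarrow> nat \<Rightarrow> nat" where
  "upr r 0 = 0"
| "upr r (Suc k) = Suc (r k)"

primrec rename :: "(nat \<Rightarrow> nat) \<Rightarrow> tm \<Rightarrow> tm" where
  "rename r (Var k) = Var (r k)"
| "rename r (Univ i) = Univ i"
| "rename r (Pi A B) = Pi (rename r A) (rename (upr r) B)"
| "rename r (Lam A b) = Lam (rename r A) (rename (upr r) b)"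
| "rename r (App f a) = App (rename r f) (rename r a)"
| "rename r (Sig A B) = Sig (rename r A) (rename (upr r) B)"
| "rename r (Tup a b) = Tup (rename r a) (rename r b)"
| "rename r (Split C g p) = Split (rename (upr r) C) (rename (upr (upr r)) g) (rename r p)"
| "rename r Empty = Empty"
| "rename r (Abort C e) = Abort (rename (upr r) C) (rename r e)"
| "rename r One = One"
| "rename r Star = Star"
| "rename r (OneInd C c e) = OneInd (rename (upr r) C) (rename r c) (rename r e)"
| "rename r (Plus A B) = Plus (rename r A) (rename r B)"
| "rename r (Inl a) = Inl (rename r a)"
| "rename r (Inr b) = Inr (rename r b)"
| "rename r (Cases C c d e) =
     Cases (rename (upr r) C) (rename (upr r) c) (rename (upr r) d) (rename r e)"
| "rename r Nat = Nat"
| "rename r Zero = Zero"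
| "rename r (Succ n) = Succ (rename r n)"
| "rename r (NatInd C c0 cs n) =
     NatInd (rename (upr r) C) (rename r c0) (rename (upr (upr r)) cs) (rename r n)"
| "rename r (Eql A a b) = Eql (rename r A) (rename r a) (rename r b)"
| "rename r (Refl a) = Refl (rename r a)"
| "rename r (J C c a b p) =
     J (rename (upr (upr (upr r))) C) (rename (upr r) c) (rename r a) (rename r b) (rename r p)"
| "rename r (PTr A) = PTr (rename r A)"
| "rename r (PIn a) = PIn (rename r a)"
| "rename r (PEq x y) = PEq (rename r x) (rename r y)"
| "rename r (PInd C c h t) =
     PInd (rename (upr r) C) (rename (upr r) c) (rename (upr r) h) (rename r t)"
| "rename r (STr A) = STr (rename r A)"
| "rename r (SIn a) = SIn (rename r a)"
| "rename r (SEq x y p q) = SEq (rename r x) (rename r y) (rename r p) (rename r q)"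
| "rename r (SInd C c h t) =
     SInd (rename (upr r) C) (rename (upr r) c) (rename (upr r) h) (rename r t)"
| "rename r (FunExt f g) = FunExt (rename r f) (rename r g)"
| "rename r (UA i A B) = UA i (rename r A) (rename r B)"

text \<open>Parallel substitutions are functions \<open>nat \<Rightarrow> tm\<close>; \<open>up \<sigma>\<close> is \<open>\<sigma>\<close> transported under a binder.\<close>

primrec up :: "(nat \<Rightarrow> tm) \<Rightarrow> nat \<Rightarrow> tm" where
  "up \<sigma> 0 = Var 0"
| "up \<sigma> (Suc k) = rename Suc (\<sigma> k)"

primrec subst :: "tm \<Rightarrow> (nat \<Rightarrow> tm) \<Rightarrow> tm" ("_\<langle>_\<rangle>" [1000, 0] 1000) where
  "subst (Var k) \<sigma> = \<sigma> k"
| "subst (Univ i) \<sigma> = Univ i"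
| "subst (Pi A B) \<sigma> = Pi (subst A \<sigma>) (subst B (up \<sigma>))"
| "subst (Lam A b) \<sigma> = Lam (subst A \<sigma>) (subst b (up \<sigma>))"
| "subst (App f a) \<sigma> = App (subst f \<sigma>) (subst a \<sigma>)"
| "subst (Sig A B) \<sigma> = Sig (subst A \<sigma>) (subst B (up \<sigma>))"
| "subst (Tup a b) \<sigma> = Tup (subst a \<sigma>) (subst b \<sigma>)"
| "subst (Split C g p) \<sigma> = Split (subst C (up \<sigma>)) (subst g (up (up \<sigma>))) (subst p \<sigma>)"
| "subst Empty \<sigma> = Empty"
| "subst (Abort C e) \<sigma> = Abort (subst C (up \<sigma>)) (subst e \<sigma>)"
| "subst One \<sigma> = One"
| "subst Star \<sigma> = Star"
| "subst (OneInd C c e) \<sigma> = OneInd (subst C (up \<sigma>)) (subst c \<sigma>) (subst e \<sigma>)"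
| "subst (Plus A B) \<sigma> = Plus (subst A \<sigma>) (subst B \<sigma>)"
| "subst (Inl a) \<sigma> = Inl (subst a \<sigma>)"
| "subst (Inr b) \<sigma> = Inr (subst b \<sigma>)"
| "subst (Cases C c d e) \<sigma> =
     Cases (subst C (up \<sigma>)) (subst c (up \<sigma>)) (subst d (up \<sigma>)) (subst e \<sigma>)"
| "subst Nat \<sigma> = Nat"
| "subst Zero \<sigma> = Zero"
| "subst (Succ n) \<sigma> = Succ (subst n \<sigma>)"
| "subst (NatInd C c0 cs n) \<sigma> =
     NatInd (subst C (up \<sigma>)) (subst c0 \<sigma>) (subst cs (up (up \<sigma>))) (subst n \<sigma>)"
| "subst (Eql A a b) \<sigma> = Eql (subst A \<sigma>) (subst a \<sigma>) (subst b \<sigma>)"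
| "subst (Refl a) \<sigma> = Refl (subst a \<sigma>)"
| "subst (J C c a b p) \<sigma> =
     J (subst C (up (up (up \<sigma>)))) (subst c (up \<sigma>)) (subst a \<sigma>) (subst b \<sigma>) (subst p \<sigma>)"
| "subst (PTr A) \<sigma> = PTr (subst A \<sigma>)"
| "subst (PIn a) \<sigma> = PIn (subst a \<sigma>)"
| "subst (PEq x y) \<sigma> = PEq (subst x \<sigma>) (subst y \<sigma>)"
| "subst (PInd C c h t) \<sigma> =
     PInd (subst C (up \<sigma>)) (subst c (up \<sigma>)) (subst h (up \<sigma>)) (subst t \<sigma>)"
| "subst (STr A) \<sigma> = STr (subst A \<sigma>)"
| "subst (SIn a) \<sigma> = SIn (subst a \<sigma>)"
| "subst (SEq x y p q) \<sigma> = SEq (subst x \<sigma>) (subst y \<sigma>) (subst p \<sigma>) (subst q \<sigma>)"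
| "subst (SInd C c h t) \<sigma> =
     SInd (subst C (up \<sigma>)) (subst c (up \<sigma>)) (subst h (up \<sigma>)) (subst t \<sigma>)"
| "subst (FunExt f g) \<sigma> = FunExt (subst f \<sigma>) (subst g \<sigma>)"
| "subst (UA i A B) \<sigma> = UA i (subst A \<sigma>) (subst B \<sigma>)"

primrec scons :: "tm \<Rightarrow> (nat \<Rightarrow> tm) \<Rightarrow> nat \<Rightarrow> tm" (infixr "\<cdot>" 60) where
  "(t \<cdot> \<sigma>) 0 = t"
| "(t \<cdot> \<sigma>) (Suc k) = \<sigma> k"

definition sh :: "nat \<Rightarrow> nat \<Rightarrow> tm" where
  "sh n k = Var (k + n)"

text \<open>
  \<open>wk n t\<close> is \<open>t\<close> weakened by \<open>n\<close> fresh variables.  If \<open>B\<close> lives over \<open>\<Gamma>, x : A\<close> and \<open>a\<close> over \<open>\<Gamma>\<close>, then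
  \<open>B\<langle>a \<cdot> Var\<rangle>\<close> is \<open>B[a/x]\<close>; more generally \<open>B\<langle>t \<cdot> sh n\<rangle>\<close> is \<open>B[t/x]\<close> in a context extending \<open>\<Gamma>\<close> by \<open>n\<close>
  variables, where \<open>t\<close> may mention those.
\<close>

definition wk :: "nat \<Rightarrow> tm \<Rightarrow> tm" where
  "wk n t = t\<langle>sh n\<rangle>"

section \<open>Notions needed to state the rules\<close>

definition Arr :: "tm \<Rightarrow> tm \<Rightarrow> tm" where
  "Arr A B = Pi A (wk 1 B)"

definition Prod :: "tm \<Rightarrow> tm \<Rightarrow> tm" where
  "Prod A B = Sig A (wk 1 B)"

(* Pi (x y : A). x = y *)
definition isProp :: "tm \<Rightarrow> tm" where
  "isProp A = Pi A (Pi (wk 1 A) (Eql (wk 2 A) (Var 1) (Var 0)))"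

(* Pi (x y : A) (p q : x = y). p = q *)
definition isSet :: "tm \<Rightarrow> tm" where
  "isSet A = Pi A (Pi (wk 1 A) (Pi (Eql (wk 2 A) (Var 1) (Var 0))
     (Pi (Eql (wk 3 A) (Var 2) (Var 1)) (Eql (Eql (wk 4 A) (Var 3) (Var 2)) (Var 1) (Var 0)))))"

(* (Sigma (g : B -> A). Pi (y : B). f (g y) = y) x (Sigma (h : B -> A). Pi (x : A). h (f x) = x) *)
definition isEquiv :: "tm \<Rightarrow> tm \<Rightarrow> tm \<Rightarrow> tm" where
  "isEquiv A B f = Prod
     (Sig (Arr B A)
        (Pi (wk 1 B) (Eql (wk 2 B) (App (wk 2 f) (App (Var 1) (Var 0))) (Var 0))))
     (Sig (Arr B A)
        (Pi (wk 1 A) (Eql (wk 2 A) (App (Var 1) (App (wk 2 f) (Var 0))) (Var 0))))"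

definition Equiv :: "tm \<Rightarrow> tm \<Rightarrow> tm" where
  "Equiv A B = Sig (Arr A B) (isEquiv (wk 1 A) (wk 1 B) (Var 0))"

definition idEquiv :: "tm \<Rightarrow> tm" where
  "idEquiv A = (let i = Tup (Lam A (Var 0)) (Lam A (Refl (Var 0))) in Tup (Lam A (Var 0)) (Tup i i))"

(* p : A = B in a universe; by induction on p, sending refl to the identity equivalence *)
definition idtoeqv :: "tm \<Rightarrow> tm \<Rightarrow> tm \<Rightarrow> tm" where
  "idtoeqv A B p = J (Equiv (Var 2) (Var 1)) (idEquiv (Var 0)) A B p"

(* f, g : Pi (x : A). B *)
definition homotopy :: "tm \<Rightarrow> tm \<Rightarrow> tm \<Rightarrow> tm \<Rightarrow> tm" where
  "homotopy A B f g = Pi A (Eql B (App (wk 1 f) (Var 0)) (App (wk 1 g) (Var 0)))"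

(* p : f = g in Pi (x : A). B; by induction on p, sending refl to \<lambda>x. refl *)
definition happly :: "tm \<Rightarrow> tm \<Rightarrow> tm \<Rightarrow> tm \<Rightarrow> tm \<Rightarrow> tm" where
  "happly A B f g p =
     J (homotopy (wk 3 A) (B\<langle>Var 0 \<cdot> sh 4\<rangle>) (Var 2) (Var 1))
       (Lam (wk 1 A) (Refl (App (Var 1) (Var 0)))) f g p"

section \<open>Judgements\<close>

text \<open>
  The hypothesis \<open>\<Gamma> ! k\<close> lives over the hypotheses after it in the list, hence the weakening in rule
  \<open>Var\<close>.  Rules \<open>Subst\<close> and \<open>EqSubst\<close>, often presented as admissible, give weakening, substitution and the congruence rules of the
  non-binding term formers; congruence for term formers with binders is given separately.
\<close>

inductive wf_ctx :: "tm list \<Rightarrow> bool"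
  and has_type :: "tm list \<Rightarrow> tm \<Rightarrow> tm \<Rightarrow> bool" ("_ \<turnstile> _ \<^bold>: _" [50, 51, 51] 50)
  and jdg_eq :: "tm list \<Rightarrow> tm \<Rightarrow> tm \<Rightarrow> tm \<Rightarrow> bool" ("_ \<turnstile> _ \<doteq> _ \<^bold>: _" [50, 51, 51, 51] 50)
where
  CtxNil: "wf_ctx []"
| CtxCons: "\<Gamma> \<turnstile> A \<^bold>: Univ i \<Longrightarrow> wf_ctx (A # \<Gamma>)"

| Var: "wf_ctx \<Gamma> \<Longrightarrow> k < length \<Gamma> \<Longrightarrow> \<Gamma> \<turnstile> Var k \<^bold>: wk (Suc k) (\<Gamma> ! k)"
| Conv: "\<Gamma> \<turnstile> t \<^bold>: A \<Longrightarrow> \<Gamma> \<turnstile> A \<doteq> B \<^bold>: Univ i \<Longrightarrow> \<Gamma> \<turnstile> t \<^bold>: B"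
| EqConv: "\<Gamma> \<turnstile> s \<doteq> t \<^bold>: A \<Longrightarrow> \<Gamma> \<turnstile> A \<doteq> B \<^bold>: Univ i \<Longrightarrow> \<Gamma> \<turnstile> s \<doteq> t \<^bold>: B"
| EqRefl: "\<Gamma> \<turnstile> t \<^bold>: A \<Longrightarrow> \<Gamma> \<turnstile> t \<doteq> t \<^bold>: A"
| EqSym: "\<Gamma> \<turnstile> s \<doteq> t \<^bold>: A \<Longrightarrow> \<Gamma> \<turnstile> t \<doteq> s \<^bold>: A"
| EqTrans: "\<Gamma> \<turnstile> s \<doteq> t \<^bold>: A \<Longrightarrow> \<Gamma> \<turnstile> t \<doteq> u \<^bold>: A \<Longrightarrow> \<Gamma> \<turnstile> s \<doteq> u \<^bold>: A"
| Subst: "\<Gamma> \<turnstile> t \<^bold>: A \<Longrightarrow> wf_ctx \<Delta> \<Longrightarrow>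
    (\<forall>k<length \<Gamma>. \<Delta> \<turnstile> \<sigma> k \<^bold>: (wk (Suc k) (\<Gamma> ! k))\<langle>\<sigma>\<rangle>) \<Longrightarrow> \<Delta> \<turnstile> t\<langle>\<sigma>\<rangle> \<^bold>: A\<langle>\<sigma>\<rangle>"
| EqSubst: "\<Gamma> \<turnstile> s \<doteq> t \<^bold>: A \<Longrightarrow> wf_ctx \<Delta> \<Longrightarrow>
    (\<forall>k<length \<Gamma>. \<Delta> \<turnstile> \<sigma> k \<doteq> \<tau> k \<^bold>: (wk (Suc k) (\<Gamma> ! k))\<langle>\<sigma>\<rangle>) \<Longrightarrow> \<Delta> \<turnstile> s\<langle>\<sigma>\<rangle> \<doteq> t\<langle>\<tau>\<rangle> \<^bold>: A\<langle>\<sigma>\<rangle>"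

| UnivF: "wf_ctx \<Gamma> \<Longrightarrow> \<Gamma> \<turnstile> Univ i \<^bold>: Univ (Suc i)"
| Cumul: "\<Gamma> \<turnstile> A \<^bold>: Univ i \<Longrightarrow> \<Gamma> \<turnstile> A \<^bold>: Univ (Suc i)"
| EqCumul: "\<Gamma> \<turnstile> A \<doteq> B \<^bold>: Univ i \<Longrightarrow> \<Gamma> \<turnstile> A \<doteq> B \<^bold>: Univ (Suc i)"

| PiF: "\<Gamma> \<turnstile> A \<^bold>: Univ i \<Longrightarrow> A # \<Gamma> \<turnstile> B \<^bold>: Univ i \<Longrightarrow> \<Gamma> \<turnstile> Pi A B \<^bold>: Univ i"
| PiI: "\<Gamma> \<turnstile> A \<^bold>: Univ i \<Longrightarrow> A # \<Gamma> \<turnstile> b \<^bold>: B \<Longrightarrow> \<Gamma> \<turnstile> Lam A b \<^bold>: Pi A B"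
| PiE: "\<Gamma> \<turnstile> f \<^bold>: Pi A B \<Longrightarrow> \<Gamma> \<turnstile> a \<^bold>: A \<Longrightarrow> \<Gamma> \<turnstile> App f a \<^bold>: B\<langle>a \<cdot> Var\<rangle>"
| PiBeta: "A # \<Gamma> \<turnstile> b \<^bold>: B \<Longrightarrow> \<Gamma> \<turnstile> a \<^bold>: A \<Longrightarrow>
    \<Gamma> \<turnstile> App (Lam A b) a \<doteq> b\<langle>a \<cdot> Var\<rangle> \<^bold>: B\<langle>a \<cdot> Var\<rangle>"
| PiEta: "\<Gamma> \<turnstile> f \<^bold>: Pi A B \<Longrightarrow> \<Gamma> \<turnstile> f \<doteq> Lam A (App (wk 1 f) (Var 0)) \<^bold>: Pi A B"
| PiCong: "\<Gamma> \<turnstile> A \<doteq> A' \<^bold>: Univ i \<Longrightarrow> A # \<Gamma> \<turnstile> B \<doteq> B' \<^bold>: Univ i \<Longrightarrow> \<Gamma> \<turnstile> Pi A B \<doteq> Pi A' B' \<^bold>: Univ i"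
| LamCong: "\<Gamma> \<turnstile> A \<doteq> A' \<^bold>: Univ i \<Longrightarrow> A # \<Gamma> \<turnstile> b \<doteq> b' \<^bold>: B \<Longrightarrow> \<Gamma> \<turnstile> Lam A b \<doteq> Lam A' b' \<^bold>: Pi A B"

| SigF: "\<Gamma> \<turnstile> A \<^bold>: Univ i \<Longrightarrow> A # \<Gamma> \<turnstile> B \<^bold>: Univ i \<Longrightarrow> \<Gamma> \<turnstile> Sig A B \<^bold>: Univ i"
| SigI: "A # \<Gamma> \<turnstile> B \<^bold>: Univ i \<Longrightarrow> \<Gamma> \<turnstile> a \<^bold>: A \<Longrightarrow> \<Gamma> \<turnstile> b \<^bold>: B\<langle>a \<cdot> Var\<rangle> \<Longrightarrow> \<Gamma> \<turnstile> Tup a b \<^bold>: Sig A B"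
| SigE: "Sig A B # \<Gamma> \<turnstile> C \<^bold>: Univ i \<Longrightarrow> B # A # \<Gamma> \<turnstile> g \<^bold>: C\<langle>Tup (Var 1) (Var 0) \<cdot> sh 2\<rangle> \<Longrightarrow>
    \<Gamma> \<turnstile> p \<^bold>: Sig A B \<Longrightarrow> \<Gamma> \<turnstile> Split C g p \<^bold>: C\<langle>p \<cdot> Var\<rangle>"
| SigBeta: "Sig A B # \<Gamma> \<turnstile> C \<^bold>: Univ i \<Longrightarrow> B # A # \<Gamma> \<turnstile> g \<^bold>: C\<langle>Tup (Var 1) (Var 0) \<cdot> sh 2\<rangle> \<Longrightarrow>
    \<Gamma> \<turnstile> a \<^bold>: A \<Longrightarrow> \<Gamma> \<turnstile> b \<^bold>: B\<langle>a \<cdot> Var\<rangle> \<Longrightarrow>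
    \<Gamma> \<turnstile> Split C g (Tup a b) \<doteq> g\<langle>b \<cdot> a \<cdot> Var\<rangle> \<^bold>: C\<langle>Tup a b \<cdot> Var\<rangle>"
| SigCong: "\<Gamma> \<turnstile> A \<doteq> A' \<^bold>: Univ i \<Longrightarrow> A # \<Gamma> \<turnstile> B \<doteq> B' \<^bold>: Univ i \<Longrightarrow>
    \<Gamma> \<turnstile> Sig A B \<doteq> Sig A' B' \<^bold>: Univ i"
| SplitCong: "Sig A B # \<Gamma> \<turnstile> C \<doteq> C' \<^bold>: Univ i \<Longrightarrow>
    B # A # \<Gamma> \<turnstile> g \<doteq> g' \<^bold>: C\<langle>Tup (Var 1) (Var 0) \<cdot> sh 2\<rangle> \<Longrightarrow>
    \<Gamma> \<turnstile> p \<doteq> p' \<^bold>: Sig A B \<Longrightarrow> \<Gamma> \<turnstile> Split C g p \<doteq> Split C' g' p' \<^bold>: C\<langle>p \<cdot> Var\<rangle>"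

| EmptyF: "wf_ctx \<Gamma> \<Longrightarrow> \<Gamma> \<turnstile> Empty \<^bold>: Univ i"
| EmptyE: "Empty # \<Gamma> \<turnstile> C \<^bold>: Univ i \<Longrightarrow> \<Gamma> \<turnstile> e \<^bold>: Empty \<Longrightarrow> \<Gamma> \<turnstile> Abort C e \<^bold>: C\<langle>e \<cdot> Var\<rangle>"
| AbortCong: "Empty # \<Gamma> \<turnstile> C \<doteq> C' \<^bold>: Univ i \<Longrightarrow> \<Gamma> \<turnstile> e \<doteq> e' \<^bold>: Empty \<Longrightarrow>
    \<Gamma> \<turnstile> Abort C e \<doteq> Abort C' e' \<^bold>: C\<langle>e \<cdot> Var\<rangle>"

| OneF: "wf_ctx \<Gamma> \<Longrightarrow> \<Gamma> \<turnstile> One \<^bold>: Univ i"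
| OneI: "wf_ctx \<Gamma> \<Longrightarrow> \<Gamma> \<turnstile> Star \<^bold>: One"
| OneE: "One # \<Gamma> \<turnstile> C \<^bold>: Univ i \<Longrightarrow> \<Gamma> \<turnstile> c \<^bold>: C\<langle>Star \<cdot> Var\<rangle> \<Longrightarrow> \<Gamma> \<turnstile> e \<^bold>: One \<Longrightarrow>
    \<Gamma> \<turnstile> OneInd C c e \<^bold>: C\<langle>e \<cdot> Var\<rangle>"
| OneBeta: "One # \<Gamma> \<turnstile> C \<^bold>: Univ i \<Longrightarrow> \<Gamma> \<turnstile> c \<^bold>: C\<langle>Star \<cdot> Var\<rangle> \<Longrightarrow>
    \<Gamma> \<turnstile> OneInd C c Star \<doteq> c \<^bold>: C\<langle>Star \<cdot> Var\<rangle>"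
| OneIndCong: "One # \<Gamma> \<turnstile> C \<doteq> C' \<^bold>: Univ i \<Longrightarrow> \<Gamma> \<turnstile> c \<doteq> c' \<^bold>: C\<langle>Star \<cdot> Var\<rangle> \<Longrightarrow> \<Gamma> \<turnstile> e \<doteq> e' \<^bold>: One \<Longrightarrow>
    \<Gamma> \<turnstile> OneInd C c e \<doteq> OneInd C' c' e' \<^bold>: C\<langle>e \<cdot> Var\<rangle>"

| PlusF: "\<Gamma> \<turnstile> A \<^bold>: Univ i \<Longrightarrow> \<Gamma> \<turnstile> B \<^bold>: Univ i \<Longrightarrow> \<Gamma> \<turnstile> Plus A B \<^bold>: Univ i"
| PlusIl: "\<Gamma> \<turnstile> a \<^bold>: A \<Longrightarrow> \<Gamma> \<turnstile> B \<^bold>: Univ i \<Longrightarrow> \<Gamma> \<turnstile> Inl a \<^bold>: Plus A B"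
| PlusIr: "\<Gamma> \<turnstile> A \<^bold>: Univ i \<Longrightarrow> \<Gamma> \<turnstile> b \<^bold>: B \<Longrightarrow> \<Gamma> \<turnstile> Inr b \<^bold>: Plus A B"
| PlusE: "Plus A B # \<Gamma> \<turnstile> C \<^bold>: Univ i \<Longrightarrow> A # \<Gamma> \<turnstile> c \<^bold>: C\<langle>Inl (Var 0) \<cdot> sh 1\<rangle> \<Longrightarrow>
    B # \<Gamma> \<turnstile> d \<^bold>: C\<langle>Inr (Var 0) \<cdot> sh 1\<rangle> \<Longrightarrow> \<Gamma> \<turnstile> e \<^bold>: Plus A B \<Longrightarrow> \<Gamma> \<turnstile> Cases C c d e \<^bold>: C\<langle>e \<cdot> Var\<rangle>"
| PlusBetal: "Plus A B # \<Gamma> \<turnstile> C \<^bold>: Univ i \<Longrightarrow> A # \<Gamma> \<turnstile> c \<^bold>: C\<langle>Inl (Var 0) \<cdot> sh 1\<rangle> \<Longrightarrow>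
    B # \<Gamma> \<turnstile> d \<^bold>: C\<langle>Inr (Var 0) \<cdot> sh 1\<rangle> \<Longrightarrow> \<Gamma> \<turnstile> a \<^bold>: A \<Longrightarrow>
    \<Gamma> \<turnstile> Cases C c d (Inl a) \<doteq> c\<langle>a \<cdot> Var\<rangle> \<^bold>: C\<langle>Inl a \<cdot> Var\<rangle>"
| PlusBetar: "Plus A B # \<Gamma> \<turnstile> C \<^bold>: Univ i \<Longrightarrow> A # \<Gamma> \<turnstile> c \<^bold>: C\<langle>Inl (Var 0) \<cdot> sh 1\<rangle> \<Longrightarrow>
    B # \<Gamma> \<turnstile> d \<^bold>: C\<langle>Inr (Var 0) \<cdot> sh 1\<rangle> \<Longrightarrow> \<Gamma> \<turnstile> b \<^bold>: B \<Longrightarrow>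
    \<Gamma> \<turnstile> Cases C c d (Inr b) \<doteq> d\<langle>b \<cdot> Var\<rangle> \<^bold>: C\<langle>Inr b \<cdot> Var\<rangle>"
| CasesCong: "Plus A B # \<Gamma> \<turnstile> C \<doteq> C' \<^bold>: Univ i \<Longrightarrow> A # \<Gamma> \<turnstile> c \<doteq> c' \<^bold>: C\<langle>Inl (Var 0) \<cdot> sh 1\<rangle> \<Longrightarrow>
    B # \<Gamma> \<turnstile> d \<doteq> d' \<^bold>: C\<langle>Inr (Var 0) \<cdot> sh 1\<rangle> \<Longrightarrow> \<Gamma> \<turnstile> e \<doteq> e' \<^bold>: Plus A B \<Longrightarrow>
    \<Gamma> \<turnstile> Cases C c d e \<doteq> Cases C' c' d' e' \<^bold>: C\<langle>e \<cdot> Var\<rangle>"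

| NatF: "wf_ctx \<Gamma> \<Longrightarrow> \<Gamma> \<turnstile> Nat \<^bold>: Univ i"
| NatI0: "wf_ctx \<Gamma> \<Longrightarrow> \<Gamma> \<turnstile> Zero \<^bold>: Nat"
| NatIS: "\<Gamma> \<turnstile> n \<^bold>: Nat \<Longrightarrow> \<Gamma> \<turnstile> Succ n \<^bold>: Nat"
| NatE: "Nat # \<Gamma> \<turnstile> C \<^bold>: Univ i \<Longrightarrow> \<Gamma> \<turnstile> c0 \<^bold>: C\<langle>Zero \<cdot> Var\<rangle> \<Longrightarrow>
    C # Nat # \<Gamma> \<turnstile> cs \<^bold>: C\<langle>Succ (Var 1) \<cdot> sh 2\<rangle> \<Longrightarrow> \<Gamma> \<turnstile> n \<^bold>: Nat \<Longrightarrow>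
    \<Gamma> \<turnstile> NatInd C c0 cs n \<^bold>: C\<langle>n \<cdot> Var\<rangle>"
| NatBeta0: "Nat # \<Gamma> \<turnstile> C \<^bold>: Univ i \<Longrightarrow> \<Gamma> \<turnstile> c0 \<^bold>: C\<langle>Zero \<cdot> Var\<rangle> \<Longrightarrow>
    C # Nat # \<Gamma> \<turnstile> cs \<^bold>: C\<langle>Succ (Var 1) \<cdot> sh 2\<rangle> \<Longrightarrow>
    \<Gamma> \<turnstile> NatInd C c0 cs Zero \<doteq> c0 \<^bold>: C\<langle>Zero \<cdot> Var\<rangle>"
| NatBetaS: "Nat # \<Gamma> \<turnstile> C \<^bold>: Univ i \<Longrightarrow> \<Gamma> \<turnstile> c0 \<^bold>: C\<langle>Zero \<cdot> Var\<rangle> \<Longrightarrow>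
    C # Nat # \<Gamma> \<turnstile> cs \<^bold>: C\<langle>Succ (Var 1) \<cdot> sh 2\<rangle> \<Longrightarrow> \<Gamma> \<turnstile> n \<^bold>: Nat \<Longrightarrow>
    \<Gamma> \<turnstile> NatInd C c0 cs (Succ n) \<doteq> cs\<langle>NatInd C c0 cs n \<cdot> n \<cdot> Var\<rangle> \<^bold>: C\<langle>Succ n \<cdot> Var\<rangle>"
| NatIndCong: "Nat # \<Gamma> \<turnstile> C \<doteq> C' \<^bold>: Univ i \<Longrightarrow> \<Gamma> \<turnstile> c0 \<doteq> c0' \<^bold>: C\<langle>Zero \<cdot> Var\<rangle> \<Longrightarrow>
    C # Nat # \<Gamma> \<turnstile> cs \<doteq> cs' \<^bold>: C\<langle>Succ (Var 1) \<cdot> sh 2\<rangle> \<Longrightarrow> \<Gamma> \<turnstile> n \<doteq> n' \<^bold>: Nat \<Longrightarrow>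
    \<Gamma> \<turnstile> NatInd C c0 cs n \<doteq> NatInd C' c0' cs' n' \<^bold>: C\<langle>n \<cdot> Var\<rangle>"

| EqlF: "\<Gamma> \<turnstile> A \<^bold>: Univ i \<Longrightarrow> \<Gamma> \<turnstile> a \<^bold>: A \<Longrightarrow> \<Gamma> \<turnstile> b \<^bold>: A \<Longrightarrow> \<Gamma> \<turnstile> Eql A a b \<^bold>: Univ i"
| EqlI: "\<Gamma> \<turnstile> a \<^bold>: A \<Longrightarrow> \<Gamma> \<turnstile> Refl a \<^bold>: Eql A a a"
| EqlE: "Eql (wk 2 A) (Var 1) (Var 0) # wk 1 A # A # \<Gamma> \<turnstile> C \<^bold>: Univ i \<Longrightarrow>
    A # \<Gamma> \<turnstile> c \<^bold>: C\<langle>Refl (Var 0) \<cdot> Var 0 \<cdot> Var 0 \<cdot> sh 1\<rangle> \<Longrightarrow>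
    \<Gamma> \<turnstile> a \<^bold>: A \<Longrightarrow> \<Gamma> \<turnstile> b \<^bold>: A \<Longrightarrow> \<Gamma> \<turnstile> p \<^bold>: Eql A a b \<Longrightarrow> \<Gamma> \<turnstile> J C c a b p \<^bold>: C\<langle>p \<cdot> b \<cdot> a \<cdot> Var\<rangle>"
| EqlBeta: "Eql (wk 2 A) (Var 1) (Var 0) # wk 1 A # A # \<Gamma> \<turnstile> C \<^bold>: Univ i \<Longrightarrow>
    A # \<Gamma> \<turnstile> c \<^bold>: C\<langle>Refl (Var 0) \<cdot> Var 0 \<cdot> Var 0 \<cdot> sh 1\<rangle> \<Longrightarrow> \<Gamma> \<turnstile> a \<^bold>: A \<Longrightarrow>
    \<Gamma> \<turnstile> J C c a a (Refl a) \<doteq> c\<langle>a \<cdot> Var\<rangle> \<^bold>: C\<langle>Refl a \<cdot> a \<cdot> a \<cdot> Var\<rangle>"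
| JCong: "Eql (wk 2 A) (Var 1) (Var 0) # wk 1 A # A # \<Gamma> \<turnstile> C \<doteq> C' \<^bold>: Univ i \<Longrightarrow>
    A # \<Gamma> \<turnstile> c \<doteq> c' \<^bold>: C\<langle>Refl (Var 0) \<cdot> Var 0 \<cdot> Var 0 \<cdot> sh 1\<rangle> \<Longrightarrow>
    \<Gamma> \<turnstile> a \<doteq> a' \<^bold>: A \<Longrightarrow> \<Gamma> \<turnstile> b \<doteq> b' \<^bold>: A \<Longrightarrow> \<Gamma> \<turnstile> p \<doteq> p' \<^bold>: Eql A a b \<Longrightarrow>
    \<Gamma> \<turnstile> J C c a b p \<doteq> J C' c' a' b' p' \<^bold>: C\<langle>p \<cdot> b \<cdot> a \<cdot> Var\<rangle>"

| PTrF: "\<Gamma> \<turnstile> A \<^bold>: Univ i \<Longrightarrow> \<Gamma> \<turnstile> PTr A \<^bold>: Univ i"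
| PTrI: "\<Gamma> \<turnstile> a \<^bold>: A \<Longrightarrow> \<Gamma> \<turnstile> PIn a \<^bold>: PTr A"
| PTrEq: "\<Gamma> \<turnstile> x \<^bold>: PTr A \<Longrightarrow> \<Gamma> \<turnstile> y \<^bold>: PTr A \<Longrightarrow> \<Gamma> \<turnstile> PEq x y \<^bold>: Eql (PTr A) x y"
| PTrE: "PTr A # \<Gamma> \<turnstile> C \<^bold>: Univ i \<Longrightarrow> A # \<Gamma> \<turnstile> c \<^bold>: C\<langle>PIn (Var 0) \<cdot> sh 1\<rangle> \<Longrightarrow>
    PTr A # \<Gamma> \<turnstile> h \<^bold>: isProp C \<Longrightarrow> \<Gamma> \<turnstile> t \<^bold>: PTr A \<Longrightarrow> \<Gamma> \<turnstile> PInd C c h t \<^bold>: C\<langle>t \<cdot> Var\<rangle>"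
| PTrBeta: "PTr A # \<Gamma> \<turnstile> C \<^bold>: Univ i \<Longrightarrow> A # \<Gamma> \<turnstile> c \<^bold>: C\<langle>PIn (Var 0) \<cdot> sh 1\<rangle> \<Longrightarrow>
    PTr A # \<Gamma> \<turnstile> h \<^bold>: isProp C \<Longrightarrow> \<Gamma> \<turnstile> a \<^bold>: A \<Longrightarrow>
    \<Gamma> \<turnstile> PInd C c h (PIn a) \<doteq> c\<langle>a \<cdot> Var\<rangle> \<^bold>: C\<langle>PIn a \<cdot> Var\<rangle>"
| PIndCong: "PTr A # \<Gamma> \<turnstile> C \<doteq> C' \<^bold>: Univ i \<Longrightarrow> A # \<Gamma> \<turnstile> c \<doteq> c' \<^bold>: C\<langle>PIn (Var 0) \<cdot> sh 1\<rangle> \<Longrightarrow>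
    PTr A # \<Gamma> \<turnstile> h \<doteq> h' \<^bold>: isProp C \<Longrightarrow> \<Gamma> \<turnstile> t \<doteq> t' \<^bold>: PTr A \<Longrightarrow>
    \<Gamma> \<turnstile> PInd C c h t \<doteq> PInd C' c' h' t' \<^bold>: C\<langle>t \<cdot> Var\<rangle>"

| STrF: "\<Gamma> \<turnstile> A \<^bold>: Univ i \<Longrightarrow> \<Gamma> \<turnstile> STr A \<^bold>: Univ i"
| STrI: "\<Gamma> \<turnstile> a \<^bold>: A \<Longrightarrow> \<Gamma> \<turnstile> SIn a \<^bold>: STr A"
| STrEq: "\<Gamma> \<turnstile> x \<^bold>: STr A \<Longrightarrow> \<Gamma> \<turnstile> y \<^bold>: STr A \<Longrightarrow> \<Gamma> \<turnstile> p \<^bold>: Eql (STr A) x y \<Longrightarrow>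
    \<Gamma> \<turnstile> q \<^bold>: Eql (STr A) x y \<Longrightarrow> \<Gamma> \<turnstile> SEq x y p q \<^bold>: Eql (Eql (STr A) x y) p q"
| STrE: "STr A # \<Gamma> \<turnstile> C \<^bold>: Univ i \<Longrightarrow> A # \<Gamma> \<turnstile> c \<^bold>: C\<langle>SIn (Var 0) \<cdot> sh 1\<rangle> \<Longrightarrow>
    STr A # \<Gamma> \<turnstile> h \<^bold>: isSet C \<Longrightarrow> \<Gamma> \<turnstile> t \<^bold>: STr A \<Longrightarrow> \<Gamma> \<turnstile> SInd C c h t \<^bold>: C\<langle>t \<cdot> Var\<rangle>"
| STrBeta: "STr A # \<Gamma> \<turnstile> C \<^bold>: Univ i \<Longrightarrow> A # \<Gamma> \<turnstile> c \<^bold>: C\<langle>SIn (Var 0) \<cdot> sh 1\<rangle> \<Longrightarrow>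
    STr A # \<Gamma> \<turnstile> h \<^bold>: isSet C \<Longrightarrow> \<Gamma> \<turnstile> a \<^bold>: A \<Longrightarrow>
    \<Gamma> \<turnstile> SInd C c h (SIn a) \<doteq> c\<langle>a \<cdot> Var\<rangle> \<^bold>: C\<langle>SIn a \<cdot> Var\<rangle>"
| SIndCong: "STr A # \<Gamma> \<turnstile> C \<doteq> C' \<^bold>: Univ i \<Longrightarrow> A # \<Gamma> \<turnstile> c \<doteq> c' \<^bold>: C\<langle>SIn (Var 0) \<cdot> sh 1\<rangle> \<Longrightarrow>
    STr A # \<Gamma> \<turnstile> h \<doteq> h' \<^bold>: isSet C \<Longrightarrow> \<Gamma> \<turnstile> t \<doteq> t' \<^bold>: STr A \<Longrightarrow>
    \<Gamma> \<turnstile> SInd C c h t \<doteq> SInd C' c' h' t' \<^bold>: C\<langle>t \<cdot> Var\<rangle>"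

| FunExtAx: "\<Gamma> \<turnstile> f \<^bold>: Pi A B \<Longrightarrow> \<Gamma> \<turnstile> g \<^bold>: Pi A B \<Longrightarrow>
    \<Gamma> \<turnstile> FunExt f g \<^bold>: isEquiv (Eql (Pi A B) f g) (homotopy A B f g)
      (Lam (Eql (Pi A B) f g) (happly (wk 1 A) (B\<langle>Var 0 \<cdot> sh 2\<rangle>) (wk 1 f) (wk 1 g) (Var 0)))"

| UAAx: "\<Gamma> \<turnstile> A \<^bold>: Univ i \<Longrightarrow> \<Gamma> \<turnstile> B \<^bold>: Univ i \<Longrightarrow>
    \<Gamma> \<turnstile> UA i A B \<^bold>: isEquiv (Eql (Univ i) A B) (Equiv A B)
      (Lam (Eql (Univ i) A B) (idtoeqv (wk 1 A) (wk 1 B) (Var 0)))"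

section \<open>Connectedness, transport and homotopy groups\<close>

text \<open>
  From here on every definition is a notion of the object theory: its arguments and its value are
  terms over one and the same context, except for arguments said to be families \<open>x. P\<close>.
\<close>

definition Iff :: "tm \<Rightarrow> tm \<Rightarrow> tm" where
  "Iff A B = Prod (Arr A B) (Arr B A)"

definition proj1 :: "tm \<Rightarrow> tm \<Rightarrow> tm" where
  "proj1 A p = Split (wk 1 A) (Var 1) p"

(* p : Sig A (x. B) *)
definition proj2 :: "tm \<Rightarrow> tm \<Rightarrow> tm \<Rightarrow> tm" where
  "proj2 A B p = Split (B\<langle>proj1 (wk 1 A) (Var 0) \<cdot> sh 1\<rangle>) (Var 0) p"

(* Pi (x y : X). || x = y || *)
definition isConn :: "tm \<Rightarrow> tm" where
  "isConn X = Pi X (Pi (wk 1 X) (PTr (Eql (wk 2 X) (Var 1) (Var 0))))"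

(* for a family x. P over A and p : a = b in A, the function P[a] -> P[b]; transport along refl is
   the identity *)
definition transport :: "tm \<Rightarrow> tm \<Rightarrow> tm \<Rightarrow> tm \<Rightarrow> tm" where
  "transport P a b p = J (Arr (P\<langle>Var 2 \<cdot> sh 3\<rangle>) (P\<langle>Var 1 \<cdot> sh 3\<rangle>)) (Lam P (Var 0)) a b p"

(* p : a = b in A *)
definition path_inv :: "tm \<Rightarrow> tm \<Rightarrow> tm \<Rightarrow> tm \<Rightarrow> tm" where
  "path_inv A a b p = J (Eql (wk 3 A) (Var 1) (Var 2)) (Refl (Var 0)) a b p"

(* p : a = b and q : b = c in A; the composite is the transport of p along q in the family z. a = z *)
definition path_comp :: "tm \<Rightarrow> tm \<Rightarrow> tm \<Rightarrow> tm \<Rightarrow> tm \<Rightarrow> tm \<Rightarrow> tm" where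
  "path_comp A a b c p q = App (transport (Eql (wk 1 A) (wk 1 a) (Var 0)) b c q) p"

definition Pointed :: "nat \<Rightarrow> tm" where
  "Pointed i = Sig (Univ i) (Var 0)"

definition carrier :: "nat \<Rightarrow> tm \<Rightarrow> tm" where
  "carrier i P = proj1 (Univ i) P"

definition point :: "nat \<Rightarrow> tm \<Rightarrow> tm" where
  "point i P = proj2 (Univ i) (Var 0) P"

definition Loop :: "nat \<Rightarrow> tm \<Rightarrow> tm" where
  "Loop i P = Tup (Eql (carrier i P) (point i P) (point i P)) (Refl (point i P))"

definition Loops :: "nat \<Rightarrow> tm \<Rightarrow> tm \<Rightarrow> tm \<Rightarrow> tm" where
  "Loops i n X x = NatInd (Pointed i) (Tup X x) (Loop i (Var 0)) n"

definition hgroup :: "nat \<Rightarrow> tm \<Rightarrow> tm \<Rightarrow> tm \<Rightarrow> tm" where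
  "hgroup i n X x = STr (carrier i (Loops i n X x))"

(* the family x. pi_n(X, x) over X *)
definition hgroup_fam :: "nat \<Rightarrow> tm \<Rightarrow> tm \<Rightarrow> tm" where
  "hgroup_fam i n X = hgroup i (wk 1 n) (wk 1 X) (Var 0)"

(* STr A is a set *)
definition STr_isSet :: "tm \<Rightarrow> tm" where
  "STr_isSet A = Lam (STr A) (Lam (STr (wk 1 A)) (Lam (Eql (STr (wk 2 A)) (Var 1) (Var 0))
     (Lam (Eql (STr (wk 3 A)) (Var 2) (Var 1)) (SEq (Var 3) (Var 2) (Var 1) (Var 0)))))"

text \<open>
  The product of \<open>u, v : \<pi>\<^sub>m\<^sub>+\<^sub>1(X, x)\<close>, determined by \<open>|p|\<^sub>0 |q|\<^sub>0 = |p q|\<^sub>0\<close>: the carrier of \<open>\<Omega>\<^sup>m\<^sup>+\<^sup>1(X, x)\<close> is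
  judgementally the type of loops at the point of \<open>\<Omega>\<^sup>m(X, x)\<close>, in which \<open>p\<close> and \<open>q\<close> are concatenated.
\<close>

definition hgroup_mult :: "nat \<Rightarrow> tm \<Rightarrow> tm \<Rightarrow> tm \<Rightarrow> tm \<Rightarrow> tm \<Rightarrow> tm" where
  "hgroup_mult i m X x u v =
     (let G = hgroup i (Succ m) X x; L = carrier i (Loops i (Succ m) X x);
          P = Loops i m X x; A = carrier i P; a = point i P
      in SInd (wk 1 G)
           (SInd (wk 2 G)
              (SIn (path_comp (wk 2 A) (wk 2 a) (wk 2 a) (wk 2 a) (Var 1) (Var 0)))
              (STr_isSet (wk 2 L))
              (wk 1 v))
           (STr_isSet (wk 1 L))
           u)"

text \<open>
  Group isomorphisms \<open>\<pi>\<^sub>m\<^sub>+\<^sub>1(X, a) \<cong> \<pi>\<^sub>m\<^sub>+\<^sub>1(X, b)\<close>: equivalences \<open>f\<close> with \<open>f (u v) = f u f v\<close> for all \<open>u, v\<close>.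
  As usual for groups, preservation of units and inverses is a consequence and not part of the data.
\<close>

definition hgroup_iso :: "nat \<Rightarrow> tm \<Rightarrow> tm \<Rightarrow> tm \<Rightarrow> tm \<Rightarrow> tm" where
  "hgroup_iso i m X a b =
     (let G = hgroup i (Succ m) X a; H = hgroup i (Succ m) X b
      in Sig (Arr G H)
           (Prod (isEquiv (wk 1 G) (wk 1 H) (Var 0))
              (Pi (wk 1 G) (Pi (wk 2 G) (Eql (wk 3 H)
                 (App (Var 2) (hgroup_mult i (wk 3 m) (wk 3 X) (wk 3 a) (Var 1) (Var 0)))
                 (hgroup_mult i (wk 3 m) (wk 3 X) (wk 3 b)
                    (App (Var 2) (Var 1)) (App (Var 2) (Var 0))))))))"

(* Sigma (phi : pi_{m+1}(X,a) ~ pi_{m+1}(X,b)). Pi (p : a = b). phi = transport p, where the equation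
   is between functions pi_{m+1}(X,a) -> pi_{m+1}(X,b) *)
definition canonical_iso :: "nat \<Rightarrow> tm \<Rightarrow> tm \<Rightarrow> tm \<Rightarrow> tm \<Rightarrow> tm" where
  "canonical_iso i m X a b =
     (let F = Arr (hgroup i (Succ m) X a) (hgroup i (Succ m) X b)
      in Sig (hgroup_iso i m X a b)
           (Pi (Eql (wk 1 X) (wk 1 a) (wk 1 b))
              (Eql (wk 2 F)
                 (proj1 (wk 2 F) (Var 1))
                 (transport (hgroup_fam i (Succ (wk 2 m)) (wk 2 X)) (wk 2 a) (wk 2 b) (Var 0)))))"

text \<open>
  The action \<open>q . u\<close> of \<open>q : \<pi>\<^sub>1(X, a)\<close> on \<open>u : \<pi>\<^sub>n(X, a)\<close>, determined on truncated loops by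
  \<open>|p|\<^sub>0 . u = transport(p\<^sup>-\<^sup>1, u)\<close>.
\<close>

definition action :: "nat \<Rightarrow> tm \<Rightarrow> tm \<Rightarrow> tm \<Rightarrow> tm \<Rightarrow> tm \<Rightarrow> tm" where
  "action i n X a q u =
     SInd (wk 1 (hgroup i n X a))
       (App (transport (hgroup_fam i (wk 1 n) (wk 1 X)) (wk 1 a) (wk 1 a)
               (path_inv (wk 1 X) (wk 1 a) (wk 1 a) (Var 0)))
            (wk 1 u))
       (STr_isSet (wk 1 (carrier i (Loops i n X a))))
       q"

(* Pi (q : pi_1(X,a)) (u : pi_n(X,a)). q . u = u *)
definition trivial_action :: "nat \<Rightarrow> tm \<Rightarrow> tm \<Rightarrow> tm \<Rightarrow> tm" where
  "trivial_action i n X a =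
     Pi (hgroup i (Succ Zero) X a) (Pi (wk 1 (hgroup i n X a))
       (Eql (wk 2 (hgroup i n X a))
          (action i (wk 2 n) (wk 2 X) (wk 2 a) (Var 1) (Var 0)) (Var 0)))"

end

theory Submission
  imports Defs
begin

text \<open>
  The statement asks for a closed term of type theory. In mathematical terms: let
  \<open>P x = \<pi>\<^sub>n(X, x)\<close>, a family of sets over \<open>X\<close>, and write \<open>p\<^sub>*\<close> for transport in \<open>P\<close> along \<open>p\<close>.

  If \<open>\<phi> = p\<^sub>*\<close> for every \<open>p : a = b\<close>, then \<open>p\<^sub>* = q\<^sub>*\<close> for any two such paths. By path induction on
  \<open>p\<close> this means that \<open>l\<^sub>* u = u\<close> for all loops \<open>l\<close> at \<open>a\<close>, because \<open>refl\<^sub>*\<close> is the identity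
  (\<open>trivial_same\<close>). An equation in a set is a proposition, so connectedness may be used to supply
  the path \<open>p\<close>, and a truncated loop acting on \<open>u\<close> may be taken to be an actual loop. Hence the
  action is trivial.

  Conversely, if the action is trivial, then \<open>p\<^sub>*\<close> does not depend on \<open>p : a = b\<close>. Connectedness
  only gives a truncated path, and the type of isomorphisms is not a proposition. But a constant
  map from \<open>T\<close> into a set factors through \<open>\<parallel>T\<parallel>\<close> (\<open>constant_map_factors\<close>), because the values \<open>y\<close>
  together with a proof that \<open>y = k t\<close> for all \<open>t\<close> do form a proposition once \<open>\<parallel>T\<parallel>\<close> is inhabited.
  Applied pointwise to \<open>p \<mapsto> p\<^sub>* u\<close> and to \<open>p \<mapsto> (p\<inverse>)\<^sub>* v\<close>, this gives functions \<open>f\<close> and \<open>g\<close>. That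
  they are inverse to each other and that \<open>f\<close> preserves products are equations in sets again. They
  can be checked for a chosen \<open>p\<close>, where \<open>f\<close> and \<open>g\<close> are \<open>p\<^sub>*\<close> and \<open>(p\<inverse>)\<^sub>*\<close>, and there they follow
  by path induction on \<open>p\<close>.

  Proof terms are suppressed as far as possible: most lemmas only say that a type is inhabited in
  a context. A term stays explicit only where a later type mentions it.
\<close>

section \<open>The calculus of substitutions\<close>

text \<open>
  Types reached in different ways are often the same type under different substitutions. The
  equations of the \<open>\<sigma>\<close>-calculus, as simplification rules, bring every substitution that occurs
  here into the form \<open>t\<^sub>1 \<cdot> \<dots> \<cdot> t\<^sub>k \<cdot> sh n\<close>, so that such coincidences are found by the simplifier.
\<close>

definition comp :: "(nat \<Rightarrow> tm) \<Rightarrow> (nat \<Rightarrow> tm) \<Rightarrow> nat \<Rightarrow> tm" (infixl ";;" 65) where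
  "(\<sigma> ;; \<tau>) k = (\<sigma> k)\<langle>\<tau>\<rangle>"

lemma up_Var [simp]: "up Var = Var"
proof
  show "up Var k = Var k" for k by (cases k) simp_all
qed

lemma subst_Var [simp]: "t\<langle>Var\<rangle> = t"
  by (induction t) simp_all

lemma up_rename: "up (\<lambda>k. Var (r k)) = (\<lambda>k. Var (upr r k))"
proof
  show "up (\<lambda>k. Var (r k)) k = Var (upr r k)" for k by (cases k) simp_all
qed

lemma rename_eq_subst: "rename r t = t\<langle>\<lambda>k. Var (r k)\<rangle>"
  by (induction t arbitrary: r) (simp_all add: up_rename)

lemma up_after_upr: "(\<lambda>k. up \<sigma> (upr r k)) = up (\<lambda>k. \<sigma> (r k))"
proof
  show "up \<sigma> (upr r k) = up (\<lambda>k. \<sigma> (r k)) k" for k by (cases k) simp_all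
qed

lemma subst_rename: "(rename r t)\<langle>\<sigma>\<rangle> = t\<langle>\<lambda>k. \<sigma> (r k)\<rangle>"
  by (induction t arbitrary: r \<sigma>) (simp_all add: up_after_upr)

lemma rename_rename: "rename r (rename s t) = rename (\<lambda>k. r (s k)) t"
  by (simp add: rename_eq_subst[of r] subst_rename) (simp add: rename_eq_subst)

lemma rename_up: "(\<lambda>k. rename (upr r) (up \<sigma> k)) = up (\<lambda>k. rename r (\<sigma> k))"
proof
  show "rename (upr r) (up \<sigma> k) = up (\<lambda>k. rename r (\<sigma> k)) k" for k
    by (cases k) (simp_all add: rename_rename)
qed

lemma rename_subst: "rename r (t\<langle>\<sigma>\<rangle>) = t\<langle>\<lambda>k. rename r (\<sigma> k)\<rangle>"
  by (induction t arbitrary: r \<sigma>) (simp_all add: rename_up)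

lemma up_comp: "up (\<sigma> ;; \<tau>) = up \<sigma> ;; up \<tau>"
proof
  show "up (\<sigma> ;; \<tau>) k = (up \<sigma> ;; up \<tau>) k" for k
    by (cases k) (simp_all add: comp_def rename_subst subst_rename)
qed

lemma subst_subst [simp]: "t\<langle>\<sigma>\<rangle>\<langle>\<tau>\<rangle> = t\<langle>\<sigma> ;; \<tau>\<rangle>"
  by (induction t arbitrary: \<sigma> \<tau>) (simp_all add: up_comp comp_def[of \<sigma> \<tau> for \<sigma> \<tau>])

lemma up_eq [simp]: "up \<sigma> = Var 0 \<cdot> (\<sigma> ;; sh (Suc 0))"
proof
  show "up \<sigma> k = (Var 0 \<cdot> (\<sigma> ;; sh (Suc 0))) k" for k
    by (cases k) (simp_all add: comp_def sh_def[abs_def] rename_eq_subst)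
qed

abbreviation weaken1 :: "tm \<Rightarrow> tm" ("_\<Up>" [1000] 1000) where
  "t\<Up> \<equiv> t\<langle>sh (Suc 0)\<rangle>"

abbreviation weaken :: "tm \<Rightarrow> nat \<Rightarrow> tm" ("_\<up>_" [1000, 1000] 1000) where
  "t\<up>n \<equiv> t\<langle>sh n\<rangle>"

lemma wk_eq [simp]: "wk n t = t\<up>n"
  by (simp add: wk_def)

lemma sh_apply [simp]: "sh n k = Var (k + n)"
  by (simp add: sh_def)

lemma sh_0 [simp]: "sh 0 = Var"
  by (rule ext) simp

lemma comp_assoc [simp]: "\<sigma> ;; \<tau> ;; \<upsilon> = \<sigma> ;; (\<tau> ;; \<upsilon>)"
  by (rule ext) (simp add: comp_def)

lemma comp_Var [simp]: "\<sigma> ;; Var = \<sigma>" "Var ;; \<sigma> = \<sigma>"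
  by (rule ext, simp add: comp_def)+

lemma scons_comp [simp]: "(t \<cdot> \<sigma>) ;; \<tau> = t\<langle>\<tau>\<rangle> \<cdot> (\<sigma> ;; \<tau>)"
proof
  show "((t \<cdot> \<sigma>) ;; \<tau>) k = (t\<langle>\<tau>\<rangle> \<cdot> (\<sigma> ;; \<tau>)) k" for k
    by (cases k) (simp_all add: comp_def)
qed

lemma sh_sh [simp]: "sh m ;; sh n = sh (m + n)"
  by (rule ext) (simp add: comp_def ac_simps)

lemma sh_sh_comp [simp]: "sh m ;; (sh n ;; \<sigma>) = sh (m + n) ;; \<sigma>"
  by (simp flip: comp_assoc)

lemma sh_Suc_comp [simp]: "sh (Suc n) ;; (t \<cdot> \<sigma>) = sh n ;; \<sigma>"
  by (rule ext) (simp add: comp_def)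

lemma sh_numeral_comp [simp]: "sh (numeral n) ;; (t \<cdot> \<sigma>) = sh (pred_numeral n) ;; \<sigma>"
  by (simp add: numeral_eq_Suc)

lemma scons_numeral [simp]: "(t \<cdot> \<sigma>) (numeral n) = \<sigma> (pred_numeral n)"
  by (simp add: numeral_eq_Suc)

lemma scons_sh [simp]: "Suc k = n \<Longrightarrow> Var k \<cdot> sh n = sh k"
proof
  assume "Suc k = n"
  then show "(Var k \<cdot> sh n) j = sh k j" for j by (cases j) auto
qed

text \<open>
  Shifts are compared syntactically, and they arise both from numerals and from nested binders.
  This rule keeps numerals as the normal form.
\<close>

lemma Suc_Suc_0 [simp]: "Suc (Suc 0) = 2"
  by simp

section \<open>Admissible rules\<close>

lemma ctx_tail_wf: "wf_ctx \<Gamma> \<Longrightarrow> wf_ctx (tl \<Gamma>)"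
  and has_type_wf: "\<Gamma> \<turnstile> t \<^bold>: A \<Longrightarrow> wf_ctx \<Gamma>"
  and jdg_eq_wf: "\<Gamma> \<turnstile> s \<doteq> t \<^bold>: A \<Longrightarrow> wf_ctx \<Gamma>"
  by (induction rule: wf_ctx_has_type_jdg_eq.inducts) (simp_all add: CtxNil)

text \<open>
  The premises of the substitution rules, with the weakening of \<open>\<Gamma> ! k\<close> and the substitution \<open>\<sigma>\<close>
  fused into one substitution.
\<close>

definition sub :: "tm list \<Rightarrow> (nat \<Rightarrow> tm) \<Rightarrow> tm list \<Rightarrow> bool" where
  "sub \<Delta> \<sigma> \<Gamma> \<longleftrightarrow> wf_ctx \<Delta> \<and> (\<forall>k<length \<Gamma>. \<Delta> \<turnstile> \<sigma> k \<^bold>: (\<Gamma> ! k)\<langle>sh (Suc k) ;; \<sigma>\<rangle>)"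

definition eqsub :: "tm list \<Rightarrow> (nat \<Rightarrow> tm) \<Rightarrow> (nat \<Rightarrow> tm) \<Rightarrow> tm list \<Rightarrow> bool" where
  "eqsub \<Delta> \<sigma> \<tau> \<Gamma> \<longleftrightarrow> wf_ctx \<Delta> \<and> (\<forall>k<length \<Gamma>. \<Delta> \<turnstile> \<sigma> k \<doteq> \<tau> k \<^bold>: (\<Gamma> ! k)\<langle>sh (Suc k) ;; \<sigma>\<rangle>)"

text \<open>
  A term \<open>t\<close> over \<open>\<Gamma>\<close> reads \<open>t\<up>n\<close> over an extension by \<open>n\<close> hypotheses; the number is part of the
  notion so that these weakenings can be computed.
\<close>

definition extends :: "nat \<Rightarrow> tm list \<Rightarrow> tm list \<Rightarrow> bool" where
  "extends n \<Gamma> \<Delta> \<longleftrightarrow> wf_ctx \<Delta> \<and> n \<le> length \<Delta> \<and> drop n \<Delta> = \<Gamma>"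

lemma type_subst: "\<Gamma> \<turnstile> t \<^bold>: A \<Longrightarrow> sub \<Delta> \<sigma> \<Gamma> \<Longrightarrow> T = A\<langle>\<sigma>\<rangle> \<Longrightarrow> \<Delta> \<turnstile> t\<langle>\<sigma>\<rangle> \<^bold>: T"
  unfolding sub_def by (simp add: Subst)

lemma eq_subst: "\<Gamma> \<turnstile> s \<doteq> t \<^bold>: A \<Longrightarrow> eqsub \<Delta> \<sigma> \<tau> \<Gamma> \<Longrightarrow> T = A\<langle>\<sigma>\<rangle> \<Longrightarrow> \<Delta> \<turnstile> s\<langle>\<sigma>\<rangle> \<doteq> t\<langle>\<tau>\<rangle> \<^bold>: T"
  unfolding eqsub_def by (simp add: EqSubst)

lemma sub_scons:
  assumes "sub \<Delta> \<sigma> \<Gamma>" "\<Delta> \<turnstile> a \<^bold>: A\<langle>\<sigma>\<rangle>"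
  shows "sub \<Delta> (a \<cdot> \<sigma>) (A # \<Gamma>)"
  unfolding sub_def
proof (intro conjI allI impI)
  show "wf_ctx \<Delta>" using assms(1) by (simp add: sub_def)
  show "\<Delta> \<turnstile> (a \<cdot> \<sigma>) k \<^bold>: ((A # \<Gamma>) ! k)\<langle>sh (Suc k) ;; (a \<cdot> \<sigma>)\<rangle>" if "k < length (A # \<Gamma>)" for k
    using that assms by (cases k) (simp_all add: sub_def)
qed

lemma eqsub_scons:
  assumes "eqsub \<Delta> \<sigma> \<tau> \<Gamma>" "\<Delta> \<turnstile> a \<doteq> b \<^bold>: A\<langle>\<sigma>\<rangle>"
  shows "eqsub \<Delta> (a \<cdot> \<sigma>) (b \<cdot> \<tau>) (A # \<Gamma>)"
  unfolding eqsub_def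
proof (intro conjI allI impI)
  show "wf_ctx \<Delta>" using assms(1) by (simp add: eqsub_def)
  show "\<Delta> \<turnstile> (a \<cdot> \<sigma>) k \<doteq> (b \<cdot> \<tau>) k \<^bold>: ((A # \<Gamma>) ! k)\<langle>sh (Suc k) ;; (a \<cdot> \<sigma>)\<rangle>"
    if "k < length (A # \<Gamma>)" for k
    using that assms by (cases k) (simp_all add: eqsub_def)
qed

lemma eqsub_refl: "sub \<Delta> \<sigma> \<Gamma> \<Longrightarrow> eqsub \<Delta> \<sigma> \<sigma> \<Gamma>"
  by (simp add: sub_def eqsub_def EqRefl)

lemma extends_sub: "extends n \<Gamma> \<Delta> \<Longrightarrow> sub \<Delta> (sh n) \<Gamma>"
  unfolding sub_def extends_def
proof (intro conjI allI impI; elim conjE)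
  fix k
  assume wf: "wf_ctx \<Delta>" and n: "n \<le> length \<Delta>" and d: "drop n \<Delta> = \<Gamma>" and k: "k < length \<Gamma>"
  have "\<Delta> \<turnstile> Var (k + n) \<^bold>: wk (Suc (k + n)) (\<Delta> ! (k + n))"
    using n d k by (intro Var wf) auto
  moreover have "\<Delta> ! (k + n) = \<Gamma> ! k"
    using n d by (auto simp: add.commute)
  ultimately show "\<Delta> \<turnstile> sh n k \<^bold>: (\<Gamma> ! k)\<langle>sh (Suc k) ;; sh n\<rangle>" by simp
qed

lemma extends_weaken: "extends n \<Gamma> \<Delta> \<Longrightarrow> \<Gamma> \<turnstile> t \<^bold>: A \<Longrightarrow> T = A\<up>n \<Longrightarrow> \<Delta> \<turnstile> t\<up>n \<^bold>: T"
  using extends_sub type_subst by blast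

lemma extends_Suc: "extends n \<Gamma> \<Delta> \<Longrightarrow> wf_ctx (A # \<Delta>) \<Longrightarrow> extends (Suc n) \<Gamma> (A # \<Delta>)"
  by (simp add: extends_def)

lemma sub_Var: "wf_ctx \<Gamma> \<Longrightarrow> sub \<Gamma> Var \<Gamma>"
  using extends_sub[of 0 \<Gamma> \<Gamma>] by (simp add: extends_def)

section \<open>Derived typing rules\<close>

text \<open>
  Rules whose type involves a substitution are restated with an equation for that type. They then
  apply to any goal, and the equation is left to the simplifier.
\<close>

lemma VarT: "wf_ctx \<Gamma> \<Longrightarrow> k < length \<Gamma> \<Longrightarrow> T = (\<Gamma> ! k)\<langle>sh (Suc k)\<rangle> \<Longrightarrow> \<Gamma> \<turnstile> Var k \<^bold>: T"
  using Var by simp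

lemma PiET: "\<Gamma> \<turnstile> f \<^bold>: Pi A B \<Longrightarrow> \<Gamma> \<turnstile> a \<^bold>: A \<Longrightarrow> T = B\<langle>a \<cdot> Var\<rangle> \<Longrightarrow> \<Gamma> \<turnstile> App f a \<^bold>: T"
  using PiE by simp

lemma ReflT: "\<Gamma> \<turnstile> a \<^bold>: A \<Longrightarrow> b = a \<Longrightarrow> c = a \<Longrightarrow> \<Gamma> \<turnstile> Refl a \<^bold>: Eql A b c"
  using EqlI by simp

lemma wf_extends:
  "wf_ctx (A # \<Gamma>) \<Longrightarrow> extends (Suc 0) \<Gamma> (A # \<Gamma>)"
  "wf_ctx (B # A # \<Gamma>) \<Longrightarrow> extends 2 \<Gamma> (B # A # \<Gamma>)"
  "wf_ctx (C # B # A # \<Gamma>) \<Longrightarrow> extends 3 \<Gamma> (C # B # A # \<Gamma>)"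
  by (simp_all add: extends_def)

lemma Univ_weaken: "extends n \<Gamma> \<Delta> \<Longrightarrow> \<Gamma> \<turnstile> A \<^bold>: Univ i \<Longrightarrow> \<Delta> \<turnstile> A\<up>n \<^bold>: Univ i"
  by (rule extends_weaken, assumption+, simp)

lemma fam_inst: "A # \<Gamma> \<turnstile> B \<^bold>: Univ i \<Longrightarrow> sub \<Delta> \<sigma> \<Gamma> \<Longrightarrow> \<Delta> \<turnstile> a \<^bold>: A\<langle>\<sigma>\<rangle> \<Longrightarrow> \<Delta> \<turnstile> B\<langle>a \<cdot> \<sigma>\<rangle> \<^bold>: Univ i"
  by (rule type_subst[of "A # \<Gamma>"]) (auto intro: sub_scons)

lemma fam_weaken:
  "A # \<Gamma> \<turnstile> B \<^bold>: Univ i \<Longrightarrow> extends n \<Gamma> \<Delta> \<Longrightarrow> \<Delta> \<turnstile> a \<^bold>: A\<up>n \<Longrightarrow> \<Delta> \<turnstile> B\<langle>a \<cdot> sh n\<rangle> \<^bold>: Univ i"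
  using fam_inst extends_sub by blast

lemma fam_subst0: "A # \<Gamma> \<turnstile> B \<^bold>: Univ i \<Longrightarrow> \<Gamma> \<turnstile> a \<^bold>: A \<Longrightarrow> \<Gamma> \<turnstile> B\<langle>a \<cdot> Var\<rangle> \<^bold>: Univ i"
  by (rule fam_inst[of A \<Gamma>]) (auto intro: sub_Var has_type_wf)

text \<open>
  Motives of path induction live over the first of these contexts.
\<close>

lemma wf_J:
  assumes A: "\<Gamma> \<turnstile> A \<^bold>: Univ i"
  shows "wf_ctx (Eql A\<up>2 (Var (Suc 0)) (Var 0) # A\<Up> # A # \<Gamma>)"
    and "wf_ctx (A\<Up> # A # \<Gamma>)" and "wf_ctx (A # \<Gamma>)"
proof -
  show w1: "wf_ctx (A # \<Gamma>)" using A by (rule CtxCons)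
  show w2: "wf_ctx (A\<Up> # A # \<Gamma>)"
    by (rule CtxCons, rule Univ_weaken[OF wf_extends(1)[OF w1] A])
  show "wf_ctx (Eql A\<up>2 (Var (Suc 0)) (Var 0) # A\<Up> # A # \<Gamma>)"
    by (rule CtxCons, rule EqlF, rule Univ_weaken[OF wf_extends(2)[OF w2] A]; rule VarT)
      (simp_all add: w2)
qed

lemma ArrF: "\<Gamma> \<turnstile> A \<^bold>: Univ i \<Longrightarrow> \<Gamma> \<turnstile> B \<^bold>: Univ i \<Longrightarrow> \<Gamma> \<turnstile> Arr A B \<^bold>: Univ i"
  unfolding Arr_def by (simp add: PiF Univ_weaken[OF wf_extends(1)] CtxCons)

lemma ProdF: "\<Gamma> \<turnstile> A \<^bold>: Univ i \<Longrightarrow> \<Gamma> \<turnstile> B \<^bold>: Univ i \<Longrightarrow> \<Gamma> \<turnstile> Prod A B \<^bold>: Univ i"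
  unfolding Prod_def by (simp add: SigF Univ_weaken[OF wf_extends(1)] CtxCons)

lemma ArrE: "\<Gamma> \<turnstile> f \<^bold>: Arr A B \<Longrightarrow> \<Gamma> \<turnstile> a \<^bold>: A \<Longrightarrow> \<Gamma> \<turnstile> App f a \<^bold>: B"
  unfolding Arr_def by (rule PiET) auto

lemma ArrI: "\<Gamma> \<turnstile> A \<^bold>: Univ i \<Longrightarrow> A # \<Gamma> \<turnstile> b \<^bold>: B\<Up> \<Longrightarrow> \<Gamma> \<turnstile> Lam A b \<^bold>: Arr A B"
  unfolding Arr_def by (rule PiI) auto

lemma ProdI: "\<Gamma> \<turnstile> A \<^bold>: Univ i \<Longrightarrow> \<Gamma> \<turnstile> B \<^bold>: Univ i \<Longrightarrow> \<Gamma> \<turnstile> a \<^bold>: A \<Longrightarrow> \<Gamma> \<turnstile> b \<^bold>: B \<Longrightarrow> \<Gamma> \<turnstile> Tup a b \<^bold>: Prod A B"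
  unfolding Prod_def by (rule SigI[where i = i]) (simp_all add: Univ_weaken[OF wf_extends(1)] CtxCons)

lemma subst_notions [simp]:
  "(Arr A B)\<langle>\<sigma>\<rangle> = Arr (A\<langle>\<sigma>\<rangle>) (B\<langle>\<sigma>\<rangle>)"
  "(Prod A B)\<langle>\<sigma>\<rangle> = Prod (A\<langle>\<sigma>\<rangle>) (B\<langle>\<sigma>\<rangle>)"
  "(isEquiv A B f)\<langle>\<sigma>\<rangle> = isEquiv (A\<langle>\<sigma>\<rangle>) (B\<langle>\<sigma>\<rangle>) (f\<langle>\<sigma>\<rangle>)"
  "(proj1 A p)\<langle>\<sigma>\<rangle> = proj1 (A\<langle>\<sigma>\<rangle>) (p\<langle>\<sigma>\<rangle>)"
  "(proj2 A B p)\<langle>\<sigma>\<rangle> = proj2 (A\<langle>\<sigma>\<rangle>) (B\<langle>Var 0 \<cdot> (\<sigma> ;; sh (Suc 0))\<rangle>) (p\<langle>\<sigma>\<rangle>)"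
  "(transport P a b q)\<langle>\<sigma>\<rangle> = transport (P\<langle>Var 0 \<cdot> (\<sigma> ;; sh (Suc 0))\<rangle>) (a\<langle>\<sigma>\<rangle>) (b\<langle>\<sigma>\<rangle>) (q\<langle>\<sigma>\<rangle>)"
  "(path_inv A a b q)\<langle>\<sigma>\<rangle> = path_inv (A\<langle>\<sigma>\<rangle>) (a\<langle>\<sigma>\<rangle>) (b\<langle>\<sigma>\<rangle>) (q\<langle>\<sigma>\<rangle>)"
  by (simp_all add: Arr_def Prod_def isEquiv_def proj1_def proj2_def transport_def path_inv_def)

lemma subst_path_comp [simp]:
  "(path_comp A a b c p q)\<langle>\<sigma>\<rangle> = path_comp (A\<langle>\<sigma>\<rangle>) (a\<langle>\<sigma>\<rangle>) (b\<langle>\<sigma>\<rangle>) (c\<langle>\<sigma>\<rangle>) (p\<langle>\<sigma>\<rangle>) (q\<langle>\<sigma>\<rangle>)"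
  by (simp add: path_comp_def)

subsection \<open>Congruence\<close>

text \<open>
  Congruence for a term former that binds no variables: its application to fresh variables is a
  term \<open>s\<close>, into which judgementally equal terms are substituted.
\<close>

lemma eq_subst1:
  assumes "A # \<Gamma> \<turnstile> s \<^bold>: B" "\<Gamma> \<turnstile> a \<doteq> b \<^bold>: A" "T = B\<langle>a \<cdot> Var\<rangle>"
  shows "\<Gamma> \<turnstile> s\<langle>a \<cdot> Var\<rangle> \<doteq> s\<langle>b \<cdot> Var\<rangle> \<^bold>: T"
  by (rule eq_subst[OF EqRefl[OF assms(1)] _ assms(3)])
    (intro eqsub_scons eqsub_refl sub_Var jdg_eq_wf[OF assms(2)]; simp add: assms)

lemma eq_subst2:
  assumes "B # A # \<Gamma> \<turnstile> s \<^bold>: C" "\<Gamma> \<turnstile> a \<doteq> a' \<^bold>: A" "\<Gamma> \<turnstile> b \<doteq> b' \<^bold>: B\<langle>a \<cdot> Var\<rangle>"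
    "T = C\<langle>b \<cdot> a \<cdot> Var\<rangle>"
  shows "\<Gamma> \<turnstile> s\<langle>b \<cdot> a \<cdot> Var\<rangle> \<doteq> s\<langle>b' \<cdot> a' \<cdot> Var\<rangle> \<^bold>: T"
  by (rule eq_subst[OF EqRefl[OF assms(1)] _ assms(4)])
    (intro eqsub_scons eqsub_refl sub_Var jdg_eq_wf[OF assms(2)]; simp add: assms)

lemma EqlCong:
  assumes A: "\<Gamma> \<turnstile> A \<^bold>: Univ i" and a: "\<Gamma> \<turnstile> a \<doteq> a' \<^bold>: A" and b: "\<Gamma> \<turnstile> b \<doteq> b' \<^bold>: A"
  shows "\<Gamma> \<turnstile> Eql A a b \<doteq> Eql A a' b' \<^bold>: Univ i"
proof -
  note w = wf_J[OF A]
  have "A\<Up> # A # \<Gamma> \<turnstile> Eql A\<up>2 (Var (Suc 0)) (Var 0) \<^bold>: Univ i"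
    by (rule EqlF, rule Univ_weaken[OF wf_extends(2)[OF w(2)] A]; rule VarT)
      (simp_all add: w)
  then have "\<Gamma> \<turnstile> (Eql A\<up>2 (Var (Suc 0)) (Var 0))\<langle>b \<cdot> a \<cdot> Var\<rangle>
      \<doteq> (Eql A\<up>2 (Var (Suc 0)) (Var 0))\<langle>b' \<cdot> a' \<cdot> Var\<rangle> \<^bold>: Univ i"
    by (rule eq_subst2) (simp_all add: a b)
  then show ?thesis by simp
qed

lemma AppCong:
  assumes A: "\<Gamma> \<turnstile> A \<^bold>: Univ i" and B: "A # \<Gamma> \<turnstile> B \<^bold>: Univ i"
    and f: "\<Gamma> \<turnstile> f \<doteq> f' \<^bold>: Pi A B" and a: "\<Gamma> \<turnstile> a \<doteq> a' \<^bold>: A"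
  shows "\<Gamma> \<turnstile> App f a \<doteq> App f' a' \<^bold>: B\<langle>a \<cdot> Var\<rangle>"
proof -
  have w1: "wf_ctx (Pi A B # \<Gamma>)" using A B by (intro CtxCons PiF)
  have w2: "wf_ctx (A\<Up> # Pi A B # \<Gamma>)"
    by (rule CtxCons, rule Univ_weaken[OF wf_extends(1)[OF w1] A])
  have "A\<Up> # Pi A B # \<Gamma> \<turnstile> App (Var (Suc 0)) (Var 0) \<^bold>: B\<langle>Var 0 \<cdot> sh 2\<rangle>"
    by (rule PiET[of _ _ "A\<up>2" "B\<langle>Var 0 \<cdot> sh 3\<rangle>"]; (rule VarT)?)
      (simp_all add: w2)
  then have "\<Gamma> \<turnstile> (App (Var (Suc 0)) (Var 0))\<langle>a \<cdot> f \<cdot> Var\<rangle>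
      \<doteq> (App (Var (Suc 0)) (Var 0))\<langle>a' \<cdot> f' \<cdot> Var\<rangle> \<^bold>: B\<langle>a \<cdot> Var\<rangle>"
    by (rule eq_subst2) (simp_all add: a f)
  then show ?thesis by simp
qed

lemma Arr_AppCong:
  assumes A: "\<Gamma> \<turnstile> A \<^bold>: Univ i" and B: "\<Gamma> \<turnstile> B \<^bold>: Univ i"
    and f: "\<Gamma> \<turnstile> f \<doteq> f' \<^bold>: Arr A B" and a: "\<Gamma> \<turnstile> a \<doteq> a' \<^bold>: A"
  shows "\<Gamma> \<turnstile> App f a \<doteq> App f' a' \<^bold>: B"
  using AppCong[OF A Univ_weaken[OF wf_extends(1)[OF CtxCons[OF A]] B], of f f' a a'] f a
  by (simp add: Arr_def)

subsection \<open>Projections\<close>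

lemma proj1T:
  assumes "\<Gamma> \<turnstile> A \<^bold>: Univ i" "A # \<Gamma> \<turnstile> B \<^bold>: Univ i" "\<Gamma> \<turnstile> p \<^bold>: Sig A B"
  shows "\<Gamma> \<turnstile> proj1 A p \<^bold>: A"
proof -
  have w: "wf_ctx (Sig A B # \<Gamma>)" "wf_ctx (B # A # \<Gamma>)"
    using assms by (blast intro: CtxCons SigF)+
  have "\<Gamma> \<turnstile> Split A\<Up> (Var (Suc 0)) p \<^bold>: A\<Up>\<langle>p \<cdot> Var\<rangle>"
    using assms w
    by (intro SigE[of A B \<Gamma>] Univ_weaken[OF wf_extends(1)] VarT) auto
  then show ?thesis by (simp add: proj1_def)
qed

lemma proj1_beta:
  assumes "\<Gamma> \<turnstile> A \<^bold>: Univ i" "A # \<Gamma> \<turnstile> B \<^bold>: Univ i" "\<Gamma> \<turnstile> a \<^bold>: A" "\<Gamma> \<turnstile> b \<^bold>: B\<langle>a \<cdot> Var\<rangle>"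
  shows "\<Gamma> \<turnstile> proj1 A (Tup a b) \<doteq> a \<^bold>: A"
proof -
  have w: "wf_ctx (Sig A B # \<Gamma>)" "wf_ctx (B # A # \<Gamma>)"
    using assms by (blast intro: CtxCons SigF)+
  have "\<Gamma> \<turnstile> Split A\<Up> (Var (Suc 0)) (Tup a b) \<doteq> (Var (Suc 0))\<langle>b \<cdot> a \<cdot> Var\<rangle>
      \<^bold>: A\<Up>\<langle>Tup a b \<cdot> Var\<rangle>"
    using assms w
    by (intro SigBeta[of A B \<Gamma>] Univ_weaken[OF wf_extends(1)] VarT) auto
  then show ?thesis by (simp add: proj1_def)
qed

text \<open>
  For a pair, the motive of the second projection mentions the first projection of that pair,
  which is the first component only up to judgemental equality; hence the conversion.
\<close>

lemma proj2_motive: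
  assumes A: "\<Gamma> \<turnstile> A \<^bold>: Univ i" and B: "A # \<Gamma> \<turnstile> B \<^bold>: Univ i"
  shows "Sig A B # \<Gamma> \<turnstile> B\<langle>proj1 A\<Up> (Var 0) \<cdot> sh (Suc 0)\<rangle> \<^bold>: Univ i"
    and "B # A # \<Gamma> \<turnstile> Var 0 \<^bold>: B\<langle>proj1 A\<Up> (Var 0) \<cdot> sh (Suc 0)\<rangle>\<langle>Tup (Var 1) (Var 0) \<cdot> sh 2\<rangle>"
proof -
  have w: "wf_ctx (Sig A B # \<Gamma>)" "wf_ctx (B # A # \<Gamma>)"
    using assms by (blast intro: CtxCons SigF)+
  note e1 = wf_extends(1)[OF w(1)] and e2 = wf_extends(2)[OF w(2)]
  have A1: "Sig A B # \<Gamma> \<turnstile> A\<Up> \<^bold>: Univ i" by (rule Univ_weaken[OF e1 A])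
  have B1: "A\<Up> # Sig A B # \<Gamma> \<turnstile> B\<langle>Var 0 \<cdot> sh 2\<rangle> \<^bold>: Univ i"
    using CtxCons[OF A1] by (intro fam_weaken[OF B] wf_extends VarT) auto
  show "Sig A B # \<Gamma> \<turnstile> B\<langle>proj1 A\<Up> (Var 0) \<cdot> sh (Suc 0)\<rangle> \<^bold>: Univ i"
    by (rule fam_weaken[OF B e1], rule proj1T[OF A1 B1], rule VarT)
      (auto simp: w)
  have A2: "B # A # \<Gamma> \<turnstile> A\<up>2 \<^bold>: Univ i" by (rule Univ_weaken[OF e2 A])
  have B2: "A\<up>2 # B # A # \<Gamma> \<turnstile> B\<langle>Var 0 \<cdot> sh 3\<rangle> \<^bold>: Univ i"
    using CtxCons[OF A2] by (intro fam_weaken[OF B] wf_extends VarT) auto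
  have "B # A # \<Gamma> \<turnstile> proj1 A\<up>2 (Tup (Var (Suc 0)) (Var 0)) \<doteq> Var (Suc 0) \<^bold>: A\<up>2"
    by (rule proj1_beta[OF A2 B2]; rule VarT) (auto simp: w(2))
  then have "B # A # \<Gamma> \<turnstile> B\<langle>proj1 A\<up>2 (Tup (Var (Suc 0)) (Var 0)) \<cdot> sh 2\<rangle> \<doteq>
      B\<langle>Var (Suc 0) \<cdot> sh 2\<rangle> \<^bold>: Univ i"
    by (intro eq_subst[OF EqRefl[OF B]] eqsub_scons eqsub_refl extends_sub e2) auto
  then have "B # A # \<Gamma> \<turnstile> Var 0 \<^bold>: B\<langle>proj1 A\<up>2 (Tup (Var (Suc 0)) (Var 0)) \<cdot> sh 2\<rangle>"
    by (intro Conv[OF VarT EqSym]) (auto simp: w)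
  then show "B # A # \<Gamma> \<turnstile> Var 0 \<^bold>: B\<langle>proj1 A\<Up> (Var 0) \<cdot> sh (Suc 0)\<rangle>\<langle>Tup (Var 1) (Var 0) \<cdot> sh 2\<rangle>"
    by simp
qed

lemma proj2T:
  assumes "\<Gamma> \<turnstile> A \<^bold>: Univ i" "A # \<Gamma> \<turnstile> B \<^bold>: Univ i" "\<Gamma> \<turnstile> p \<^bold>: Sig A B" "T = B\<langle>proj1 A p \<cdot> Var\<rangle>"
  shows "\<Gamma> \<turnstile> proj2 A B p \<^bold>: T"
  using SigE[OF proj2_motive[OF assms(1,2)] assms(3)] assms(4) by (simp add: proj2_def)

lemma proj2_beta:
  assumes A: "\<Gamma> \<turnstile> A \<^bold>: Univ i" and B: "A # \<Gamma> \<turnstile> B \<^bold>: Univ i"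
    and a: "\<Gamma> \<turnstile> a \<^bold>: A" and b: "\<Gamma> \<turnstile> b \<^bold>: B\<langle>a \<cdot> Var\<rangle>"
  shows "\<Gamma> \<turnstile> proj2 A B (Tup a b) \<doteq> b \<^bold>: B\<langle>a \<cdot> Var\<rangle>"
proof (rule EqConv)
  show "\<Gamma> \<turnstile> proj2 A B (Tup a b) \<doteq> b \<^bold>: B\<langle>proj1 A (Tup a b) \<cdot> Var\<rangle>"
    using SigBeta[OF proj2_motive[OF A B] a b] by (simp add: proj2_def)
  show "\<Gamma> \<turnstile> B\<langle>proj1 A (Tup a b) \<cdot> Var\<rangle> \<doteq> B\<langle>a \<cdot> Var\<rangle> \<^bold>: Univ i"
    by (rule eq_subst1[OF B proj1_beta[OF A B a b]]) simp
qed

subsection \<open>Transport, inversion and concatenation\<close>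

lemma transport_motive:
  assumes A: "\<Gamma> \<turnstile> A \<^bold>: Univ j" and P: "A # \<Gamma> \<turnstile> P \<^bold>: Univ i"
  shows "Eql A\<up>2 (Var (Suc 0)) (Var 0) # A\<Up> # A # \<Gamma> \<turnstile>
      Arr (P\<langle>Var 2 \<cdot> sh 3\<rangle>) (P\<langle>Var 1 \<cdot> sh 3\<rangle>) \<^bold>: Univ i" (is "?\<Gamma> \<turnstile> ?C \<^bold>: _")
    and "A # \<Gamma> \<turnstile> Lam P (Var 0) \<^bold>: (Arr (P\<langle>Var 2 \<cdot> sh 3\<rangle>) (P\<langle>Var 1 \<cdot> sh 3\<rangle>))\<langle>Refl (Var 0) \<cdot> Var 0 \<cdot>
        Var 0 \<cdot> sh 1\<rangle>"
proof -
  note w = wf_J[OF A] and e = wf_extends(3)[OF wf_J(1)[OF A]]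
  show "?\<Gamma> \<turnstile> ?C \<^bold>: Univ i"
    by (intro ArrF fam_weaken[OF P e] VarT) (auto simp: w )
  have "A # \<Gamma> \<turnstile> Lam P (Var 0) \<^bold>: Arr P P"
    using CtxCons[OF P] by (intro ArrI[OF P] VarT) auto
  then show "A # \<Gamma> \<turnstile> Lam P (Var 0) \<^bold>: ?C\<langle>Refl (Var 0) \<cdot> Var 0 \<cdot> Var 0 \<cdot> sh 1\<rangle>"
    by simp
qed

lemma transportT:
  assumes A: "\<Gamma> \<turnstile> A \<^bold>: Univ j" and P: "A # \<Gamma> \<turnstile> P \<^bold>: Univ i"
    and "\<Gamma> \<turnstile> a \<^bold>: A" "\<Gamma> \<turnstile> b \<^bold>: A" "\<Gamma> \<turnstile> p \<^bold>: Eql A a b"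
  shows "\<Gamma> \<turnstile> transport P a b p \<^bold>: Arr (P\<langle>a \<cdot> Var\<rangle>) (P\<langle>b \<cdot> Var\<rangle>)"
  using EqlE[of A \<Gamma>, simplified, OF _ _ assms(3-5)] transport_motive[OF A P]
  by (fastforce simp: transport_def)

lemma transport_refl:
  assumes A: "\<Gamma> \<turnstile> A \<^bold>: Univ j" and P: "A # \<Gamma> \<turnstile> P \<^bold>: Univ i"
    and a: "\<Gamma> \<turnstile> a \<^bold>: A" and u: "\<Gamma> \<turnstile> u \<^bold>: P\<langle>a \<cdot> Var\<rangle>"
  shows "\<Gamma> \<turnstile> App (transport P a a (Refl a)) u \<doteq> u \<^bold>: P\<langle>a \<cdot> Var\<rangle>"
proof -
  have Pa: "\<Gamma> \<turnstile> P\<langle>a \<cdot> Var\<rangle> \<^bold>: Univ i" by (rule fam_subst0[OF P a])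
  have "\<Gamma> \<turnstile> transport P a a (Refl a) \<doteq> Lam (P\<langle>a \<cdot> Var\<rangle>) (Var 0) \<^bold>: Arr (P\<langle>a \<cdot> Var\<rangle>) (P\<langle>a \<cdot> Var\<rangle>)"
    using EqlBeta[of A \<Gamma>, simplified, OF _ _ a] transport_motive[OF A P]
    by (fastforce simp: transport_def)
  then have "\<Gamma> \<turnstile> App (transport P a a (Refl a)) u \<doteq> App (Lam (P\<langle>a \<cdot> Var\<rangle>) (Var 0)) u \<^bold>: P\<langle>a \<cdot> Var\<rangle>"
    by (rule Arr_AppCong[OF Pa Pa]) (rule EqRefl[OF u])
  moreover have "P\<langle>a \<cdot> Var\<rangle> # \<Gamma> \<turnstile> Var 0 \<^bold>: P\<langle>a\<Up> \<cdot> sh (Suc 0)\<rangle>"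
    by (rule VarT[OF CtxCons[OF Pa]]) simp_all
  from PiBeta[OF this u] have "\<Gamma> \<turnstile> App (Lam (P\<langle>a \<cdot> Var\<rangle>) (Var 0)) u \<doteq> u \<^bold>: P\<langle>a \<cdot> Var\<rangle>" by simp
  ultimately show ?thesis by (rule EqTrans)
qed

lemma path_inv_motive:
  assumes A: "\<Gamma> \<turnstile> A \<^bold>: Univ i"
  shows "Eql A\<up>2 (Var (Suc 0)) (Var 0) # A\<Up> # A # \<Gamma> \<turnstile>
      Eql A\<up>3 (Var 1) (Var 2) \<^bold>: Univ i"
    and "A # \<Gamma> \<turnstile> Refl (Var 0) \<^bold>: (Eql A\<up>3 (Var 1) (Var 2))\<langle>Refl (Var 0) \<cdot> Var 0 \<cdot> Var 0 \<cdot> sh 1\<rangle>"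
proof -
  note w = wf_J[OF A] and e = wf_extends(3)[OF wf_J(1)[OF A]]
  show "Eql A\<up>2 (Var (Suc 0)) (Var 0) # A\<Up> # A # \<Gamma> \<turnstile>
      Eql A\<up>3 (Var 1) (Var 2) \<^bold>: Univ i"
    by (intro EqlF Univ_weaken[OF e A] VarT) (auto simp: w)
  have "A # \<Gamma> \<turnstile> Var 0 \<^bold>: A\<Up>" by (rule VarT) (auto simp: w)
  then show "A # \<Gamma> \<turnstile> Refl (Var 0) \<^bold>: (Eql A\<up>3 (Var 1) (Var 2))\<langle>Refl (Var 0) \<cdot> Var 0 \<cdot> Var 0 \<cdot> sh 1\<rangle>"
    by (simp add: EqlI)
qed

lemma path_invT:
  assumes A: "\<Gamma> \<turnstile> A \<^bold>: Univ i" and "\<Gamma> \<turnstile> a \<^bold>: A" "\<Gamma> \<turnstile> b \<^bold>: A" "\<Gamma> \<turnstile> p \<^bold>: Eql A a b"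
  shows "\<Gamma> \<turnstile> path_inv A a b p \<^bold>: Eql A b a"
  using EqlE[of A \<Gamma>, simplified, OF _ _ assms(2-4)] path_inv_motive[OF A]
  by (fastforce simp: path_inv_def)

lemma path_inv_refl:
  assumes A: "\<Gamma> \<turnstile> A \<^bold>: Univ i" and a: "\<Gamma> \<turnstile> a \<^bold>: A"
  shows "\<Gamma> \<turnstile> path_inv A a a (Refl a) \<doteq> Refl a \<^bold>: Eql A a a"
  using EqlBeta[of A \<Gamma>, simplified, OF _ _ a] path_inv_motive[OF A]
  by (fastforce simp: path_inv_def)

lemma based_path_fam:
  assumes A: "\<Gamma> \<turnstile> A \<^bold>: Univ i" and a: "\<Gamma> \<turnstile> a \<^bold>: A"
  shows "A # \<Gamma> \<turnstile> Eql A\<Up> a\<Up> (Var 0) \<^bold>: Univ i"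
proof -
  note w = CtxCons[OF A] note e = wf_extends(1)[OF w]
  show ?thesis
    by (intro EqlF Univ_weaken[OF e A] extends_weaken[OF e a] VarT) (auto simp: w)
qed

lemma path_compT:
  assumes A: "\<Gamma> \<turnstile> A \<^bold>: Univ i" and "\<Gamma> \<turnstile> a \<^bold>: A" "\<Gamma> \<turnstile> b \<^bold>: A" "\<Gamma> \<turnstile> c \<^bold>: A"
    and "\<Gamma> \<turnstile> p \<^bold>: Eql A a b" "\<Gamma> \<turnstile> q \<^bold>: Eql A b c"
  shows "\<Gamma> \<turnstile> path_comp A a b c p q \<^bold>: Eql A a c"
  using ArrE[OF transportT[OF A based_path_fam[OF A assms(2)] assms(3,4,6)], of p] assms(5)
  by (simp add: path_comp_def)

lemma path_comp_refl:
  assumes A: "\<Gamma> \<turnstile> A \<^bold>: Univ i" and "\<Gamma> \<turnstile> a \<^bold>: A" "\<Gamma> \<turnstile> b \<^bold>: A" "\<Gamma> \<turnstile> p \<^bold>: Eql A a b"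
  shows "\<Gamma> \<turnstile> path_comp A a b b p (Refl b) \<doteq> p \<^bold>: Eql A a b"
  using transport_refl[OF A based_path_fam[OF A assms(2)] assms(3), of p] assms(4)
  by (simp add: path_comp_def)


section \<open>Reasoning about inhabited types\<close>

text \<open>
  Working with this predicate turns type theory into a logic with the usual introduction and
  elimination rules, in which proof terms need not be written down.
\<close>

definition inhabited :: "tm list \<Rightarrow> tm \<Rightarrow> bool" where
  "inhabited \<Gamma> A \<longleftrightarrow> (\<exists>t. \<Gamma> \<turnstile> t \<^bold>: A)"

lemma inhabitedI: "\<Gamma> \<turnstile> t \<^bold>: A \<Longrightarrow> inhabited \<Gamma> A"
  by (auto simp: inhabited_def)

lemma inhabited_conv: "inhabited \<Gamma> A \<Longrightarrow> \<Gamma> \<turnstile> A \<doteq> B \<^bold>: Univ i \<Longrightarrow> inhabited \<Gamma> B"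
  by (auto simp: inhabited_def intro: Conv)

lemma inhabited_subst: "inhabited \<Gamma> A \<Longrightarrow> sub \<Delta> \<sigma> \<Gamma> \<Longrightarrow> T = A\<langle>\<sigma>\<rangle> \<Longrightarrow> inhabited \<Delta> T"
  unfolding inhabited_def using type_subst by blast

lemma inhabited_weaken: "inhabited \<Gamma> A \<Longrightarrow> extends n \<Gamma> \<Delta> \<Longrightarrow> T = A\<up>n \<Longrightarrow> inhabited \<Delta> T"
  using inhabited_subst extends_sub by blast

lemma inhabited_Pi: "\<Gamma> \<turnstile> A \<^bold>: Univ i \<Longrightarrow> inhabited (A # \<Gamma>) B \<Longrightarrow> inhabited \<Gamma> (Pi A B)"
  unfolding inhabited_def by (blast intro: PiI)

lemma inhabited_app: "inhabited \<Gamma> (Pi A B) \<Longrightarrow> \<Gamma> \<turnstile> a \<^bold>: A \<Longrightarrow> T = B\<langle>a \<cdot> Var\<rangle> \<Longrightarrow> inhabited \<Gamma> T"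
  unfolding inhabited_def using PiE by blast

lemma inhabited_app_Arr: "inhabited \<Gamma> (Arr A B) \<Longrightarrow> inhabited \<Gamma> A \<Longrightarrow> inhabited \<Gamma> B"
  unfolding inhabited_def using ArrE by blast

lemma inhabited_Arr: "\<Gamma> \<turnstile> A \<^bold>: Univ i \<Longrightarrow> inhabited (A # \<Gamma>) B\<Up> \<Longrightarrow> inhabited \<Gamma> (Arr A B)"
  unfolding inhabited_def by (blast intro: ArrI)

text \<open>
  The hypothesis of an implication enters as an assumption about an arbitrary extension of the
  context instead of as a variable, so that lemmas stated for arbitrary contexts apply to it.
\<close>

lemma inhabited_Arr_generic:
  assumes A: "\<Gamma> \<turnstile> A \<^bold>: Univ i"
    and step: "\<And>\<Delta> n. extends n \<Gamma> \<Delta> \<Longrightarrow> inhabited \<Delta> A\<up>n \<Longrightarrow> inhabited \<Delta> B\<up>n"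
  shows "inhabited \<Gamma> (Arr A B)"
proof (rule inhabited_Arr[OF A step])
  note w = CtxCons[OF A]
  show "extends (Suc 0) \<Gamma> (A # \<Gamma>)" by (rule wf_extends(1)[OF w])
  show "inhabited (A # \<Gamma>) A\<Up>" by (rule inhabitedI[OF VarT[of _ 0]]) (simp_all add: w)
qed

lemma inhabited_Sig:
  "A # \<Gamma> \<turnstile> B \<^bold>: Univ i \<Longrightarrow> \<Gamma> \<turnstile> a \<^bold>: A \<Longrightarrow> inhabited \<Gamma> (B\<langle>a \<cdot> Var\<rangle>) \<Longrightarrow> inhabited \<Gamma> (Sig A B)"
  unfolding inhabited_def by (blast intro: SigI)

lemma inhabited_Prod:
  "\<Gamma> \<turnstile> A \<^bold>: Univ i \<Longrightarrow> \<Gamma> \<turnstile> B \<^bold>: Univ i \<Longrightarrow> inhabited \<Gamma> A \<Longrightarrow> inhabited \<Gamma> B \<Longrightarrow> inhabited \<Gamma> (Prod A B)"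
  unfolding inhabited_def by (blast intro: ProdI)

lemma inhabited_SigE:
  "Sig A B # \<Gamma> \<turnstile> C \<^bold>: Univ i \<Longrightarrow> inhabited (B # A # \<Gamma>) (C\<langle>Tup (Var (Suc 0)) (Var 0) \<cdot> sh 2\<rangle>) \<Longrightarrow>
    \<Gamma> \<turnstile> p \<^bold>: Sig A B \<Longrightarrow> T = C\<langle>p \<cdot> Var\<rangle> \<Longrightarrow> inhabited \<Gamma> T"
  unfolding inhabited_def using SigE[of A B \<Gamma> C i] by auto

lemma inhabited_J:
  assumes "Eql A\<up>2 (Var (Suc 0)) (Var 0) # A\<Up> # A # \<Gamma> \<turnstile> C \<^bold>: Univ k"
    and "inhabited (A # \<Gamma>) (C\<langle>Refl (Var 0) \<cdot> Var 0 \<cdot> Var 0 \<cdot> sh (Suc 0)\<rangle>)"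
    and "\<Gamma> \<turnstile> a \<^bold>: A" "\<Gamma> \<turnstile> b \<^bold>: A" "\<Gamma> \<turnstile> p \<^bold>: Eql A a b" "T = C\<langle>p \<cdot> b \<cdot> a \<cdot> Var\<rangle>"
  shows "inhabited \<Gamma> T"
  using assms EqlE[of A \<Gamma> C k _ a b p] by (auto simp: inhabited_def)

lemma inhabited_PTr:
  assumes C: "\<Gamma> \<turnstile> C \<^bold>: Univ i" and A: "\<Gamma> \<turnstile> A \<^bold>: Univ j"
    and c: "inhabited (A # \<Gamma>) C\<Up>"
    and h: "inhabited \<Gamma> (isProp C)" and t: "inhabited \<Gamma> (PTr A)"
  shows "inhabited \<Gamma> C"
proof -
  have w: "wf_ctx (PTr A # \<Gamma>)" using A by (intro CtxCons PTrF)
  note e = wf_extends(1)[OF w]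
  have "inhabited (PTr A # \<Gamma>) (isProp C\<Up>)"
    by (rule inhabited_weaken[OF h e]) (simp add: isProp_def)
  then show ?thesis
    using PTrE[of A \<Gamma> "C\<Up>" i] Univ_weaken[OF e C] c t
    by (auto simp: inhabited_def)
qed

subsection \<open>Identity types\<close>

lemma inhabited_refl: "\<Gamma> \<turnstile> A \<^bold>: Univ i \<Longrightarrow> \<Gamma> \<turnstile> s \<^bold>: A \<Longrightarrow> \<Gamma> \<turnstile> s \<doteq> t \<^bold>: A \<Longrightarrow> inhabited \<Gamma> (Eql A s t)"
  by (rule inhabited_conv[OF inhabitedI[OF EqlI] EqlCong[OF _ EqRefl]])

lemma inhabited_Eql_conv:
  assumes "inhabited \<Gamma> (Eql A s t)" "\<Gamma> \<turnstile> A \<^bold>: Univ i" "\<Gamma> \<turnstile> s \<doteq> s' \<^bold>: A" "\<Gamma> \<turnstile> t \<doteq> t' \<^bold>: A"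
  shows "inhabited \<Gamma> (Eql A s' t')"
  by (rule inhabited_conv[OF assms(1) EqlCong[OF assms(2-4)]])

lemma inhabited_sym:
  "inhabited \<Gamma> (Eql A a b) \<Longrightarrow> \<Gamma> \<turnstile> A \<^bold>: Univ i \<Longrightarrow> \<Gamma> \<turnstile> a \<^bold>: A \<Longrightarrow> \<Gamma> \<turnstile> b \<^bold>: A \<Longrightarrow> inhabited \<Gamma> (Eql A b a)"
  unfolding inhabited_def using path_invT by blast

lemma inhabited_trans:
  "inhabited \<Gamma> (Eql A a b) \<Longrightarrow> inhabited \<Gamma> (Eql A b c) \<Longrightarrow> \<Gamma> \<turnstile> A \<^bold>: Univ i \<Longrightarrow>
    \<Gamma> \<turnstile> a \<^bold>: A \<Longrightarrow> \<Gamma> \<turnstile> b \<^bold>: A \<Longrightarrow> \<Gamma> \<turnstile> c \<^bold>: A \<Longrightarrow> inhabited \<Gamma> (Eql A a c)"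
  unfolding inhabited_def using path_compT by blast

lemma inhabited_transport:
  assumes "inhabited \<Gamma> (Eql A a b)" "\<Gamma> \<turnstile> A \<^bold>: Univ j" "A # \<Gamma> \<turnstile> C \<^bold>: Univ i"
    and "\<Gamma> \<turnstile> a \<^bold>: A" "\<Gamma> \<turnstile> b \<^bold>: A" "inhabited \<Gamma> (C\<langle>a \<cdot> Var\<rangle>)" "T = C\<langle>b \<cdot> Var\<rangle>"
  shows "inhabited \<Gamma> T"
proof -
  obtain p c where p: "\<Gamma> \<turnstile> p \<^bold>: Eql A a b" and c: "\<Gamma> \<turnstile> c \<^bold>: C\<langle>a \<cdot> Var\<rangle>"
    using assms(1,6) by (auto simp: inhabited_def)
  show ?thesis
    using ArrE[OF transportT[OF assms(2-5) p] c] assms(7) by (simp add: inhabitedI)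
qed

lemma inhabited_happly:
  assumes eq: "inhabited \<Gamma> (Eql (Pi A B) f g)" and A: "\<Gamma> \<turnstile> A \<^bold>: Univ i" and B: "A # \<Gamma> \<turnstile> B \<^bold>: Univ i"
    and f: "\<Gamma> \<turnstile> f \<^bold>: Pi A B" and g: "\<Gamma> \<turnstile> g \<^bold>: Pi A B" and a: "\<Gamma> \<turnstile> a \<^bold>: A" and T: "T = B\<langle>a \<cdot> Var\<rangle>"
  shows "inhabited \<Gamma> (Eql T (App f a) (App g a))"
proof (rule inhabited_transport[OF eq _ _ f g])
  let ?C = "Eql (B\<langle>a\<Up> \<cdot> sh (Suc 0)\<rangle>) (App f\<Up> a\<Up>) (App (Var 0) a\<Up>)"
  show PiT: "\<Gamma> \<turnstile> Pi A B \<^bold>: Univ i" by (rule PiF[OF A B])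
  note w = CtxCons[OF PiT] note e = wf_extends(1)[OF w]
  have a': "Pi A B # \<Gamma> \<turnstile> a\<Up> \<^bold>: A\<Up>" by (rule extends_weaken[OF e a]) simp
  show "Pi A B # \<Gamma> \<turnstile> ?C \<^bold>: Univ i"
    by (intro EqlF fam_weaken[OF B e a'] PiET[OF _ a', of _ "B\<langle>Var 0 \<cdot> sh 2\<rangle>"]
      extends_weaken[OF e f] VarT) (auto simp: w)
  show "inhabited \<Gamma> (?C\<langle>f \<cdot> Var\<rangle>)"
    by (rule inhabitedI[of _ "Refl (App f a)"]) (simp add: EqlI PiE[OF f a])
  show "Eql T (App f a) (App g a) = ?C\<langle>g \<cdot> Var\<rangle>" by (simp add: T)
qed

subsection \<open>Equivalences and function extensionality\<close>

lemma isEquiv_parts: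
  assumes A: "\<Gamma> \<turnstile> A \<^bold>: Univ i" and B: "\<Gamma> \<turnstile> B \<^bold>: Univ i" and f: "\<Gamma> \<turnstile> f \<^bold>: Arr A B"
  shows "Arr B A # \<Gamma> \<turnstile> Pi B\<Up> (Eql B\<up>2 (App f\<up>2 (App (Var (Suc 0)) (Var 0))) (Var 0)) \<^bold>: Univ i"
    and "Arr B A # \<Gamma> \<turnstile> Pi A\<Up> (Eql A\<up>2 (App (Var (Suc 0)) (App f\<up>2 (Var 0))) (Var 0)) \<^bold>: Univ i"
proof -
  have w: "wf_ctx (Arr B A # \<Gamma>)" using A B by (intro CtxCons ArrF)
  note e = wf_extends(1)[OF w]
  have A1: "Arr B A # \<Gamma> \<turnstile> A\<Up> \<^bold>: Univ i" by (rule Univ_weaken[OF e A])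
  have B1: "Arr B A # \<Gamma> \<turnstile> B\<Up> \<^bold>: Univ i" by (rule Univ_weaken[OF e B])
  note wA = CtxCons[OF A1] and wB = CtxCons[OF B1]
  note eA = wf_extends(2)[OF wA] and eB = wf_extends(2)[OF wB]
  show "Arr B A # \<Gamma> \<turnstile> Pi B\<Up> (Eql B\<up>2 (App f\<up>2 (App (Var (Suc 0)) (Var 0))) (Var 0)) \<^bold>: Univ i"
    by (intro PiF B1 EqlF Univ_weaken[OF eB B] ArrE[OF extends_weaken[OF eB f, of "Arr A\<up>2 B\<up>2"]]
       ArrE[of _ "Var (Suc 0)" "B\<up>2"] VarT) (auto simp: wB)
  show "Arr B A # \<Gamma> \<turnstile> Pi A\<Up> (Eql A\<up>2 (App (Var (Suc 0)) (App f\<up>2 (Var 0))) (Var 0)) \<^bold>: Univ i"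
    by (intro PiF A1 EqlF Univ_weaken[OF eA A] ArrE[OF extends_weaken[OF eA f, of "Arr A\<up>2 B\<up>2"]]
       ArrE[of _ "Var (Suc 0)" "B\<up>2"] VarT) (auto simp: wA)
qed

lemma isEquivF:
  assumes A: "\<Gamma> \<turnstile> A \<^bold>: Univ i" and B: "\<Gamma> \<turnstile> B \<^bold>: Univ i" and f: "\<Gamma> \<turnstile> f \<^bold>: Arr A B"
  shows "\<Gamma> \<turnstile> isEquiv A B f \<^bold>: Univ i"
  using SigF[OF ArrF[OF B A] isEquiv_parts(1)[OF assms]] SigF[OF ArrF[OF B
      A] isEquiv_parts(2)[OF assms]]
  by (simp add: isEquiv_def ProdF)

lemma inhabited_isEquiv:
  assumes A: "\<Gamma> \<turnstile> A \<^bold>: Univ i" and B: "\<Gamma> \<turnstile> B \<^bold>: Univ i" and f: "\<Gamma> \<turnstile> f \<^bold>: Arr A B"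
    and g: "\<Gamma> \<turnstile> g \<^bold>: Arr B A"
    and fg: "inhabited (B # \<Gamma>) (Eql B\<Up> (App f\<Up> (App g\<Up> (Var 0))) (Var 0))"
    and gf: "inhabited (A # \<Gamma>) (Eql A\<Up> (App g\<Up> (App f\<Up> (Var 0))) (Var 0))"
  shows "inhabited \<Gamma> (isEquiv A B f)"
  unfolding isEquiv_def
proof (rule inhabited_Prod)
  note parts = isEquiv_parts[OF A B f]
  let ?S = "Sig (Arr B A) (Pi (wk 1 B) (Eql (wk 2 B) (App (wk 2 f) (App (Var 1) (Var 0))) (Var 0)))"
  let ?R = "Sig (Arr B A) (Pi (wk 1 A) (Eql (wk 2 A) (App (Var 1) (App (wk 2 f) (Var 0))) (Var 0)))"
  show "\<Gamma> \<turnstile> ?S \<^bold>: Univ i" "\<Gamma> \<turnstile> ?R \<^bold>: Univ i"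
    using SigF[OF ArrF[OF B A] parts(1)] SigF[OF ArrF[OF B A] parts(2)] by simp_all
  show "inhabited \<Gamma> ?S"
    by (rule inhabited_Sig[OF _ g, of _ i]) (use parts(1) inhabited_Pi[OF B fg] in simp_all)
  show "inhabited \<Gamma> ?R"
    by (rule inhabited_Sig[OF _ g, of _ i]) (use parts(2) inhabited_Pi[OF A gf] in simp_all)
qed

text \<open>
  For the function extensionality axiom, this inverse takes pointwise equality to equality of
  functions.
\<close>

lemma inhabited_isEquiv_inv:
  assumes A: "\<Gamma> \<turnstile> A \<^bold>: Univ i" and B: "\<Gamma> \<turnstile> B \<^bold>: Univ i" and f: "\<Gamma> \<turnstile> f \<^bold>: Arr A B"
    and e: "inhabited \<Gamma> (isEquiv A B f)"
  shows "inhabited \<Gamma> (Arr B A)"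
proof -
  note S1 = SigF[OF ArrF[OF B A] isEquiv_parts(1)[OF A B f]]
    and S2 = SigF[OF ArrF[OF B A] isEquiv_parts(2)[OF A B f]]
  obtain t where "\<Gamma> \<turnstile> t \<^bold>: isEquiv A B f" using e by (auto simp: inhabited_def)
  then show ?thesis
    using proj1T[OF ArrF[OF B A] isEquiv_parts(1)[OF A B f] proj1T[OF S1
        Univ_weaken[OF wf_extends(1)[OF CtxCons[OF S1]] S2]]]
    by (auto simp: isEquiv_def Prod_def inhabited_def)
qed

lemma App_weaken_Var:
  assumes f: "\<Gamma> \<turnstile> f \<^bold>: Pi A B" and e: "extends n \<Gamma> \<Delta>" and a: "\<Delta> \<turnstile> a \<^bold>: A\<up>n" and T: "T = B\<langle>a \<cdot> sh n\<rangle>"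
  shows "\<Delta> \<turnstile> App f\<up>n a \<^bold>: T"
  by (rule PiET[OF extends_weaken[OF e f] a, of "B\<langle>Var 0 \<cdot> sh (Suc n)\<rangle>"]) (simp_all add: T)

lemma homotopyF:
  assumes A: "\<Gamma> \<turnstile> A \<^bold>: Univ i" and B: "A # \<Gamma> \<turnstile> B \<^bold>: Univ i" and f: "\<Gamma> \<turnstile> f \<^bold>: Pi A B"
    and g: "\<Gamma> \<turnstile> g \<^bold>: Pi A B"
  shows "\<Gamma> \<turnstile> homotopy A B f g \<^bold>: Univ i"
  unfolding homotopy_def wk_eq One_nat_def
  by (intro PiF A EqlF B App_weaken_Var[OF f wf_extends(1)] App_weaken_Var[OF g wf_extends(1)] VarT)
    (auto simp: CtxCons[OF A])

lemma happlyT: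
  assumes A: "\<Gamma> \<turnstile> A \<^bold>: Univ i" and B: "A # \<Gamma> \<turnstile> B \<^bold>: Univ i" and f: "\<Gamma> \<turnstile> f \<^bold>: Pi A B"
    and g: "\<Gamma> \<turnstile> g \<^bold>: Pi A B"
    and p: "\<Gamma> \<turnstile> p \<^bold>: Eql (Pi A B) f g"
  shows "\<Gamma> \<turnstile> happly A B f g p \<^bold>: homotopy A B f g"
proof -
  let ?\<Pi> = "Pi A B"
  let ?C = "homotopy A\<up>3 (B\<langle>Var 0 \<cdot> sh 4\<rangle>) (Var 2) (Var (Suc 0))"
  note PiT = PiF[OF A B]
  note w = wf_J[OF PiT] note e3 = wf_extends(3)[OF w(1)] and e1 = wf_extends(1)[OF w(3)]
  have A3: "Eql (?\<Pi>\<up>2) (Var (Suc 0)) (Var 0) # ?\<Pi>\<Up> # ?\<Pi> # \<Gamma> \<turnstile> A\<up>3 \<^bold>: Univ i"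
    by (rule Univ_weaken[OF e3 A])
  have C: "Eql (?\<Pi>\<up>2) (Var (Suc 0)) (Var 0) # ?\<Pi>\<Up> # ?\<Pi> # \<Gamma> \<turnstile> ?C \<^bold>: Univ i"
  proof (rule homotopyF[OF A3])
    show "A\<up>3 # Eql (?\<Pi>\<up>2) (Var (Suc 0)) (Var 0) # ?\<Pi>\<Up> # ?\<Pi> # \<Gamma> \<turnstile>
        B\<langle>Var 0 \<cdot> sh 4\<rangle> \<^bold>: Univ i"
      by (rule fam_weaken[OF B], simp add: extends_def CtxCons[OF A3, simplified], rule VarT)
        (simp_all add: CtxCons[OF A3, simplified])
  qed (rule VarT; use w in simp)+
  have A1: "?\<Pi> # \<Gamma> \<turnstile> A\<Up> \<^bold>: Univ i" by (rule Univ_weaken[OF e1 A])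
  have "A\<Up> # ?\<Pi> # \<Gamma> \<turnstile> App (Var (Suc 0)) (Var 0) \<^bold>: B\<langle>Var 0 \<cdot> sh 2\<rangle>"
    by (rule PiET[of _ _ "A\<up>2" "B\<langle>Var 0 \<cdot> sh 3\<rangle>"]; (rule VarT)?)
      (simp_all add: CtxCons[OF A1])
  then have c: "?\<Pi> # \<Gamma> \<turnstile> Lam A\<Up> (Refl (App (Var (Suc 0)) (Var 0))) \<^bold>:
      ?C\<langle>Refl (Var 0) \<cdot> Var 0 \<cdot> Var 0 \<cdot> sh (Suc 0)\<rangle>"
    unfolding homotopy_def by (auto intro!: PiI[OF A1] EqlI)
  show ?thesis
    using EqlE[unfolded wk_eq One_nat_def, OF C c f g p]
    by (simp add: happly_def homotopy_def)
qed

lemma inhabited_funext: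
  assumes A: "\<Gamma> \<turnstile> A \<^bold>: Univ i" and B: "A # \<Gamma> \<turnstile> B \<^bold>: Univ i" and f: "\<Gamma> \<turnstile> f \<^bold>: Pi A B"
    and g: "\<Gamma> \<turnstile> g \<^bold>: Pi A B"
    and eq: "inhabited (A # \<Gamma>) (Eql B (App f\<Up> (Var 0)) (App g\<Up> (Var 0)))"
  shows "inhabited \<Gamma> (Eql (Pi A B) f g)"
proof -
  let ?E = "Eql (Pi A B) f g" and ?H = "homotopy A B f g"
  have E: "\<Gamma> \<turnstile> ?E \<^bold>: Univ i" by (intro EqlF PiF A B f g)
  have H: "\<Gamma> \<turnstile> ?H \<^bold>: Univ i" by (rule homotopyF[OF A B f g])
  note w = CtxCons[OF E] note e = wf_extends(1)[OF w]
  have A1: "?E # \<Gamma> \<turnstile> A\<Up> \<^bold>: Univ i" by (rule Univ_weaken[OF e A])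
  have B1: "A\<Up> # ?E # \<Gamma> \<turnstile> B\<langle>Var 0 \<cdot> sh 2\<rangle> \<^bold>: Univ i"
    by (intro fam_weaken[OF B wf_extends(2)] VarT) (auto simp: CtxCons[OF A1])
  have "?E # \<Gamma> \<turnstile> happly A\<Up> (B\<langle>Var 0 \<cdot> sh 2\<rangle>) f\<Up> g\<Up> (Var 0)
      \<^bold>: homotopy A\<Up> (B\<langle>Var 0 \<cdot> sh 2\<rangle>) f\<Up> g\<Up>"
    by (intro happlyT[OF A1 B1] extends_weaken[OF e f] extends_weaken[OF e g] VarT) (auto simp: w)
  then have h: "\<Gamma> \<turnstile> Lam ?E (happly (wk 1 A) (B\<langle>Var 0 \<cdot> sh 2\<rangle>) (wk 1 f) (wk 1 g) (Var 0)) \<^bold>: Arr ?E ?H"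
    by (intro ArrI[OF E]) (simp add: homotopy_def)
  have "inhabited \<Gamma> (Arr ?H ?E)"
    by (rule inhabited_isEquiv_inv[OF E H h inhabitedI[OF FunExtAx[OF f g]]])
  moreover have "inhabited \<Gamma> ?H"
    unfolding homotopy_def using eq by (intro inhabited_Pi[OF A]) simp
  ultimately show ?thesis by (rule inhabited_app_Arr)
qed

section \<open>Propositions, sets and truncations\<close>

lemma subst_isProp [simp]: "(isProp A)\<langle>\<sigma>\<rangle> = isProp (A\<langle>\<sigma>\<rangle>)"
  by (simp add: isProp_def)

lemma subst_isSet [simp]: "(isSet A)\<langle>\<sigma>\<rangle> = isSet (A\<langle>\<sigma>\<rangle>)"
  by (simp add: isSet_def)

lemma subst_STr_isSet [simp]: "(STr_isSet A)\<langle>\<sigma>\<rangle> = STr_isSet (A\<langle>\<sigma>\<rangle>)"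
  by (simp add: STr_isSet_def)

lemma comp_inv_refl:
  assumes A: "\<Gamma> \<turnstile> A \<^bold>: Univ i" and a: "\<Gamma> \<turnstile> a \<^bold>: A"
  shows "\<Gamma> \<turnstile> path_comp A a a a (path_inv A a a (Refl a)) (Refl a) \<doteq> Refl a \<^bold>: Eql A a a"
  by (rule EqTrans[OF path_comp_refl[OF A a a path_invT[OF A a a EqlI[OF a]]] path_inv_refl[OF A a]])

text \<open>
  By path induction, since both sides compute to \<open>refl\<close> when \<open>p\<close> is \<open>refl\<close>.
\<close>

lemma comp_inv:
  assumes A: "\<Gamma> \<turnstile> A \<^bold>: Univ i" and a: "\<Gamma> \<turnstile> a \<^bold>: A" and b: "\<Gamma> \<turnstile> b \<^bold>: A" and p: "\<Gamma> \<turnstile> p \<^bold>: Eql A a b"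
  shows "inhabited \<Gamma> (Eql (Eql A b b) (Refl b) (path_comp A b a b (path_inv A a b p) p))"
proof (rule inhabited_J[OF _ _ a b p])
  note w = wf_J[OF A]
  let ?\<Delta> = "Eql A\<up>2 (Var (Suc 0)) (Var 0) # A\<Up> # A # \<Gamma>"
  let ?C = "Eql (Eql A\<up>3 (Var 1) (Var 1)) (Refl (Var 1))
    (path_comp A\<up>3 (Var 1) (Var 2) (Var 1) (path_inv A\<up>3 (Var 2) (Var 1) (Var 0)) (Var 0))"
  have A3: "?\<Delta> \<turnstile> A\<up>3 \<^bold>: Univ i" by (rule Univ_weaken[OF wf_extends(3)[OF w(1)] A])
  show "?\<Delta> \<turnstile> ?C \<^bold>: Univ i"
    by (intro EqlF A3 ReflT path_compT[OF A3] path_invT[OF A3] VarT) (simp_all add: w)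
  have A1: "A # \<Gamma> \<turnstile> A\<Up> \<^bold>: Univ i" by (rule Univ_weaken[OF wf_extends(1)[OF w(3)] A])
  have v: "A # \<Gamma> \<turnstile> Var 0 \<^bold>: A\<Up>" by (rule VarT) (simp_all add: w)
  show "inhabited (A # \<Gamma>) (?C\<langle>Refl (Var 0) \<cdot> Var 0 \<cdot> Var 0 \<cdot> sh (Suc 0)\<rangle>)"
    using inhabited_refl[OF EqlF[OF A1 v v] EqlI[OF v] EqSym[OF comp_inv_refl[OF A1 v]]] by simp
qed simp

lemma isPropE:
  assumes h: "\<Gamma> \<turnstile> h \<^bold>: isProp A" and s: "\<Gamma> \<turnstile> s \<^bold>: A" and t: "\<Gamma> \<turnstile> t \<^bold>: A"
  shows "\<Gamma> \<turnstile> App (App h s) t \<^bold>: Eql A s t"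
  by (rule PiET[OF PiET[OF h[unfolded isProp_def] s refl, simplified] t]) simp

text \<open>
  Path induction on \<open>p\<close> reduces this to the inverse law for the path \<open>h a a\<close>. The right-hand side
  does not depend on \<open>p\<close>, so any two paths from \<open>a\<close> to \<open>b\<close> are equal; thus propositions are sets.
\<close>

lemma isProp_path:
  assumes A: "\<Gamma> \<turnstile> A \<^bold>: Univ i" and h: "\<Gamma> \<turnstile> h \<^bold>: isProp A"
    and a: "\<Gamma> \<turnstile> a \<^bold>: A" and b: "\<Gamma> \<turnstile> b \<^bold>: A" and p: "\<Gamma> \<turnstile> p \<^bold>: Eql A a b"
  shows "inhabited \<Gamma> (Eql (Eql A a b) p
    (path_comp A a a b (path_inv A a a (App (App h a) a)) (App (App h a) b)))"
proof (rule inhabited_J[OF _ _ a b p])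
  note w = wf_J[OF A]
  let ?\<Delta> = "Eql A\<up>2 (Var (Suc 0)) (Var 0) # A\<Up> # A # \<Gamma>"
  let ?h = "\<lambda>x y. App (App h\<up>3 x) y"
  let ?C = "Eql (Eql A\<up>3 (Var 2) (Var 1)) (Var 0)
    (path_comp A\<up>3 (Var 2) (Var 2) (Var 1)
      (path_inv A\<up>3 (Var 2) (Var 2) (?h (Var 2) (Var 2))) (?h (Var 2) (Var 1)))"
  note e3 = wf_extends(3)[OF w(1)] note e1 = wf_extends(1)[OF w(3)]
  have A3: "?\<Delta> \<turnstile> A\<up>3 \<^bold>: Univ i" by (rule Univ_weaken[OF e3 A])
  have h3: "?\<Delta> \<turnstile> h\<up>3 \<^bold>: isProp A\<up>3" by (rule extends_weaken[OF e3 h]) simp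
  show "?\<Delta> \<turnstile> ?C \<^bold>: Univ i"
    by (intro EqlF A3 path_compT[OF A3] path_invT[OF A3] isPropE[OF h3] VarT) (simp_all add: w)
  have A1: "A # \<Gamma> \<turnstile> A\<Up> \<^bold>: Univ i" by (rule Univ_weaken[OF e1 A])
  have h1: "A # \<Gamma> \<turnstile> h\<Up> \<^bold>: isProp A\<Up>" by (rule extends_weaken[OF e1 h]) simp
  have v: "A # \<Gamma> \<turnstile> Var 0 \<^bold>: A\<Up>" by (rule VarT) (simp_all add: w)
  show "inhabited (A # \<Gamma>) (?C\<langle>Refl (Var 0) \<cdot> Var 0 \<cdot> Var 0 \<cdot> sh (Suc 0)\<rangle>)"
    using comp_inv[OF A1 v v isPropE[OF h1 v v]] by simp
qed simp

lemma isSet_of_isProp: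
  assumes A: "\<Gamma> \<turnstile> A \<^bold>: Univ i" and h: "inhabited \<Gamma> (isProp A)"
  shows "inhabited \<Gamma> (isSet A)"
proof -
  let ?\<Gamma>2 = "A\<Up> # A # \<Gamma>"
  let ?\<Gamma>3 = "Eql A\<up>2 (Var (Suc 0)) (Var 0) # ?\<Gamma>2"
  let ?\<Gamma>4 = "Eql A\<up>3 (Var 2) (Var (Suc 0)) # ?\<Gamma>3"
  note w = wf_J[OF A]
  have A1: "A # \<Gamma> \<turnstile> A\<Up> \<^bold>: Univ i" by (rule Univ_weaken[OF wf_extends(1)[OF w(3)] A])
  have A2: "?\<Gamma>2 \<turnstile> A\<up>2 \<^bold>: Univ i" by (rule Univ_weaken[OF wf_extends(2)[OF w(2)] A])
  have A3: "?\<Gamma>3 \<turnstile> A\<up>3 \<^bold>: Univ i" by (rule Univ_weaken[OF wf_extends(3)[OF w(1)] A])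
  have E2: "?\<Gamma>2 \<turnstile> Eql A\<up>2 (Var (Suc 0)) (Var 0) \<^bold>: Univ i"
    by (intro EqlF A2 VarT) (simp_all add: w)
  have E3: "?\<Gamma>3 \<turnstile> Eql A\<up>3 (Var 2) (Var (Suc 0)) \<^bold>: Univ i"
    by (intro EqlF A3 VarT) (simp_all add: w)
  note w4 = CtxCons[OF E3]
  have e4: "extends 4 \<Gamma> ?\<Gamma>4" using w4 by (simp add: extends_def)
  have A4: "?\<Gamma>4 \<turnstile> A\<up>4 \<^bold>: Univ i" by (rule Univ_weaken[OF e4 A])
  obtain k where k: "\<Gamma> \<turnstile> k \<^bold>: isProp A" using h by (auto simp: inhabited_def)
  have h4: "?\<Gamma>4 \<turnstile> k\<up>4 \<^bold>: isProp A\<up>4" by (rule extends_weaken[OF e4 k]) simp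
  let ?h = "\<lambda>x y. App (App k\<up>4 x) y"
  let ?K = "path_comp A\<up>4 (Var 3) (Var 3) (Var 2)
      (path_inv A\<up>4 (Var 3) (Var 3) (?h (Var 3) (Var 3))) (?h (Var 3) (Var 2))"
  have v: "?\<Gamma>4 \<turnstile> Var 3 \<^bold>: A\<up>4" "?\<Gamma>4 \<turnstile> Var 2 \<^bold>: A\<up>4"
    "?\<Gamma>4 \<turnstile> Var (Suc 0) \<^bold>: Eql A\<up>4 (Var 3) (Var 2)" "?\<Gamma>4 \<turnstile> Var 0 \<^bold>: Eql A\<up>4 (Var 3) (Var 2)"
    by (rule VarT; simp add: w4)+
  note E4 = EqlF[OF A4 v(1,2)]
  have K: "?\<Gamma>4 \<turnstile> ?K \<^bold>: Eql A\<up>4 (Var 3) (Var 2)"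
    by (intro path_compT[OF A4] path_invT[OF A4] isPropE[OF h4] v)
  have "inhabited ?\<Gamma>4 (Eql (Eql A\<up>4 (Var 3) (Var 2)) (Var (Suc 0)) (Var 0))"
    by (rule inhabited_trans[OF isProp_path[OF A4 h4 v(1-3)]
      inhabited_sym[OF isProp_path[OF A4 h4 v(1,2,4)] E4 v(4) K] E4 v(3) K v(4)])
  from inhabited_Pi[OF A inhabited_Pi[OF A1 inhabited_Pi[OF E2 inhabited_Pi[OF E3 this]]]]
  show ?thesis by (simp add: isSet_def)
qed

lemma STr_isSetT:
  assumes L: "\<Gamma> \<turnstile> L \<^bold>: Univ i"
  shows "\<Gamma> \<turnstile> STr_isSet L \<^bold>: isSet (STr L)"
proof -
  note A = STrF[OF L]
  let ?A = "STr L"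
  let ?\<Gamma>2 = "?A\<Up> # ?A # \<Gamma>"
  let ?\<Gamma>3 = "Eql ?A\<up>2 (Var (Suc 0)) (Var 0) # ?\<Gamma>2"
  let ?\<Gamma>4 = "Eql ?A\<up>3 (Var 2) (Var (Suc 0)) # ?\<Gamma>3"
  note w = wf_J[OF A]
  have A1: "?A # \<Gamma> \<turnstile> ?A\<Up> \<^bold>: Univ i" by (rule Univ_weaken[OF wf_extends(1)[OF w(3)] A])
  have A2: "?\<Gamma>2 \<turnstile> ?A\<up>2 \<^bold>: Univ i" by (rule Univ_weaken[OF wf_extends(2)[OF w(2)] A])
  have A3: "?\<Gamma>3 \<turnstile> ?A\<up>3 \<^bold>: Univ i" by (rule Univ_weaken[OF wf_extends(3)[OF w(1)] A])
  have E2: "?\<Gamma>2 \<turnstile> Eql ?A\<up>2 (Var (Suc 0)) (Var 0) \<^bold>: Univ i"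
    by (intro EqlF A2 VarT) (simp_all add: w[simplified])
  have E3: "?\<Gamma>3 \<turnstile> Eql ?A\<up>3 (Var 2) (Var (Suc 0)) \<^bold>: Univ i"
    by (intro EqlF A3 VarT) (simp_all add: w[simplified])
  note w4 = CtxCons[OF E3]
  have v: "?\<Gamma>4 \<turnstile> Var 3 \<^bold>: STr L\<up>4" "?\<Gamma>4 \<turnstile> Var 2 \<^bold>: STr L\<up>4"
    "?\<Gamma>4 \<turnstile> Var (Suc 0) \<^bold>: Eql (STr L\<up>4) (Var 3) (Var 2)" "?\<Gamma>4 \<turnstile> Var 0 \<^bold>:
        Eql (STr L\<up>4) (Var 3) (Var 2)"
    by (rule VarT; simp add: w4[simplified])+
  show ?thesis
    using PiI[OF A PiI[OF A1 PiI[OF E2 PiI[OF E3 STrEq[OF v]]]]]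
    by (simp add: isSet_def STr_isSet_def)
qed

lemma isProp_Eql_STr:
  assumes L: "\<Gamma> \<turnstile> L \<^bold>: Univ i" and x: "\<Gamma> \<turnstile> x \<^bold>: STr L" and y: "\<Gamma> \<turnstile> y \<^bold>: STr L"
  shows "inhabited \<Gamma> (isProp (Eql (STr L) x y))"
proof -
  let ?E = "Eql (STr L) x y"
  let ?\<Gamma>2 = "?E\<Up> # ?E # \<Gamma>"
  have E: "\<Gamma> \<turnstile> ?E \<^bold>: Univ i" by (intro EqlF STrF L x y)
  note w = wf_J[OF E] note e2 = wf_extends(2)[OF w(2)]
  have E1: "?E # \<Gamma> \<turnstile> ?E\<Up> \<^bold>: Univ i" by (rule Univ_weaken[OF wf_extends(1)[OF w(3)] E])
  have "inhabited ?\<Gamma>2 (Eql (Eql (STr L\<up>2) x\<up>2 y\<up>2) (Var (Suc 0)) (Var 0))"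
    by (rule inhabitedI, rule STrEq)
      (rule extends_weaken[OF e2 x] extends_weaken[OF e2 y] VarT; simp add: w(2)[simplified])+
  from this inhabited_Pi[OF E inhabited_Pi[OF E1, of "Eql ?E\<up>2 (Var (Suc 0)) (Var 0)"]]
  show ?thesis by (simp add: isProp_def)
qed

lemma inhabited_SInd:
  assumes "STr L # \<Gamma> \<turnstile> C \<^bold>: Univ i" "inhabited (L # \<Gamma>) (C\<langle>SIn (Var 0) \<cdot> sh (Suc 0)\<rangle>)"
    "inhabited (STr L # \<Gamma>) (isSet C)" "\<Gamma> \<turnstile> t \<^bold>: STr L" "T = C\<langle>t \<cdot> Var\<rangle>"
  shows "inhabited \<Gamma> T"
  using assms STrE[of L \<Gamma> C i _ _ t] by (auto simp: inhabited_def)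

text \<open>
  An equation in a set truncation is a proposition. To prove it, one may therefore choose an
  element of any merely inhabited type.
\<close>

lemma inhabited_Eql_STr_PTr:
  assumes L: "\<Gamma> \<turnstile> L \<^bold>: Univ i" and x: "\<Gamma> \<turnstile> x \<^bold>: STr L" and y: "\<Gamma> \<turnstile> y \<^bold>: STr L"
    and A: "\<Gamma> \<turnstile> A \<^bold>: Univ j"
    and c: "inhabited (A # \<Gamma>) (Eql (STr L\<Up>) x\<Up> y\<Up>)"
    and t: "inhabited \<Gamma> (PTr A)"
  shows "inhabited \<Gamma> (Eql (STr L) x y)"
  by (rule inhabited_PTr[OF EqlF[OF STrF[OF L] x y] A _ isProp_Eql_STr[OF L x y] t]) (simp add: c)

section \<open>Constant maps into sets\<close>

lemma inhabited_Pi_Sig: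
  assumes A: "\<Gamma> \<turnstile> A \<^bold>: Univ i" and B: "A # \<Gamma> \<turnstile> B \<^bold>: Univ i" and C: "Sig A B # \<Gamma> \<turnstile> C \<^bold>: Univ j"
    and c: "inhabited (B # A # \<Gamma>) (C\<langle>Tup (Var (Suc 0)) (Var 0) \<cdot> sh 2\<rangle>)"
  shows "inhabited \<Gamma> (Pi (Sig A B) C)"
proof (rule inhabited_Pi[OF SigF[OF A B]])
  let ?S = "Sig A B"
  note w1 = CtxCons[OF SigF[OF A B]] note e1 = wf_extends(1)[OF w1]
  have A1: "?S # \<Gamma> \<turnstile> A\<Up> \<^bold>: Univ i" by (rule Univ_weaken[OF e1 A])
  note w2 = CtxCons[OF A1] note e2 = wf_extends(2)[OF w2]
  have B2: "A\<Up> # ?S # \<Gamma> \<turnstile> B\<langle>Var 0 \<cdot> sh 2\<rangle> \<^bold>: Univ i"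
    by (rule fam_weaken[OF B e2 VarT]) (simp_all add: w2)
  note w3 = CtxCons[OF B2] note e3 = wf_extends(3)[OF w3]
  have S1: "?S # \<Gamma> \<turnstile> ?S\<Up> \<^bold>: Univ i" by (rule Univ_weaken[OF e1 SigF[OF A B]])
  have C2: "?S\<Up> # ?S # \<Gamma> \<turnstile> C\<langle>Var 0 \<cdot> sh 2\<rangle> \<^bold>: Univ j"
    by (rule fam_weaken[OF C wf_extends(2)[OF CtxCons[OF S1]] VarT]) (use CtxCons[OF S1] in simp_all)
  have s: "sub (B\<langle>Var 0 \<cdot> sh 2\<rangle> # A\<Up> # ?S # \<Gamma>) (Var 0 \<cdot> Var (Suc 0) \<cdot> sh 3) (B # A # \<Gamma>)"
    by (intro sub_scons extends_sub[OF e3] VarT) (simp_all add: w3)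
  show "inhabited (?S # \<Gamma>) C"
  proof (rule inhabited_SigE[of "A\<Up>" "B\<langle>Var 0 \<cdot> sh 2\<rangle>" _ "C\<langle>Var 0 \<cdot> sh 2\<rangle>" j "Var 0"])
    show "inhabited (B\<langle>Var 0 \<cdot> sh 2\<rangle> # A\<Up> # ?S # \<Gamma>)
        (C\<langle>Var 0 \<cdot> sh 2\<rangle>\<langle>Tup (Var (Suc 0)) (Var 0) \<cdot> sh 2\<rangle>)"
      by (rule inhabited_subst[OF c s]) simp
  qed (use C2 in simp_all, rule VarT, simp_all add: w1)
qed

text \<open>
  Path induction on \<open>s = s'\<close> reduces the claim to two elements of the same fibre, which \<open>fib\<close>
  identifies.
\<close>

lemma pair_eq:
  assumes A: "\<Gamma> \<turnstile> A \<^bold>: Univ i" and W: "A # \<Gamma> \<turnstile> W \<^bold>: Univ i"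
    and fib: "inhabited (W\<Up> # W # A # \<Gamma>) (Eql W\<up>2 (Var (Suc 0)) (Var 0))"
    and s: "\<Gamma> \<turnstile> s \<^bold>: A" and s': "\<Gamma> \<turnstile> s' \<^bold>: A" and eq: "inhabited \<Gamma> (Eql A s s')"
    and w: "\<Gamma> \<turnstile> w \<^bold>: W\<langle>s \<cdot> Var\<rangle>" and w': "\<Gamma> \<turnstile> w' \<^bold>: W\<langle>s' \<cdot> Var\<rangle>"
  shows "inhabited \<Gamma> (Eql (Sig A W) (Tup s w) (Tup s' w'))"
proof -
  note J = wf_J[OF A]
  let ?\<Gamma>3 = "Eql A\<up>2 (Var (Suc 0)) (Var 0) # A\<Up> # A # \<Gamma>"
  let ?\<Gamma>4 = "W\<langle>Var 2 \<cdot> sh 3\<rangle> # ?\<Gamma>3"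
  let ?\<Gamma>5 = "W\<langle>Var 2 \<cdot> sh 4\<rangle> # ?\<Gamma>4"
  have W3: "?\<Gamma>3 \<turnstile> W\<langle>Var 2 \<cdot> sh 3\<rangle> \<^bold>: Univ i"
    by (rule fam_weaken[OF W wf_extends(3)[OF J(1)] VarT]) (simp_all add: J)
  note w4 = CtxCons[OF W3]
  have e4: "extends 4 \<Gamma> ?\<Gamma>4" using w4 by (simp add: extends_def)
  have W4: "?\<Gamma>4 \<turnstile> W\<langle>Var 2 \<cdot> sh 4\<rangle> \<^bold>: Univ i"
    by (rule fam_weaken[OF W e4 VarT]) (use w4 in simp_all)
  note w5 = CtxCons[OF W4]
  have e5: "extends 5 \<Gamma> ?\<Gamma>5" using w5 by (simp add: extends_def)
  have A5: "?\<Gamma>5 \<turnstile> A\<up>5 \<^bold>: Univ i" by (rule Univ_weaken[OF e5 A])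
  have W5: "A\<up>5 # ?\<Gamma>5 \<turnstile> W\<langle>Var 0 \<cdot> sh 6\<rangle> \<^bold>: Univ i"
    using CtxCons[OF A5] by (intro fam_weaken[OF W] VarT) (simp_all add: extends_def)
  let ?C = "Pi (W\<langle>Var 2 \<cdot> sh 3\<rangle>) (Pi (W\<langle>Var 2 \<cdot> sh 4\<rangle>)
    (Eql (Sig A\<up>5 (W\<langle>Var 0 \<cdot> sh 6\<rangle>)) (Tup (Var 4) (Var 1)) (Tup (Var 3) (Var 0))))"
  have C: "?\<Gamma>3 \<turnstile> ?C \<^bold>: Univ i"
    by (intro PiF W3 W4 EqlF SigF A5 W5 SigI[OF W5] VarT) (use w5 in simp_all)
  let ?\<Delta>2 = "W # A # \<Gamma>"
  let ?\<Delta>3 = "W\<Up> # ?\<Delta>2"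
  let ?\<Delta>4 = "W\<up>2 # ?\<Delta>3"
  note v2 = CtxCons[OF W]
  have W': "?\<Delta>2 \<turnstile> W\<Up> \<^bold>: Univ i" by (rule Univ_weaken[OF wf_extends(1)[OF v2] W])
  note v3 = CtxCons[OF W']
  have W'': "?\<Delta>3 \<turnstile> W\<up>2 \<^bold>: Univ i" by (rule Univ_weaken[OF wf_extends(2)[OF v3] W])
  note v4 = CtxCons[OF W'']
  have d4: "extends 4 \<Gamma> ?\<Delta>4" by (simp add: extends_def v4)
  have A4': "?\<Delta>4 \<turnstile> A\<up>4 \<^bold>: Univ i" by (rule Univ_weaken[OF d4 A])
  have W4': "A\<up>4 # ?\<Delta>4 \<turnstile> W\<langle>Var 0 \<cdot> sh 5\<rangle> \<^bold>: Univ i"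
    using CtxCons[OF A4'] by (intro fam_weaken[OF W] VarT) (simp_all add: extends_def)
  have d3: "extends 3 \<Gamma> ?\<Delta>3" by (simp add: extends_def v3)
  have W3': "A\<up>3 # ?\<Delta>3 \<turnstile> W\<langle>Var 0 \<cdot> sh 4\<rangle> \<^bold>: Univ i"
    using CtxCons[OF Univ_weaken[OF d3 A]]
      by (intro fam_weaken[OF W] VarT) (simp_all add: extends_def)
  let ?D = "Eql (Sig A\<up>4 (W\<langle>Var 0 \<cdot> sh 5\<rangle>)) (Tup (Var 3) (Var 2)) (Tup (Var 3) (Var 0))"
  have D: "?\<Delta>4 \<turnstile> ?D \<^bold>: Univ i"
    by (intro EqlF SigF A4' W4' SigI[OF W4'] VarT) (simp_all add: v4)
  have "?\<Delta>3 \<turnstile> Tup (Var 2) (Var (Suc 0)) \<^bold>: Sig A\<up>3 (W\<langle>Var 0 \<cdot> sh 4\<rangle>)"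
    by (intro SigI[OF W3'] VarT) (simp_all add: v3)
  note base = inhabitedI[OF EqlI[OF this]]
  have "inhabited ?\<Delta>3 (?D\<langle>Var 0 \<cdot> Var\<rangle>)"
    by (rule inhabited_transport[OF fib W'' D VarT VarT]) (use base in \<open>simp_all add: v3\<close>)
  then have c: "inhabited (A # \<Gamma>) (?C\<langle>Refl (Var 0) \<cdot> Var 0 \<cdot> Var 0 \<cdot> sh (Suc 0)\<rangle>)"
    using inhabited_Pi[OF W inhabited_Pi[OF W']] by simp
  obtain p where p: "\<Gamma> \<turnstile> p \<^bold>: Eql A s s'" using eq by (auto simp: inhabited_def)
  have "inhabited \<Gamma> (?C\<langle>p \<cdot> s' \<cdot> s \<cdot> Var\<rangle>)"
    by (rule inhabited_J[OF C c s s' p refl])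
  then have "inhabited \<Gamma> (Pi (W\<langle>s \<cdot> Var\<rangle>) (Pi (W\<langle>s'\<Up> \<cdot> sh (Suc 0)\<rangle>)
    (Eql (Sig A\<up>2 (W\<langle>Var 0 \<cdot> sh 3\<rangle>)) (Tup s\<up>2 (Var 1)) (Tup s'\<up>2 (Var 0)))))"
    by simp
  from inhabited_app[OF inhabited_app[OF this w refl, simplified] w'] show ?thesis by simp
qed

text \<open>
  If \<open>T\<close> is merely inhabited, then the elements of \<open>STr L\<close> that satisfy \<open>value_spec\<close>, paired with
  the proof, form a proposition. Truncation elimination can map into such a type.
\<close>

locale constant_map =
  fixes \<Gamma> :: "tm list" and i :: nat and T L k :: tm
  assumes T: "\<Gamma> \<turnstile> T \<^bold>: Univ i" and L: "\<Gamma> \<turnstile> L \<^bold>: Univ i"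
    and k: "T # \<Gamma> \<turnstile> k \<^bold>: STr L\<Up>"
begin

abbreviation "value_spec \<equiv> Pi T\<Up> (Eql (STr L\<up>2) (Var (Suc 0)) (k\<langle>Var 0 \<cdot> sh 2\<rangle>))"

lemma kT: "extends n \<Gamma> \<Delta> \<Longrightarrow> \<Delta> \<turnstile> t \<^bold>: T\<up>n \<Longrightarrow> S = STr L\<up>n \<Longrightarrow> \<Delta> \<turnstile> k\<langle>t \<cdot> sh n\<rangle> \<^bold>: S"
  by (rule type_subst[OF k sub_scons[OF extends_sub]]) simp_all

lemma ST: "extends n \<Gamma> \<Delta> \<Longrightarrow> \<Delta> \<turnstile> STr L\<up>n \<^bold>: Univ i"
  by (intro STrF Univ_weaken[OF _ L])

lemma value_specT: "STr L # \<Gamma> \<turnstile> value_spec \<^bold>: Univ i"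
proof -
  note w = CtxCons[OF STrF[OF L]]
  have T1: "STr L # \<Gamma> \<turnstile> T\<Up> \<^bold>: Univ i" by (rule Univ_weaken[OF wf_extends(1)[OF w] T])
  note w2 = CtxCons[OF T1]
  note e2 = wf_extends(2)[OF w2]
  show ?thesis
    by (intro PiF T1 EqlF ST[OF e2] kT[OF e2] VarT) (simp_all add: w2)
qed

lemma value_spec_prop:
  "inhabited (value_spec\<Up> # value_spec # STr L # \<Gamma>) (Eql (value_spec\<up>2) (Var (Suc 0)) (Var 0))"
proof -
  let ?\<Delta> = "value_spec\<Up> # value_spec # STr L # \<Gamma>"
  note w2 = CtxCons[OF value_specT]
  note w3 = CtxCons[OF Univ_weaken[OF wf_extends(1)[OF w2] value_specT]]
  have e3: "extends 3 \<Gamma> ?\<Delta>" by (simp only: wf_extends(3)[OF w3])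
  have T3: "?\<Delta> \<turnstile> T\<up>3 \<^bold>: Univ i" by (rule Univ_weaken[OF e3 T])
  note w4 = CtxCons[OF T3]
  let ?\<Delta>' = "T\<up>3 # ?\<Delta>"
  have e4: "extends 4 \<Gamma> ?\<Delta>'" using w4 by (simp add: extends_def)
  let ?B = "Eql (STr L\<up>4) (Var 3) (k\<langle>Var 0 \<cdot> sh 4\<rangle>)"
  have v3: "?\<Delta>' \<turnstile> Var 3 \<^bold>: STr L\<up>4" by (rule VarT) (use w4 in simp_all)
  have v0: "?\<Delta>' \<turnstile> Var 0 \<^bold>: T\<up>4" by (rule VarT) (use w4 in simp_all)
  have B: "?\<Delta>' \<turnstile> ?B \<^bold>: Univ i" by (intro EqlF ST[OF e4] kT[OF e4] v3 v0) simp
  have v1: "?\<Delta>' \<turnstile> Var 1 \<^bold>: Pi T\<up>4 (Eql (STr L\<up>5) (Var 4) (k\<langle>Var 0 \<cdot> sh 5\<rangle>))"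
   and v2: "?\<Delta>' \<turnstile> Var 2 \<^bold>: Pi T\<up>4 (Eql (STr L\<up>5) (Var 4) (k\<langle>Var 0 \<cdot> sh 5\<rangle>))"
    by (rule VarT; use w4 in simp)+
  have eq: "inhabited ?\<Delta>' (Eql ?B (App (Var 2) (Var 0)) (App (Var 1) (Var 0)))"
    by (rule inhabitedI, rule STrEq[OF v3 kT[OF e4 v0 refl] PiET[OF v2 v0] PiET[OF v1 v0]]) simp_all
  have "inhabited ?\<Delta> (Eql (Pi T\<up>3 ?B) (Var 1) (Var 0))"
    by (rule inhabited_funext[OF T3 B VarT VarT]) (use w3 eq in simp_all)
  then show ?thesis by simp
qed

text \<open>
  Given an element \<open>t\<close> of \<open>T\<close>, both \<open>s\<close> and \<open>s'\<close> equal \<open>k t\<close>. As \<open>s = s'\<close> is an equation in a set,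
  mere inhabitation of \<open>T\<close> suffices.
\<close>

lemma value_eq:
  assumes "inhabited \<Gamma> (PTr T)" and s: "\<Gamma> \<turnstile> s \<^bold>: STr L" and s': "\<Gamma> \<turnstile> s' \<^bold>: STr L"
    and w: "\<Gamma> \<turnstile> w \<^bold>: value_spec\<langle>s \<cdot> Var\<rangle>" and w': "\<Gamma> \<turnstile> w' \<^bold>: value_spec\<langle>s' \<cdot> Var\<rangle>"
  shows "inhabited \<Gamma> (Eql (Sig (STr L) value_spec) (Tup s w) (Tup s' w'))"
proof (rule pair_eq[OF STrF[OF L] value_specT value_spec_prop s s' _ w w'])
  note w1 = CtxCons[OF T] note e = wf_extends(1)[OF w1]
  have s1: "T # \<Gamma> \<turnstile> s\<Up> \<^bold>: STr L\<Up>" "T # \<Gamma> \<turnstile> s'\<Up> \<^bold>: STr L\<Up>"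
    by (rule extends_weaken[OF e s] extends_weaken[OF e s'], simp)+
  have v: "T # \<Gamma> \<turnstile> Var 0 \<^bold>: T\<Up>" by (rule VarT) (simp_all add: w1)
  have eqs: "inhabited (T # \<Gamma>) (Eql (STr L\<Up>) s\<Up> k)"
    "inhabited (T # \<Gamma>) (Eql (STr L\<Up>) s'\<Up> k)"
    by (rule inhabitedI, rule App_weaken_Var[OF w[simplified] e v], simp)
      (rule inhabitedI, rule App_weaken_Var[OF w'[simplified] e v], simp)
  show "inhabited \<Gamma> (Eql (STr L) s s')"
    by (rule inhabited_Eql_STr_PTr[OF L s s' T inhabited_trans[OF eqs(1)
      inhabited_sym[OF eqs(2) ST[OF e] s1(2) k] ST[OF e] s1(1) k s1(2)] assms(1)])
qed

end

text \<open>
  The eliminator of \<open>\<parallel>T\<parallel>\<close> cannot map into the set \<open>STr L\<close> directly. It does map into the sum type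
  \<open>?D\<close> of all \<open>y\<close> with \<open>y = k t\<close> for every \<open>t\<close>, which is a proposition by \<open>value_eq\<close> and to which
  constancy lifts \<open>k\<close>.
\<close>

lemma constant_map_factors:
  assumes T: "\<Gamma> \<turnstile> T \<^bold>: Univ i" and L: "\<Gamma> \<turnstile> L \<^bold>: Univ i"
    and k: "T # \<Gamma> \<turnstile> k \<^bold>: STr L\<Up>"
    and const: "inhabited (T\<Up> # T # \<Gamma>) (Eql (STr L\<up>2) k\<Up> (k\<langle>Var 0 \<cdot> sh 2\<rangle>))"
    and t: "inhabited \<Gamma> (PTr T)"
  obtains y where "\<Gamma> \<turnstile> y \<^bold>: STr L" "inhabited (T # \<Gamma>) (Eql (STr L\<Up>) y\<Up> k)"
proof -
  interpret constant_map \<Gamma> i T L k using T L k by unfold_locales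
  let ?D = "Sig (STr L) value_spec"
  have D: "\<Gamma> \<turnstile> ?D \<^bold>: Univ i" by (intro SigF STrF L value_specT)
  note J = wf_J[OF D]
  have D1: "?D # \<Gamma> \<turnstile> ?D\<Up> \<^bold>: Univ i" by (rule Univ_weaken[OF wf_extends(1)[OF J(3)] D])
  have "inhabited \<Gamma> (isProp ?D)"
    unfolding isProp_def
  proof (rule inhabited_Pi_Sig[OF STrF[OF L] value_specT])
    have E: "?D\<Up> # ?D # \<Gamma> \<turnstile> Eql ?D\<up>2 (Var (Suc 0)) (Var 0) \<^bold>: Univ i"
      by (rule EqlF[OF Univ_weaken[OF wf_extends(2)[OF J(2)] D]]; rule VarT) (use J(2) in simp_all)
    show "?D # \<Gamma> \<turnstile> Pi (wk 1 ?D) (Eql (wk 2 ?D) (Var 1) (Var 0)) \<^bold>: Univ i"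
      using PiF[OF D1 E] by simp
    let ?\<Gamma>2 = "value_spec # STr L # \<Gamma>"
    note w2 = CtxCons[OF value_specT] note e2 = wf_extends(2)[OF w2]
    have S2: "?\<Gamma>2 \<turnstile> STr L\<up>2 \<^bold>: Univ i" by (rule ST[OF e2])
    note w3 = CtxCons[OF S2]
    have V3: "STr L\<up>2 # ?\<Gamma>2 \<turnstile> value_spec\<langle>Var 0 \<cdot> sh 3\<rangle> \<^bold>: Univ i"
      by (rule fam_weaken[OF value_specT wf_extends(3)[OF w3] VarT]) (simp_all add: w3)
    note w4 = CtxCons[OF V3]
    let ?\<Gamma>4 = "value_spec\<langle>Var 0 \<cdot> sh 3\<rangle> # STr L\<up>2 # ?\<Gamma>2"
    have e4: "extends 4 \<Gamma> ?\<Gamma>4" using w4 by (simp add: extends_def)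
    have T4: "?\<Gamma>4 \<turnstile> T\<up>4 \<^bold>: Univ i" by (rule Univ_weaken[OF e4 T])
    have L4: "?\<Gamma>4 \<turnstile> L\<up>4 \<^bold>: Univ i" by (rule Univ_weaken[OF e4 L])
    note w5 = CtxCons[OF T4]
    have k5: "T\<up>4 # ?\<Gamma>4 \<turnstile> k\<langle>Var 0 \<cdot> sh 5\<rangle> \<^bold>: STr L\<up>4\<Up>"
      by (rule kT[OF _ VarT]) (use w5 in \<open>simp_all add: extends_def\<close>)
    interpret c: constant_map ?\<Gamma>4 i "T\<up>4" "L\<up>4" "k\<langle>Var 0 \<cdot> sh 5\<rangle>"
      using T4 L4 k5 by unfold_locales
    have t4: "inhabited ?\<Gamma>4 (PTr T\<up>4)" by (rule inhabited_weaken[OF t e4]) simp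
    have "inhabited ?\<Gamma>4 (Eql (Sig (STr L\<up>4) c.value_spec) (Tup (Var 3) (Var 2)) (Tup (Var
        (Suc 0)) (Var 0)))"
      by (rule c.value_eq[OF t4]; rule VarT) (use w4 in simp_all)
    then have c4: "inhabited ?\<Gamma>4 ((Eql ?D\<up>3 (Tup (Var 2) (Var (Suc 0))) (Var 0))\<langle>Tup (Var (Suc 0))
        (Var 0) \<cdot> sh 2\<rangle>)"
      by simp
    let ?\<Delta> = "Sig (STr L\<up>2) (value_spec\<langle>Var 0 \<cdot> sh 3\<rangle>) # ?\<Gamma>2"
    note d3 = CtxCons[OF SigF[OF S2 V3]]
    have e3: "extends 3 \<Gamma> ?\<Delta>" using d3 by (simp add: extends_def)
    have "STr L\<up>3 # ?\<Delta> \<turnstile> value_spec\<langle>Var 0 \<cdot> sh 4\<rangle> \<^bold>: Univ i"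
      by (rule fam_weaken[OF value_specT _ VarT]) (use CtxCons[OF ST[OF e3]]
          in \<open>simp_all add: extends_def\<close>)
    then have tup: "?\<Delta> \<turnstile> Tup (Var 2) (Var (Suc 0)) \<^bold>: ?D\<up>3"
      unfolding subst.simps by (intro SigI[where i = i] VarT) (use d3 in simp_all)
    have "?\<Delta> \<turnstile> Eql ?D\<up>3 (Tup (Var 2) (Var (Suc 0))) (Var 0) \<^bold>: Univ i"
      by (rule EqlF[OF Univ_weaken[OF e3 D] tup VarT]) (use d3 in simp_all)
    from inhabited_Pi_Sig[OF S2 V3 this c4]
    show "inhabited ?\<Gamma>2 ((Pi (wk 1 ?D) (Eql (wk 2 ?D) (Var 1) (Var 0)))\<langle>Tup (Var (Suc 0))
        (Var 0) \<cdot> sh 2\<rangle>)"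
      by simp
  qed
  have "inhabited \<Gamma> ?D"
  proof (rule inhabited_PTr[OF D T _ \<open>inhabited \<Gamma> (isProp ?D)\<close> t])
    note w1 = CtxCons[OF T] note e = wf_extends(1)[OF w1]
    have T1: "T # \<Gamma> \<turnstile> T\<Up> \<^bold>: Univ i" by (rule Univ_weaken[OF e T])
    have L1: "T # \<Gamma> \<turnstile> L\<Up> \<^bold>: Univ i" by (rule Univ_weaken[OF e L])
    note w2 = CtxCons[OF T1]
    have k1: "T\<Up> # T # \<Gamma> \<turnstile> k\<langle>Var 0 \<cdot> sh 2\<rangle> \<^bold>: STr L\<up>2"
      by (rule kT[OF wf_extends(2)[OF w2] VarT]) (simp_all add: w2)
    interpret c: constant_map "T # \<Gamma>" i "T\<Up>" "L\<Up>" "k\<langle>Var 0 \<cdot> sh 2\<rangle>"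
      using T1 L1 k1 by unfold_locales simp_all
    show "inhabited (T # \<Gamma>) ?D\<Up>"
      using inhabited_Sig[OF c.value_specT k] inhabited_Pi[OF T1 const] by simp
  qed
  then obtain d where d: "\<Gamma> \<turnstile> d \<^bold>: ?D" by (auto simp: inhabited_def)
  note p1 = proj1T[OF STrF[OF L] value_specT d] and p2 = proj2T[OF STrF[OF L] value_specT d refl]
  have "T # \<Gamma> \<turnstile> App ((proj2 (STr L) value_spec d)\<Up>) (Var 0) \<^bold>:
    Eql (STr L\<Up>) ((proj1 (STr L) d)\<Up>) k"
    by (rule App_weaken_Var[OF p2[simplified] wf_extends(1)[OF CtxCons[OF T]] VarT])
      (simp_all add: CtxCons[OF T])
  with p1 show ?thesis using that inhabitedI by blast
qed

text \<open>
  Factoring \<open>k\<close> separately for each \<open>x : A\<close> produces a function without a proof that the function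
  type is a set.
\<close>

lemma constant_maps_factor:
  assumes A: "\<Gamma> \<turnstile> A \<^bold>: Univ i" and T: "\<Gamma> \<turnstile> T \<^bold>: Univ i" and L: "\<Gamma> \<turnstile> L \<^bold>: Univ i"
    and k: "T\<Up> # A # \<Gamma> \<turnstile> k \<^bold>: STr L\<up>2"
    and const: "inhabited (T\<up>2 # T\<Up> # A # \<Gamma>) (Eql (STr L\<up>3) k\<Up> (k\<langle>Var 0 \<cdot> sh 2\<rangle>))"
    and t: "inhabited \<Gamma> (PTr T)"
  obtains f where "\<Gamma> \<turnstile> f \<^bold>: Arr A (STr L)"
    "inhabited (T\<Up> # A # \<Gamma>) (Eql (STr L\<up>2) (App f\<up>2 (Var (Suc 0))) k)"
proof -
  note w1 = CtxCons[OF A] note e1 = wf_extends(1)[OF w1]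
  note T1 = Univ_weaken[OF e1 T] and L1 = Univ_weaken[OF e1 L]
  note w2 = CtxCons[OF T1] note e2 = wf_extends(2)[OF w2]
  have t1: "inhabited (A # \<Gamma>) (PTr T\<Up>)" by (rule inhabited_weaken[OF t e1]) simp
  obtain y where y: "A # \<Gamma> \<turnstile> y \<^bold>: STr L\<Up>"
    and eq: "inhabited (T\<Up> # A # \<Gamma>) (Eql (STr L\<Up>\<Up>) y\<Up> k)"
    by (rule constant_map_factors[OF T1 L1 _ _ t1]) (use k const in simp_all)
  let ?\<Delta> = "T\<Up> # A # \<Gamma>"
  let ?f = "Lam A y"
  have f: "\<Gamma> \<turnstile> ?f \<^bold>: Arr A (STr L)" by (rule ArrI[OF A]) (simp add: y)
  note A2 = Univ_weaken[OF e2 A] note w3 = CtxCons[OF A2]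
  have "A\<up>2 # ?\<Delta> \<turnstile> y\<langle>Var 0 \<cdot> sh 3\<rangle> \<^bold>: STr L\<up>3"
    by (rule type_subst[OF y sub_scons[OF extends_sub]])
      (use w3 in \<open>simp_all add: wf_extends(3)\<close>, rule VarT, simp_all)
  moreover have v: "?\<Delta> \<turnstile> Var (Suc 0) \<^bold>: A\<up>2" by (rule VarT) (simp_all add: w2)
  ultimately have beta: "?\<Delta> \<turnstile> App ?f\<up>2 (Var (Suc 0)) \<doteq> y\<Up> \<^bold>: STr L\<up>2"
    using PiBeta[of "A\<up>2" ?\<Delta> "y\<langle>Var 0 \<cdot> sh 3\<rangle>" "STr L\<up>3" "Var (Suc 0)"] by simp
  have "inhabited ?\<Delta> (Eql (STr L\<up>2) (App ?f\<up>2 (Var (Suc 0))) k)"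
    by (rule inhabited_Eql_conv[OF _ STrF[OF Univ_weaken[OF e2 L]] EqSym[OF beta] EqRefl[OF k]])
      (use eq in simp)
  with f show ?thesis by (rule that)
qed

section \<open>Transport in a family\<close>

locale family =
  fixes \<Gamma> :: "tm list" and i :: nat and X P :: tm
  assumes X: "\<Gamma> \<turnstile> X \<^bold>: Univ i" and P: "X # \<Gamma> \<turnstile> P \<^bold>: Univ i"

lemma family_weaken:
  assumes "family \<Gamma> i X P" and e: "extends n \<Gamma> \<Delta>"
    and eq: "X' = X\<up>n" "P' = P\<langle>Var 0 \<cdot> sh (Suc n)\<rangle>"
  shows "family \<Delta> i X' P'"
proof -
  interpret family \<Gamma> i X P by fact
  have X': "\<Delta> \<turnstile> X\<up>n \<^bold>: Univ i" by (rule Univ_weaken[OF e X])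
  note w = CtxCons[OF X']
  have "X\<up>n # \<Delta> \<turnstile> P\<langle>Var 0 \<cdot> sh (Suc n)\<rangle> \<^bold>: Univ i"
    by (rule fam_weaken[OF P extends_Suc[OF e w] VarT]) (simp_all add: w)
  with X' show ?thesis unfolding eq by unfold_locales
qed

text \<open>
  The second condition is the form of the first that path induction needs: it makes sense for a
  path \<open>p\<close> with two free end points, and it compares all transports between them with the one
  along \<open>p\<close>.
\<close>

definition trivial_transport :: "tm \<Rightarrow> tm \<Rightarrow> tm \<Rightarrow> tm" where
  "trivial_transport X P x =
     Pi (Eql X x x) (Pi (P\<langle>x\<Up> \<cdot> sh (Suc 0)\<rangle>) (Eql (P\<langle>x\<up>2 \<cdot> sh 2\<rangle>)
       (App (transport (P\<langle>Var 0 \<cdot> sh 3\<rangle>) x\<up>2 x\<up>2 (Var (Suc 0))) (Var 0)) (Var 0)))"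

definition same_transport :: "tm \<Rightarrow> tm \<Rightarrow> tm \<Rightarrow> tm \<Rightarrow> tm \<Rightarrow> tm" where
  "same_transport X P x y p =
     Pi (Eql X x y) (Pi (P\<langle>x\<Up> \<cdot> sh (Suc 0)\<rangle>) (Eql (P\<langle>y\<up>2 \<cdot> sh 2\<rangle>)
       (App (transport (P\<langle>Var 0 \<cdot> sh 3\<rangle>) x\<up>2 y\<up>2 p\<up>2) (Var 0))
       (App (transport (P\<langle>Var 0 \<cdot> sh 3\<rangle>) x\<up>2 y\<up>2 (Var (Suc 0))) (Var 0))))"

lemma subst_trivial_transport [simp]:
  "(trivial_transport X P x)\<langle>\<sigma>\<rangle> = trivial_transport (X\<langle>\<sigma>\<rangle>) (P\<langle>Var 0 \<cdot> (\<sigma> ;; sh (Suc 0))\<rangle>) (x\<langle>\<sigma>\<rangle>)"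
  "(same_transport X P x y p)\<langle>\<sigma>\<rangle> =
    same_transport (X\<langle>\<sigma>\<rangle>) (P\<langle>Var 0 \<cdot> (\<sigma> ;; sh (Suc 0))\<rangle>) (x\<langle>\<sigma>\<rangle>) (y\<langle>\<sigma>\<rangle>) (p\<langle>\<sigma>\<rangle>)"
  by (simp_all add: trivial_transport_def same_transport_def)

context family
begin

lemma fibreF: "\<Gamma> \<turnstile> a \<^bold>: X \<Longrightarrow> \<Gamma> \<turnstile> P\<langle>a \<cdot> Var\<rangle> \<^bold>: Univ i"
  by (rule fam_subst0[OF P])

lemma trT: "\<Gamma> \<turnstile> a \<^bold>: X \<Longrightarrow> \<Gamma> \<turnstile> b \<^bold>: X \<Longrightarrow> \<Gamma> \<turnstile> p \<^bold>: Eql X a b \<Longrightarrow> \<Gamma> \<turnstile> u \<^bold>: P\<langle>a \<cdot> Var\<rangle> \<Longrightarrow>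
    T = P\<langle>b \<cdot> Var\<rangle> \<Longrightarrow> \<Gamma> \<turnstile> App (transport P a b p) u \<^bold>: T"
  using ArrE[OF transportT[OF X P]] by simp

lemma invT: "\<Gamma> \<turnstile> a \<^bold>: X \<Longrightarrow> \<Gamma> \<turnstile> b \<^bold>: X \<Longrightarrow> \<Gamma> \<turnstile> p \<^bold>: Eql X a b \<Longrightarrow> \<Gamma> \<turnstile> path_inv X a b p \<^bold>: Eql X b a"
  by (rule path_invT[OF X])

lemma tr_cong:
  assumes a: "\<Gamma> \<turnstile> a \<^bold>: X" and b: "\<Gamma> \<turnstile> b \<^bold>: X" and p: "\<Gamma> \<turnstile> p \<doteq> p' \<^bold>: Eql X a b"
    and u: "\<Gamma> \<turnstile> u \<doteq> u' \<^bold>: P\<langle>a \<cdot> Var\<rangle>"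
  shows "\<Gamma> \<turnstile> App (transport P a b p) u \<doteq> App (transport P a b p') u' \<^bold>: P\<langle>b \<cdot> Var\<rangle>"
proof (rule Arr_AppCong[OF fibreF[OF a] fibreF[OF b] _ u])
  note w = CtxCons[OF EqlF[OF X a b]] note e = wf_extends(1)[OF w]
  interpret E: family "Eql X a b # \<Gamma>" i "X\<Up>" "P\<langle>Var 0 \<cdot> sh 2\<rangle>"
    by (rule family_weaken[OF family_axioms e]) simp_all
  have "Eql X a b # \<Gamma> \<turnstile> transport (P\<langle>Var 0 \<cdot> sh 2\<rangle>) a\<Up> b\<Up> (Var 0) \<^bold>:
      Arr (P\<langle>a\<Up> \<cdot> sh (Suc 0)\<rangle>) (P\<langle>b\<Up> \<cdot> sh (Suc 0)\<rangle>)"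
    using transportT[OF E.X E.P extends_weaken[OF e a refl] extends_weaken[OF e b refl]
        VarT[OF w]] by simp
  from eq_subst1[OF this p refl]
  show "\<Gamma> \<turnstile> transport P a b p \<doteq> transport P a b p' \<^bold>: Arr (P\<langle>a \<cdot> Var\<rangle>) (P\<langle>b \<cdot> Var\<rangle>)" by simp
qed

lemma tr_refl:
  "\<Gamma> \<turnstile> a \<^bold>: X \<Longrightarrow> \<Gamma> \<turnstile> u \<^bold>: P\<langle>a \<cdot> Var\<rangle> \<Longrightarrow> \<Gamma> \<turnstile> App (transport P a a (Refl a)) u \<doteq> u \<^bold>: P\<langle>a \<cdot> Var\<rangle>"
  by (rule transport_refl[OF X P])

lemma tr_inv_refl:
  assumes a: "\<Gamma> \<turnstile> a \<^bold>: X" and u: "\<Gamma> \<turnstile> u \<^bold>: P\<langle>a \<cdot> Var\<rangle>"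
  shows "\<Gamma> \<turnstile> App (transport P a a (path_inv X a a (Refl a))) u \<doteq> u \<^bold>: P\<langle>a \<cdot> Var\<rangle>"
  by (rule EqTrans[OF tr_cong[OF a a path_inv_refl[OF X a] EqRefl[OF u]] tr_refl[OF a u]])

lemma tr_ap:
  assumes a: "\<Gamma> \<turnstile> a \<^bold>: X" and b: "\<Gamma> \<turnstile> b \<^bold>: X" and p: "\<Gamma> \<turnstile> p \<^bold>: Eql X a b"
    and u: "\<Gamma> \<turnstile> u \<^bold>: P\<langle>a \<cdot> Var\<rangle>" and u': "\<Gamma> \<turnstile> u' \<^bold>: P\<langle>a \<cdot> Var\<rangle>"
    and eq: "inhabited \<Gamma> (Eql (P\<langle>a \<cdot> Var\<rangle>) u u')"
  shows "inhabited \<Gamma> (Eql (P\<langle>b \<cdot> Var\<rangle>) (App (transport P a b p) u) (App (transport P a b p) u'))"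
proof (rule inhabited_transport[OF eq fibreF[OF a] _ u u'])
  note w = CtxCons[OF fibreF[OF a]] note e = wf_extends(1)[OF w]
  interpret E: family "P\<langle>a \<cdot> Var\<rangle> # \<Gamma>" i "X\<Up>" "P\<langle>Var 0 \<cdot> sh 2\<rangle>"
    by (rule family_weaken[OF family_axioms e]) simp_all
  let ?t = "\<lambda>v. App (transport (P\<langle>Var 0 \<cdot> sh 2\<rangle>) a\<Up> b\<Up> p\<Up>) v"
  let ?C = "Eql (P\<langle>b\<Up> \<cdot> sh (Suc 0)\<rangle>) (?t u\<Up>) (?t (Var 0))"
  note ty = extends_weaken[OF e a] extends_weaken[OF e b] extends_weaken[OF e p]
      extends_weaken[OF e u]
  show "P\<langle>a \<cdot> Var\<rangle> # \<Gamma> \<turnstile> ?C \<^bold>: Univ i"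
    using E.fibreF[OF ty(2)[OF refl]] by (intro EqlF E.trT ty VarT) (simp_all add: w)
  show "inhabited \<Gamma> (?C\<langle>u \<cdot> Var\<rangle>)"
    using inhabitedI[OF EqlI[OF trT[OF a b p u refl]]] by simp
qed simp

lemma path_ctx:
  defines "\<Delta> \<equiv> Eql X\<up>2 (Var (Suc 0)) (Var 0) # X\<Up> # X # \<Gamma>"
  shows "family \<Delta> i X\<up>3 (P\<langle>Var 0 \<cdot> sh 4\<rangle>)" "wf_ctx \<Delta>"
    "\<Delta> \<turnstile> Var 2 \<^bold>: X\<up>3" "\<Delta> \<turnstile> Var (Suc 0) \<^bold>: X\<up>3" "\<Delta> \<turnstile> Var 0 \<^bold>: Eql X\<up>3 (Var 2) (Var (Suc 0))"
  unfolding \<Delta>_def using wf_J[OF X] wf_extends(3)[OF wf_J(1)[OF X]]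
  by (auto intro!: family_weaken[OF family_axioms, of 3] VarT)

lemma point_ctx:
  shows "family (X # \<Gamma>) i X\<Up> (P\<langle>Var 0 \<cdot> sh 2\<rangle>)" "wf_ctx (X # \<Gamma>)"
    "X # \<Gamma> \<turnstile> Var 0 \<^bold>: X\<Up>"
  using wf_J[OF X] wf_extends(1)[OF wf_J(3)[OF X]]
  by (auto intro!: family_weaken[OF family_axioms, of "Suc 0"] VarT)

text \<open>
  By path induction on \<open>p\<close>: along \<open>refl\<close> and its inverse, both transports compute to the identity.
\<close>

lemma tr_inv_tr:
  assumes a: "\<Gamma> \<turnstile> a \<^bold>: X" and b: "\<Gamma> \<turnstile> b \<^bold>: X" and p: "\<Gamma> \<turnstile> p \<^bold>: Eql X a b" and u: "\<Gamma> \<turnstile> u \<^bold>: P\<langle>a \<cdot> Var\<rangle>"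
  shows "inhabited \<Gamma> (Eql (P\<langle>a \<cdot> Var\<rangle>) (App (transport P b a (path_inv X a b p)) (App (transport
      P a b p) u)) u)"
proof -
  let ?\<Delta> = "Eql X\<up>2 (Var (Suc 0)) (Var 0) # X\<Up> # X # \<Gamma>"
  interpret D: family ?\<Delta> i "X\<up>3" "P\<langle>Var 0 \<cdot> sh 4\<rangle>" by (rule path_ctx)
  have P3: "?\<Delta> \<turnstile> P\<langle>Var 2 \<cdot> sh 3\<rangle> \<^bold>: Univ i" using D.fibreF[OF path_ctx(3)] by simp
  note w = CtxCons[OF P3]
  interpret E: family "P\<langle>Var 2 \<cdot> sh 3\<rangle> # ?\<Delta>" i "X\<up>4" "P\<langle>Var 0 \<cdot> sh 5\<rangle>"
    by (rule family_weaken[OF D.family_axioms wf_extends(1)[OF w]]) simp_all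
  let ?C = "Pi (P\<langle>Var 2 \<cdot> sh 3\<rangle>) (Eql (P\<langle>Var 3 \<cdot> sh 4\<rangle>)
    (App (transport (P\<langle>Var 0 \<cdot> sh 5\<rangle>) (Var 2) (Var 3) (path_inv X\<up>4 (Var 3) (Var 2) (Var 1)))
      (App (transport (P\<langle>Var 0 \<cdot> sh 5\<rangle>) (Var 3) (Var 2) (Var 1)) (Var 0))) (Var 0))"
  have P4: "P\<langle>Var 2 \<cdot> sh 3\<rangle> # ?\<Delta> \<turnstile> P\<langle>Var 3 \<cdot> sh 4\<rangle> \<^bold>: Univ i"
    using E.fibreF[OF VarT, of 3] w by simp
  have C: "?\<Delta> \<turnstile> ?C \<^bold>: Univ i"
    by (intro PiF P3 P4 EqlF E.trT E.invT VarT) (use w in simp_all)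
  note w2 = CtxCons[OF P]
  interpret F: family "P # X # \<Gamma>" i "X\<up>2" "P\<langle>Var 0 \<cdot> sh 3\<rangle>"
    by (rule family_weaken[OF family_axioms wf_extends(2)[OF w2]]) simp_all
  have v: "P # X # \<Gamma> \<turnstile> Var (Suc 0) \<^bold>: X\<up>2" "P # X # \<Gamma> \<turnstile> Var 0 \<^bold>: P\<langle>Var 0 \<cdot> sh 3\<rangle>\<langle>Var (Suc 0) \<cdot> Var\<rangle>"
    by (rule VarT; use w2 in simp)+
  note t = F.trT[OF v(1,1) EqlI[OF v(1)] v(2) refl]
  have "inhabited (P # X # \<Gamma>) (Eql (P\<langle>Var 0 \<cdot> sh 3\<rangle>\<langle>Var (Suc 0) \<cdot> Var\<rangle>) (App (transport (P\<langle>Var 0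
      \<cdot> sh 3\<rangle>) (Var (Suc 0)) (Var (Suc 0)) (path_inv X\<up>2 (Var (Suc 0)) (Var (Suc 0)) (Refl
      (Var (Suc 0)))))
      (App (transport (P\<langle>Var 0 \<cdot> sh 3\<rangle>) (Var (Suc 0)) (Var (Suc 0)) (Refl (Var (Suc 0))))
          (Var 0))) (Var 0))"
    by (rule inhabited_refl[OF F.fibreF[OF v(1)] F.trT[OF v(1,1) F.invT[OF v(1,1)
        EqlI[OF v(1)]] t refl]
      EqTrans[OF F.tr_inv_refl[OF v(1) t] F.tr_refl[OF v]]])
  then have c: "inhabited (X # \<Gamma>) (?C\<langle>Refl (Var 0) \<cdot> Var 0 \<cdot> Var 0 \<cdot> sh (Suc 0)\<rangle>)"
    using inhabited_Pi[OF P] by simp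
  show ?thesis
    by (rule inhabited_app[OF inhabited_J[OF C c a b p refl, simplified] u]) simp
qed

lemma tr_tr_inv:
  assumes a: "\<Gamma> \<turnstile> a \<^bold>: X" and b: "\<Gamma> \<turnstile> b \<^bold>: X" and p: "\<Gamma> \<turnstile> p \<^bold>: Eql X a b" and v: "\<Gamma> \<turnstile> v \<^bold>: P\<langle>b \<cdot> Var\<rangle>"
  shows "inhabited \<Gamma> (Eql (P\<langle>b \<cdot> Var\<rangle>) (App (transport P a b p) (App (transport P b a (path_inv
      X a b p)) v)) v)"
proof -
  let ?\<Delta> = "Eql X\<up>2 (Var (Suc 0)) (Var 0) # X\<Up> # X # \<Gamma>"
  interpret D: family ?\<Delta> i "X\<up>3" "P\<langle>Var 0 \<cdot> sh 4\<rangle>" by (rule path_ctx)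
  have P3: "?\<Delta> \<turnstile> P\<langle>Var (Suc 0) \<cdot> sh 3\<rangle> \<^bold>: Univ i" using D.fibreF[OF path_ctx(4)] by simp
  note w = CtxCons[OF P3]
  interpret E: family "P\<langle>Var (Suc 0) \<cdot> sh 3\<rangle> # ?\<Delta>" i "X\<up>4" "P\<langle>Var 0 \<cdot> sh 5\<rangle>"
    by (rule family_weaken[OF D.family_axioms wf_extends(1)[OF w]]) simp_all
  let ?C = "Pi (P\<langle>Var (Suc 0) \<cdot> sh 3\<rangle>) (Eql (P\<langle>Var 2 \<cdot> sh 4\<rangle>)
    (App (transport (P\<langle>Var 0 \<cdot> sh 5\<rangle>) (Var 3) (Var 2) (Var 1))
      (App (transport (P\<langle>Var 0 \<cdot> sh 5\<rangle>) (Var 2) (Var 3) (path_inv X\<up>4 (Var 3) (Var 2) (Var 1)))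
          (Var 0))) (Var 0))"
  have P4: "P\<langle>Var (Suc 0) \<cdot> sh 3\<rangle> # ?\<Delta> \<turnstile> P\<langle>Var 2 \<cdot> sh 4\<rangle> \<^bold>: Univ i"
    using E.fibreF[OF VarT, of 2] w by simp
  have C: "?\<Delta> \<turnstile> ?C \<^bold>: Univ i"
    by (intro PiF P3 P4 EqlF E.trT E.invT VarT) (use w in simp_all)
  note w2 = CtxCons[OF P]
  interpret F: family "P # X # \<Gamma>" i "X\<up>2" "P\<langle>Var 0 \<cdot> sh 3\<rangle>"
    by (rule family_weaken[OF family_axioms wf_extends(2)[OF w2]]) simp_all
  have x: "P # X # \<Gamma> \<turnstile> Var (Suc 0) \<^bold>: X\<up>2" "P # X # \<Gamma> \<turnstile> Var 0 \<^bold>: P\<langle>Var 0 \<cdot> sh 3\<rangle>\<langle>Var (Suc 0) \<cdot> Var\<rangle>"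
    by (rule VarT; use w2 in simp)+
  note t = F.trT[OF x(1,1) F.invT[OF x(1,1) EqlI[OF x(1)]] x(2) refl]
  have "inhabited (P # X # \<Gamma>) (Eql (P\<langle>Var 0 \<cdot> sh 3\<rangle>\<langle>Var (Suc 0) \<cdot> Var\<rangle>) (App (transport (P\<langle>Var 0
      \<cdot> sh 3\<rangle>) (Var (Suc 0)) (Var (Suc 0)) (Refl (Var (Suc 0))))
      (App (transport (P\<langle>Var 0 \<cdot> sh 3\<rangle>) (Var (Suc 0)) (Var (Suc 0)) (path_inv X\<up>2 (Var (Suc 0))
          (Var (Suc 0)) (Refl (Var (Suc 0))))) (Var 0))) (Var 0))"
    by (rule inhabited_refl[OF F.fibreF[OF x(1)] F.trT[OF x(1,1) EqlI[OF x(1)] t refl]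
      EqTrans[OF F.tr_refl[OF x(1) t] F.tr_inv_refl[OF x]]])
  then have c: "inhabited (X # \<Gamma>) (?C\<langle>Refl (Var 0) \<cdot> Var 0 \<cdot> Var 0 \<cdot> sh (Suc 0)\<rangle>)"
    using inhabited_Pi[OF P] by simp
  show ?thesis
    by (rule inhabited_app[OF inhabited_J[OF C c a b p refl, simplified] v]) simp
qed

lemma tr_inv_eq:
  assumes a: "\<Gamma> \<turnstile> a \<^bold>: X" and b: "\<Gamma> \<turnstile> b \<^bold>: X" and p: "\<Gamma> \<turnstile> p \<^bold>: Eql X a b"
    and u: "\<Gamma> \<turnstile> u \<^bold>: P\<langle>a \<cdot> Var\<rangle>" and v: "\<Gamma> \<turnstile> v \<^bold>: P\<langle>b \<cdot> Var\<rangle>"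
    and eq: "inhabited \<Gamma> (Eql (P\<langle>b \<cdot> Var\<rangle>) (App (transport P a b p) u) v)"
  shows "inhabited \<Gamma> (Eql (P\<langle>a \<cdot> Var\<rangle>) (App (transport P b a (path_inv X a b p)) v) u)"
proof -
  note q = invT[OF a b p] and t = trT[OF a b p u refl]
  note t' = trT[OF b a q t refl] and s = trT[OF b a q v refl]
  show ?thesis
    by (rule inhabited_trans[OF inhabited_sym[OF tr_ap[OF b a q t v eq] fibreF[OF a] t' s]
      tr_inv_tr[OF a b p u] fibreF[OF a] s t' u])
qed

lemma tr_eq:
  assumes a: "\<Gamma> \<turnstile> a \<^bold>: X" and b: "\<Gamma> \<turnstile> b \<^bold>: X" and p: "\<Gamma> \<turnstile> p \<^bold>: Eql X a b"
    and u: "\<Gamma> \<turnstile> u \<^bold>: P\<langle>a \<cdot> Var\<rangle>" and v: "\<Gamma> \<turnstile> v \<^bold>: P\<langle>b \<cdot> Var\<rangle>"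
    and eq: "inhabited \<Gamma> (Eql (P\<langle>a \<cdot> Var\<rangle>) (App (transport P b a (path_inv X a b p)) v) u)"
  shows "inhabited \<Gamma> (Eql (P\<langle>b \<cdot> Var\<rangle>) (App (transport P a b p) u) v)"
proof -
  note q = invT[OF a b p]
  note t = trT[OF b a q v refl]
  note t' = trT[OF a b p t refl] and s = trT[OF a b p u refl]
  show ?thesis
    by (rule inhabited_trans[OF inhabited_sym[OF tr_ap[OF a b p t u eq] fibreF[OF b] t' s]
      tr_tr_inv[OF a b p v] fibreF[OF b] s t' v])
qed

lemma trivial_transport_parts:
  assumes a: "\<Gamma> \<turnstile> a \<^bold>: X" and b: "\<Gamma> \<turnstile> b \<^bold>: X"
  defines "\<Delta> \<equiv> P\<langle>a\<Up> \<cdot> sh (Suc 0)\<rangle> # Eql X a b # \<Gamma>"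
  shows "family \<Delta> i X\<up>2 (P\<langle>Var 0 \<cdot> sh 3\<rangle>)" and "extends 2 \<Gamma> \<Delta>"
    and "\<Delta> \<turnstile> a\<up>2 \<^bold>: X\<up>2" "\<Delta> \<turnstile> b\<up>2 \<^bold>: X\<up>2"
    and "\<Delta> \<turnstile> Var (Suc 0) \<^bold>: Eql X\<up>2 a\<up>2 b\<up>2"
    and "\<Delta> \<turnstile> Var 0 \<^bold>: P\<langle>Var 0 \<cdot> sh 3\<rangle>\<langle>a\<up>2 \<cdot> Var\<rangle>"
    and "\<Gamma> \<turnstile> Eql X a b \<^bold>: Univ i" "Eql X a b # \<Gamma> \<turnstile> P\<langle>a\<Up> \<cdot> sh (Suc 0)\<rangle> \<^bold>: Univ i"
proof -
  show E: "\<Gamma> \<turnstile> Eql X a b \<^bold>: Univ i" by (rule EqlF[OF X a b])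
  note w = CtxCons[OF E] note e1 = wf_extends(1)[OF w]
  show P1: "Eql X a b # \<Gamma> \<turnstile> P\<langle>a\<Up> \<cdot> sh (Suc 0)\<rangle> \<^bold>: Univ i"
    by (rule fam_weaken[OF P e1 extends_weaken[OF e1 a refl]])
  note w2 = CtxCons[OF P1, folded \<Delta>_def]
  show e2: "extends 2 \<Gamma> \<Delta>" using w2 unfolding \<Delta>_def by (rule wf_extends)
  show "family \<Delta> i X\<up>2 (P\<langle>Var 0 \<cdot> sh 3\<rangle>)"
    by (rule family_weaken[OF family_axioms e2]) simp_all
  show "\<Delta> \<turnstile> a\<up>2 \<^bold>: X\<up>2" "\<Delta> \<turnstile> b\<up>2 \<^bold>: X\<up>2"
    by (rule extends_weaken[OF e2 a refl] extends_weaken[OF e2 b refl])+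
  show "\<Delta> \<turnstile> Var (Suc 0) \<^bold>: Eql X\<up>2 a\<up>2 b\<up>2" "\<Delta> \<turnstile> Var 0 \<^bold>: P\<langle>Var 0 \<cdot> sh 3\<rangle>\<langle>a\<up>2 \<cdot> Var\<rangle>"
    by (rule VarT; use w2 in \<open>simp add: \<Delta>_def\<close>)+
qed

lemma trivial_transportF:
  assumes a: "\<Gamma> \<turnstile> a \<^bold>: X"
  shows "\<Gamma> \<turnstile> trivial_transport X P a \<^bold>: Univ i"
proof -
  note t = trivial_transport_parts[OF a a]
  interpret D: family "P\<langle>a\<Up> \<cdot> sh (Suc 0)\<rangle> # Eql X a a # \<Gamma>" i "X\<up>2" "P\<langle>Var 0 \<cdot> sh 3\<rangle>" by (rule t)
  show ?thesis
    using PiF[OF t(7) PiF[OF t(8) EqlF[OF D.fibreF[OF t(3)] D.trT[OF t(3,3,5,6) refl] t(6)]]]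
    by (simp add: trivial_transport_def)
qed

lemma same_transportF:
  assumes a: "\<Gamma> \<turnstile> a \<^bold>: X" and b: "\<Gamma> \<turnstile> b \<^bold>: X" and p: "\<Gamma> \<turnstile> p \<^bold>: Eql X a b"
  shows "\<Gamma> \<turnstile> same_transport X P a b p \<^bold>: Univ i"
proof -
  note t = trivial_transport_parts[OF a b]
  interpret D: family "P\<langle>a\<Up> \<cdot> sh (Suc 0)\<rangle> # Eql X a b # \<Gamma>" i "X\<up>2" "P\<langle>Var 0 \<cdot> sh 3\<rangle>" by (rule t)
  have p': "P\<langle>a\<Up> \<cdot> sh (Suc 0)\<rangle> # Eql X a b # \<Gamma> \<turnstile> p\<up>2 \<^bold>: Eql X\<up>2 a\<up>2 b\<up>2"
    by (rule extends_weaken[OF t(2) p]) simp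
  show ?thesis
    using PiF[OF t(7) PiF[OF t(8) EqlF[OF D.fibreF[OF t(4)] D.trT[OF t(3,4) p' t(6) refl]
        D.trT[OF t(3-6) refl]]]]
    by (simp add: same_transport_def)
qed

lemma trivial_transportE:
  assumes "inhabited \<Gamma> (trivial_transport X P a)" and l: "\<Gamma> \<turnstile> l \<^bold>: Eql X a a"
    and u: "\<Gamma> \<turnstile> u \<^bold>: P\<langle>a \<cdot> Var\<rangle>"
  shows "inhabited \<Gamma> (Eql (P\<langle>a \<cdot> Var\<rangle>) (App (transport P a a l) u) u)"
  by (rule inhabited_app[OF inhabited_app[OF assms(1)[unfolded trivial_transport_def] l refl,
      simplified] u]) simp

lemma same_transportE:
  assumes "inhabited \<Gamma> (same_transport X P a b p)" and q: "\<Gamma> \<turnstile> q \<^bold>: Eql X a b"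
    and u: "\<Gamma> \<turnstile> u \<^bold>: P\<langle>a \<cdot> Var\<rangle>"
  shows "inhabited \<Gamma> (Eql (P\<langle>b \<cdot> Var\<rangle>) (App (transport P a b p) u) (App (transport P a b q) u))"
  by (rule inhabited_app[OF inhabited_app[OF assms(1)[unfolded same_transport_def] q refl,
      simplified] u]) simp

lemma trivial_of_same_refl:
  assumes a: "\<Gamma> \<turnstile> a \<^bold>: X" and h: "inhabited \<Gamma> (same_transport X P a a (Refl a))"
  shows "inhabited \<Gamma> (trivial_transport X P a)"
proof -
  note t = trivial_transport_parts[OF a a]
  interpret D: family "P\<langle>a\<Up> \<cdot> sh (Suc 0)\<rangle> # Eql X a a # \<Gamma>" i "X\<up>2" "P\<langle>Var 0 \<cdot> sh 3\<rangle>" by (rule t)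
  note l = D.trT[OF t(3,3,5,6) refl] and r = D.trT[OF t(3,3) EqlI[OF t(3)] t(6) refl]
  have "inhabited (P\<langle>a\<Up> \<cdot> sh (Suc 0)\<rangle> # Eql X a a # \<Gamma>)
      (same_transport X\<up>2 (P\<langle>Var 0 \<cdot> sh 3\<rangle>) a\<up>2 a\<up>2 (Refl a\<up>2))"
    by (rule inhabited_weaken[OF h t(2)]) simp
  note eq = D.same_transportE[OF this t(5,6)]
  note eq' = inhabited_Eql_conv[OF inhabited_sym[OF eq D.fibreF[OF t(3)] r l] D.fibreF[OF t(3)]
      EqRefl[OF l] D.tr_refl[OF t(3,6)]]
  show ?thesis
    using inhabited_Pi[OF t(7) inhabited_Pi[OF t(8)]] eq' by (simp add: trivial_transport_def)
qed

lemma same_refl_of_trivial: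
  assumes a: "\<Gamma> \<turnstile> a \<^bold>: X" and h: "inhabited \<Gamma> (trivial_transport X P a)"
  shows "inhabited \<Gamma> (same_transport X P a a (Refl a))"
proof -
  note t = trivial_transport_parts[OF a a]
  interpret D: family "P\<langle>a\<Up> \<cdot> sh (Suc 0)\<rangle> # Eql X a a # \<Gamma>" i "X\<up>2" "P\<langle>Var 0 \<cdot> sh 3\<rangle>" by (rule t)
  note l = D.trT[OF t(3,3,5,6) refl]
  have "inhabited (P\<langle>a\<Up> \<cdot> sh (Suc 0)\<rangle> # Eql X a a # \<Gamma>)
      (trivial_transport X\<up>2 (P\<langle>Var 0 \<cdot> sh 3\<rangle>) a\<up>2)"
    by (rule inhabited_weaken[OF h t(2)]) simp
  note eq = D.trivial_transportE[OF this t(5,6)]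
  note eq' = inhabited_Eql_conv[OF inhabited_sym[OF eq D.fibreF[OF t(3)] l t(6)] D.fibreF[OF t(3)]
      EqSym[OF D.tr_refl[OF t(3,6)]] EqRefl[OF l]]
  show ?thesis
    using inhabited_Pi[OF t(7) inhabited_Pi[OF t(8)]] eq' by (simp add: same_transport_def)
qed

lemma trivial_same_refl:
  assumes a: "\<Gamma> \<turnstile> a \<^bold>: X"
  shows "inhabited \<Gamma> (Arr (same_transport X P a a (Refl a)) (trivial_transport X P a))"
    and "inhabited \<Gamma> (Arr (trivial_transport X P a) (same_transport X P a a (Refl a)))"
proof -
  show "inhabited \<Gamma> (Arr (same_transport X P a a (Refl a)) (trivial_transport X P a))"
  proof (rule inhabited_Arr_generic[OF same_transportF[OF a a EqlI[OF a]]])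
    fix \<Delta> n
    assume e: "extends n \<Gamma> \<Delta>" and h: "inhabited \<Delta> ((same_transport X P a a (Refl a))\<up>n)"
    interpret E: family \<Delta> i "X\<up>n" "P\<langle>Var 0 \<cdot> sh (Suc n)\<rangle>"
      by (rule family_weaken[OF family_axioms e]) simp_all
    show "inhabited \<Delta> ((trivial_transport X P a)\<up>n)"
      using E.trivial_of_same_refl[OF extends_weaken[OF e a refl]] h by simp
  qed
  show "inhabited \<Gamma> (Arr (trivial_transport X P a) (same_transport X P a a (Refl a)))"
  proof (rule inhabited_Arr_generic[OF trivial_transportF[OF a]])
    fix \<Delta> n
    assume e: "extends n \<Gamma> \<Delta>" and h: "inhabited \<Delta> ((trivial_transport X P a)\<up>n)"
    interpret E: family \<Delta> i "X\<up>n" "P\<langle>Var 0 \<cdot> sh (Suc n)\<rangle>"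
      by (rule family_weaken[OF family_axioms e]) simp_all
    show "inhabited \<Delta> ((same_transport X P a a (Refl a))\<up>n)"
      using E.same_refl_of_trivial[OF extends_weaken[OF e a refl]] h by simp
  qed
qed

text \<open>
  Path induction on \<open>p\<close>. For \<open>p = refl\<close> the comparison with \<open>p\<close> is a comparison with the identity.
\<close>

lemma trivial_same:
  assumes a: "\<Gamma> \<turnstile> a \<^bold>: X" and b: "\<Gamma> \<turnstile> b \<^bold>: X" and p: "\<Gamma> \<turnstile> p \<^bold>: Eql X a b"
  shows "inhabited \<Gamma> (Arr (same_transport X P a b p) (trivial_transport X P a))"
    and "inhabited \<Gamma> (Arr (trivial_transport X P a) (same_transport X P a b p))"
proof -
  let ?\<Delta> = "Eql X\<up>2 (Var (Suc 0)) (Var 0) # X\<Up> # X # \<Gamma>"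
  interpret D: family ?\<Delta> i "X\<up>3" "P\<langle>Var 0 \<cdot> sh 4\<rangle>" by (rule path_ctx)
  interpret E: family "X # \<Gamma>" i "X\<Up>" "P\<langle>Var 0 \<cdot> sh 2\<rangle>" by (rule point_ctx)
  note sF = D.same_transportF[OF path_ctx(3-5)] and tF = D.trivial_transportF[OF path_ctx(3)]
  show "inhabited \<Gamma> (Arr (same_transport X P a b p) (trivial_transport X P a))"
    by (rule inhabited_J[OF ArrF[OF sF tF] _ a b p]) (simp_all add:
        E.trivial_same_refl[OF point_ctx(3)])
  show "inhabited \<Gamma> (Arr (trivial_transport X P a) (same_transport X P a b p))"
    by (rule inhabited_J[OF ArrF[OF tF sF] _ a b p]) (simp_all add:
        E.trivial_same_refl[OF point_ctx(3)])
qed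

lemma trivial_tr_eq:
  assumes triv: "inhabited \<Gamma> (trivial_transport X P a)"
    and a: "\<Gamma> \<turnstile> a \<^bold>: X" and b: "\<Gamma> \<turnstile> b \<^bold>: X" and p: "\<Gamma> \<turnstile> p \<^bold>: Eql X a b" and q: "\<Gamma> \<turnstile> q \<^bold>: Eql X a b"
    and u: "\<Gamma> \<turnstile> u \<^bold>: P\<langle>a \<cdot> Var\<rangle>"
  shows "inhabited \<Gamma> (Eql (P\<langle>b \<cdot> Var\<rangle>) (App (transport P a b p) u) (App (transport P a b q) u))"
  by (rule same_transportE[OF inhabited_app_Arr[OF trivial_same(2)[OF a b p] triv] q u])

text \<open>
  Let \<open>u = (p\<inverse>)\<^sub>* v\<close>. Then \<open>q\<^sub>* u = p\<^sub>* u = v\<close>, and hence \<open>(q\<inverse>)\<^sub>* v = u\<close>.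
\<close>

lemma trivial_tr_inv_eq:
  assumes triv: "inhabited \<Gamma> (trivial_transport X P a)"
    and a: "\<Gamma> \<turnstile> a \<^bold>: X" and b: "\<Gamma> \<turnstile> b \<^bold>: X" and p: "\<Gamma> \<turnstile> p \<^bold>: Eql X a b" and q: "\<Gamma> \<turnstile> q \<^bold>: Eql X a b"
    and v: "\<Gamma> \<turnstile> v \<^bold>: P\<langle>b \<cdot> Var\<rangle>"
  shows "inhabited \<Gamma> (Eql (P\<langle>a \<cdot> Var\<rangle>) (App (transport P b a (path_inv X a b p)) v) (App
      (transport P b a (path_inv X a b q)) v))"
proof -
  note u = trT[OF b a invT[OF a b p] v refl] and u' = trT[OF b a invT[OF a b q] v refl]
  note t = trT[OF a b p u refl] and t' = trT[OF a b q u refl]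
  have "inhabited \<Gamma> (Eql (P\<langle>b \<cdot> Var\<rangle>) (App (transport P a b q) (App (transport P b a (path_inv
      X a b p)) v)) v)"
    by (rule inhabited_trans[OF inhabited_sym[OF trivial_tr_eq[OF triv a b p q u] fibreF[OF b] t t']
      tr_tr_inv[OF a b p v] fibreF[OF b] t' t v])
  then show ?thesis
    by (intro inhabited_sym[OF tr_inv_eq[OF a b q u v] fibreF[OF a] u' u])
qed

end

section \<open>Homotopy groups\<close>

lemma subst_Pointed [simp]: "(Pointed i)\<langle>\<sigma>\<rangle> = Pointed i"
  by (simp add: Pointed_def)

lemma subst_carrier [simp]:
  "(carrier i P)\<langle>\<sigma>\<rangle> = carrier i (P\<langle>\<sigma>\<rangle>)" "(point i P)\<langle>\<sigma>\<rangle> = point i (P\<langle>\<sigma>\<rangle>)" "(Loop i P)\<langle>\<sigma>\<rangle> =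
      Loop i (P\<langle>\<sigma>\<rangle>)"
  by (simp_all add: carrier_def point_def Loop_def)

lemma subst_Loops [simp]: "(Loops i n X x)\<langle>\<sigma>\<rangle> = Loops i (n\<langle>\<sigma>\<rangle>) (X\<langle>\<sigma>\<rangle>) (x\<langle>\<sigma>\<rangle>)"
  by (simp add: Loops_def)

lemma subst_hgroup [simp]: "(hgroup i n X x)\<langle>\<sigma>\<rangle> = hgroup i (n\<langle>\<sigma>\<rangle>) (X\<langle>\<sigma>\<rangle>) (x\<langle>\<sigma>\<rangle>)"
  by (simp add: hgroup_def)

lemma hgroup_fam_eq [simp]: "hgroup_fam i n X = hgroup i n\<Up> X\<Up> (Var 0)"
  by (simp add: hgroup_fam_def)

lemma subst_hgroup_mult [simp]:
  "(hgroup_mult i m X x u v)\<langle>\<sigma>\<rangle> = hgroup_mult i (m\<langle>\<sigma>\<rangle>) (X\<langle>\<sigma>\<rangle>) (x\<langle>\<sigma>\<rangle>) (u\<langle>\<sigma>\<rangle>) (v\<langle>\<sigma>\<rangle>)"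
  by (simp add: hgroup_mult_def)

lemma subst_action [simp]:
  "(action i n X a q u)\<langle>\<sigma>\<rangle> = action i (n\<langle>\<sigma>\<rangle>) (X\<langle>\<sigma>\<rangle>) (a\<langle>\<sigma>\<rangle>) (q\<langle>\<sigma>\<rangle>) (u\<langle>\<sigma>\<rangle>)"
  by (simp add: action_def)

text \<open>
  The type of pointed types lies one universe above the carriers, which is why \<open>Var 0\<close> is typed at
  both levels.
\<close>

lemma Pointed_parts:
  assumes "wf_ctx \<Gamma>"
  shows "\<Gamma> \<turnstile> Univ i \<^bold>: Univ (Suc i)" "Univ i # \<Gamma> \<turnstile> Var 0 \<^bold>:
      Univ (Suc i)" "Univ i # \<Gamma> \<turnstile> Var 0 \<^bold>: Univ i"
proof -
  show U: "\<Gamma> \<turnstile> Univ i \<^bold>: Univ (Suc i)" by (rule UnivF[OF assms])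
  show "Univ i # \<Gamma> \<turnstile> Var 0 \<^bold>: Univ i" by (rule VarT) (simp_all add: CtxCons[OF U])
  then show "Univ i # \<Gamma> \<turnstile> Var 0 \<^bold>: Univ (Suc i)" by (rule Cumul)
qed

lemma PointedF: "wf_ctx \<Gamma> \<Longrightarrow> \<Gamma> \<turnstile> Pointed i \<^bold>: Univ (Suc i)"
  unfolding Pointed_def by (intro SigF Pointed_parts)

lemma carrierF: "\<Gamma> \<turnstile> P \<^bold>: Pointed i \<Longrightarrow> \<Gamma> \<turnstile> carrier i P \<^bold>: Univ i"
  unfolding Pointed_def carrier_def by (rule proj1T[OF Pointed_parts(1,2)])
      (simp_all add: has_type_wf)

lemma pointT: "\<Gamma> \<turnstile> P \<^bold>: Pointed i \<Longrightarrow> \<Gamma> \<turnstile> point i P \<^bold>: carrier i P"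
  unfolding Pointed_def carrier_def point_def
  by (rule proj2T[OF Pointed_parts(1,2)]) (simp_all add: has_type_wf)

lemma Tup_Pointed: "\<Gamma> \<turnstile> X \<^bold>: Univ i \<Longrightarrow> \<Gamma> \<turnstile> x \<^bold>: X \<Longrightarrow> \<Gamma> \<turnstile> Tup X x \<^bold>: Pointed i"
  unfolding Pointed_def by (rule SigI[OF Pointed_parts(2)]) (simp_all add: has_type_wf)

lemma carrier_Tup: "\<Gamma> \<turnstile> X \<^bold>: Univ i \<Longrightarrow> \<Gamma> \<turnstile> x \<^bold>: X \<Longrightarrow> \<Gamma> \<turnstile> carrier i (Tup X x) \<doteq> X \<^bold>: Univ i"
  unfolding carrier_def by (rule proj1_beta[OF Pointed_parts(1,2)]) (simp_all add: has_type_wf)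

lemma point_Tup: "\<Gamma> \<turnstile> X \<^bold>: Univ i \<Longrightarrow> \<Gamma> \<turnstile> x \<^bold>: X \<Longrightarrow> \<Gamma> \<turnstile> point i (Tup X x) \<doteq> x \<^bold>: X"
  unfolding point_def using proj2_beta[OF Pointed_parts(1,2), of \<Gamma> X i x] by (simp add: has_type_wf)

lemma LoopT: "\<Gamma> \<turnstile> P \<^bold>: Pointed i \<Longrightarrow> \<Gamma> \<turnstile> Loop i P \<^bold>: Pointed i"
  unfolding Loop_def by (intro Tup_Pointed EqlF carrierF pointT EqlI)

lemma carrier_Loop:
  "\<Gamma> \<turnstile> P \<^bold>: Pointed i \<Longrightarrow> \<Gamma> \<turnstile> carrier i (Loop i P) \<doteq>
      Eql (carrier i P) (point i P) (point i P) \<^bold>: Univ i"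
  unfolding Loop_def by (intro carrier_Tup EqlF carrierF pointT EqlI)

lemma Loops_parts:
  assumes "wf_ctx \<Gamma>"
  shows "Nat # \<Gamma> \<turnstile> Pointed i \<^bold>: Univ (Suc i)"
    and "Pointed i # Nat # \<Gamma> \<turnstile> Loop i (Var 0) \<^bold>: Pointed i"
proof -
  show w: "Nat # \<Gamma> \<turnstile> Pointed i \<^bold>: Univ (Suc i)" by (intro PointedF CtxCons[OF NatF[OF assms]])
  show "Pointed i # Nat # \<Gamma> \<turnstile> Loop i (Var 0) \<^bold>: Pointed i"
    by (intro LoopT VarT) (simp_all add: CtxCons[OF w])
qed

lemma LoopsT:
  "\<Gamma> \<turnstile> n \<^bold>: Nat \<Longrightarrow> \<Gamma> \<turnstile> X \<^bold>: Univ i \<Longrightarrow> \<Gamma> \<turnstile> x \<^bold>: X \<Longrightarrow> \<Gamma> \<turnstile> Loops i n X x \<^bold>: Pointed i"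
  using NatE[of \<Gamma> "Pointed i" "Suc i" "Tup X x" "Loop i (Var 0)" n] Loops_parts[of \<Gamma> i]
  by (simp add: Loops_def Tup_Pointed has_type_wf)

lemma Loops_Zero:
  "\<Gamma> \<turnstile> X \<^bold>: Univ i \<Longrightarrow> \<Gamma> \<turnstile> x \<^bold>: X \<Longrightarrow> \<Gamma> \<turnstile> Loops i Zero X x \<doteq> Tup X x \<^bold>: Pointed i"
  using NatBeta0[of \<Gamma> "Pointed i" "Suc i" "Tup X x" "Loop i (Var 0)"] Loops_parts[of \<Gamma> i]
  by (simp add: Loops_def Tup_Pointed has_type_wf)

lemma Loops_Succ:
  "\<Gamma> \<turnstile> n \<^bold>: Nat \<Longrightarrow> \<Gamma> \<turnstile> X \<^bold>: Univ i \<Longrightarrow> \<Gamma> \<turnstile> x \<^bold>: X \<Longrightarrow>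
    \<Gamma> \<turnstile> Loops i (Succ n) X x \<doteq> Loop i (Loops i n X x) \<^bold>: Pointed i"
  using NatBetaS[of \<Gamma> "Pointed i" "Suc i" "Tup X x" "Loop i (Var 0)" n] Loops_parts[of \<Gamma> i]
  by (simp add: Loops_def Tup_Pointed has_type_wf)

lemma carrier_cong:
  assumes "\<Gamma> \<turnstile> P \<doteq> Q \<^bold>: Pointed i"
  shows "\<Gamma> \<turnstile> carrier i P \<doteq> carrier i Q \<^bold>: Univ i"
proof -
  have "Pointed i # \<Gamma> \<turnstile> carrier i (Var 0) \<^bold>: Univ i"
    by (intro carrierF VarT) (simp_all add: CtxCons[OF PointedF[OF jdg_eq_wf[OF assms]]])
  from eq_subst1[OF this assms refl] show ?thesis by simp
qed

lemma carrier_Loops_Succ: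
  assumes "\<Gamma> \<turnstile> n \<^bold>: Nat" "\<Gamma> \<turnstile> X \<^bold>: Univ i" "\<Gamma> \<turnstile> x \<^bold>: X"
  shows "\<Gamma> \<turnstile> carrier i (Loops i (Succ n) X x) \<doteq>
    Eql (carrier i (Loops i n X x)) (point i (Loops i n X x)) (point i (Loops i n X x)) \<^bold>: Univ i"
  by (rule EqTrans[OF carrier_cong[OF Loops_Succ[OF assms]] carrier_Loop[OF LoopsT[OF assms]]])

text \<open>
  Elements of \<open>\<Omega>\<^sup>1(X, x)\<close> are loops at \<open>x\<close> only up to this judgemental equality; the definition of
  the action relies on it when it inverts them.
\<close>

lemma carrier_Loops_One:
  assumes X: "\<Gamma> \<turnstile> X \<^bold>: Univ i" and x: "\<Gamma> \<turnstile> x \<^bold>: X"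
  shows "\<Gamma> \<turnstile> carrier i (Loops i (Succ Zero) X x) \<doteq> Eql X x x \<^bold>: Univ i"
proof -
  note w0 = has_type_wf[OF X]
  note z = NatI0[OF w0]
  let ?P = "Tup X x"
  note P = Tup_Pointed[OF X x]
  have w1: "wf_ctx (Pointed i # \<Gamma>)" by (rule CtxCons[OF PointedF[OF w0]])
  have v: "Pointed i # \<Gamma> \<turnstile> Var 0 \<^bold>: Pointed i" by (rule VarT) (simp_all add: w1)
  have "\<Gamma> \<turnstile> (Eql (carrier i (Var 0)) (point i (Var 0)) (point i (Var 0)))\<langle>Loops i Zero X x \<cdot> Var\<rangle> \<doteq>
      (Eql (carrier i (Var 0)) (point i (Var 0)) (point i (Var 0)))\<langle>Tup X x \<cdot> Var\<rangle> \<^bold>: Univ i"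
    by (rule eq_subst1[OF EqlF[OF carrierF[OF v] pointT[OF v] pointT[OF v]] Loops_Zero[OF X x]]) simp
  moreover have "\<Gamma> \<turnstile> Eql (carrier i ?P) (point i ?P) (point i ?P) \<doteq> Eql X x x \<^bold>: Univ i"
  proof -
    have U: "\<Gamma> \<turnstile> Univ i \<^bold>: Univ (Suc i)" by (rule UnivF[OF w0])
    note u1 = CtxCons[OF U]
    have V0: "Univ i # \<Gamma> \<turnstile> Var 0 \<^bold>: Univ i" by (rule VarT) (simp_all add: u1)
    note u2 = CtxCons[OF V0]
    have V1: "Var 0 # Univ i # \<Gamma> \<turnstile> Var (Suc 0) \<^bold>: Univ i" by (rule VarT) (simp_all add: u2)
    note u3 = CtxCons[OF V1]
    have E: "Var (Suc 0) # Var 0 # Univ i # \<Gamma> \<turnstile> Eql (Var 2) (Var (Suc 0)) (Var 0) \<^bold>: Univ i"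
      by (rule EqlF; rule VarT) (simp_all add: u3)
    have pt: "\<Gamma> \<turnstile> point i ?P \<doteq> x \<^bold>: carrier i ?P"
      by (rule EqConv[OF point_Tup[OF X x] EqSym[OF carrier_Tup[OF X x]]])
    have "\<Gamma> \<turnstile> (Eql (Var 2) (Var (Suc 0)) (Var 0))\<langle>point i ?P \<cdot> point i ?P \<cdot> carrier i ?P \<cdot> Var\<rangle> \<doteq>
        (Eql (Var 2) (Var (Suc 0)) (Var 0))\<langle>x \<cdot> x \<cdot> X \<cdot> Var\<rangle> \<^bold>: Univ i"
      by (rule eq_subst[OF EqRefl[OF E]], intro eqsub_scons eqsub_refl sub_Var[OF w0])
        (simp_all add: carrier_Tup[OF X x] pt)
    then show ?thesis by simp
  qed
  ultimately show ?thesis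
    using carrier_Loops_Succ[OF z X x] by (auto intro: EqTrans)
qed

lemma hgroupF: "\<Gamma> \<turnstile> n \<^bold>: Nat \<Longrightarrow> \<Gamma> \<turnstile> X \<^bold>: Univ i \<Longrightarrow> \<Gamma> \<turnstile> x \<^bold>: X \<Longrightarrow> \<Gamma> \<turnstile> hgroup i n X x \<^bold>: Univ i"
  unfolding hgroup_def by (intro STrF carrierF LoopsT)

lemma hgroup_family:
  assumes n: "\<Gamma> \<turnstile> n \<^bold>: Nat" and X: "\<Gamma> \<turnstile> X \<^bold>: Univ i"
  shows "family \<Gamma> i X (hgroup i n\<Up> X\<Up> (Var 0))"
proof
  note w = CtxCons[OF X] note e = wf_extends(1)[OF w]
  show "X # \<Gamma> \<turnstile> hgroup i n\<Up> X\<Up> (Var 0) \<^bold>: Univ i"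
    by (intro hgroupF extends_weaken[OF e n] Univ_weaken[OF e X] VarT) (simp_all add: w)
qed fact

lemma hgroup_multT:
  assumes m: "\<Gamma> \<turnstile> m \<^bold>: Nat" and X: "\<Gamma> \<turnstile> X \<^bold>: Univ i" and x: "\<Gamma> \<turnstile> x \<^bold>: X"
    and u: "\<Gamma> \<turnstile> u \<^bold>: hgroup i (Succ m) X x" and v: "\<Gamma> \<turnstile> v \<^bold>: hgroup i (Succ m) X x"
  shows "\<Gamma> \<turnstile> hgroup_mult i m X x u v \<^bold>: hgroup i (Succ m) X x"
proof -
  let ?L = "carrier i (Loops i (Succ m) X x)"
  let ?P = "Loops i m X x"
  note P = LoopsT[OF m X x]
  have L: "\<Gamma> \<turnstile> ?L \<^bold>: Univ i" by (intro carrierF LoopsT NatIS m X x)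
  note w1 = CtxCons[OF L] note e1 = wf_extends(1)[OF w1]
  have L1: "?L # \<Gamma> \<turnstile> ?L\<Up> \<^bold>: Univ i" by (rule Univ_weaken[OF e1 L])
  note w2 = CtxCons[OF L1] note e2 = wf_extends(2)[OF w2]
  let ?\<Gamma>2 = "?L\<Up> # ?L # \<Gamma>"
  let ?A = "carrier i ?P\<up>2" and ?a = "point i ?P\<up>2"
  have P2: "?\<Gamma>2 \<turnstile> ?P\<up>2 \<^bold>: Pointed i" by (rule extends_weaken[OF e2 P]) simp
  have eq: "?\<Gamma>2 \<turnstile> ?L\<up>2 \<doteq> Eql ?A ?a ?a \<^bold>: Univ i"
    using carrier_Loops_Succ[of ?\<Gamma>2 "m\<up>2" "X\<up>2" i "x\<up>2"]
      extends_weaken[OF e2 m refl] extends_weaken[OF e2 X refl] extends_weaken[OF e2 x refl] by simp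
  have v0: "?\<Gamma>2 \<turnstile> Var 0 \<^bold>: Eql ?A ?a ?a" "?\<Gamma>2 \<turnstile> Var (Suc 0) \<^bold>: Eql ?A ?a ?a"
    by (rule Conv[OF VarT eq]; use w2 in simp)+
  note A = carrierF[OF P2] and a = pointT[OF P2]
  have c: "?\<Gamma>2 \<turnstile> SIn (path_comp ?A ?a ?a ?a (Var (Suc 0)) (Var 0)) \<^bold>: STr ?L\<up>2"
    by (intro STrI Conv[OF path_compT[OF A a a a v0(2,1)] EqSym[OF eq]])
  note s1 = CtxCons[OF STrF[OF L]] and s2 = CtxCons[OF STrF[OF L1]]
  have "?L # \<Gamma> \<turnstile> SInd (STr ?L\<up>2) (SIn (path_comp ?A ?a ?a ?a (Var (Suc 0)) (Var 0)))
      (STr_isSet ?L\<up>2) v\<Up>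
      \<^bold>: (STr ?L\<up>2)\<langle>v\<Up> \<cdot> Var\<rangle>"
  proof (rule STrE[OF _ _ STr_isSetT])
    have e: "extends 2 \<Gamma> (STr ?L\<Up> # ?L # \<Gamma>)" by (rule wf_extends(2)[OF s2])
    show "STr ?L\<Up> # ?L # \<Gamma> \<turnstile> STr ?L\<up>2 \<^bold>: Univ i"
      "STr ?L\<Up> # ?L # \<Gamma> \<turnstile> ?L\<up>2 \<^bold>: Univ i"
      by (intro STrF Univ_weaken[OF e L])+
    show "?\<Gamma>2 \<turnstile> SIn (path_comp ?A ?a ?a ?a (Var (Suc 0)) (Var 0)) \<^bold>: (STr ?L\<up>2)\<langle>SIn (Var 0) \<cdot> sh 1\<rangle>"
      using c by simp
    show "?L # \<Gamma> \<turnstile> v\<Up> \<^bold>: STr ?L\<Up>"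
      by (rule extends_weaken[OF e1 v]) (simp add: hgroup_def)
  qed
  then have c1: "?L # \<Gamma> \<turnstile> SInd (STr ?L\<up>2) (SIn (path_comp ?A ?a ?a ?a (Var (Suc 0)) (Var 0)))
      (STr_isSet ?L\<up>2) v\<Up>
      \<^bold>: (STr ?L\<Up>)\<langle>SIn (Var 0) \<cdot> sh 1\<rangle>" by simp
  have e: "extends (Suc 0) \<Gamma> (STr ?L # \<Gamma>)" by (rule wf_extends(1)[OF s1])
  note l1 = Univ_weaken[OF e L]
  show ?thesis
    using STrE[OF STrF[OF l1] c1 STr_isSetT[OF l1] u[unfolded hgroup_def]]
    by (simp add: hgroup_mult_def hgroup_def)
qed

lemma hgroup_mult_cong:
  assumes m: "\<Gamma> \<turnstile> m \<^bold>: Nat" and X: "\<Gamma> \<turnstile> X \<^bold>: Univ i" and x: "\<Gamma> \<turnstile> x \<^bold>: X"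
    and u: "\<Gamma> \<turnstile> u \<doteq> u' \<^bold>: hgroup i (Succ m) X x" and v: "\<Gamma> \<turnstile> v \<doteq> v' \<^bold>: hgroup i (Succ m) X x"
  shows "\<Gamma> \<turnstile> hgroup_mult i m X x u v \<doteq> hgroup_mult i m X x u' v' \<^bold>: hgroup i (Succ m) X x"
proof -
  let ?G = "hgroup i (Succ m) X x"
  have G: "\<Gamma> \<turnstile> ?G \<^bold>: Univ i" by (intro hgroupF NatIS m X x)
  note w = wf_J[OF G] note e = wf_extends(2)[OF w(2)]
  have "?G\<Up> # ?G # \<Gamma> \<turnstile> hgroup_mult i m\<up>2 X\<up>2 x\<up>2 (Var (Suc 0)) (Var 0) \<^bold>:
      hgroup i (Succ m\<up>2) X\<up>2 x\<up>2"
    by (intro hgroup_multT extends_weaken[OF e m] Univ_weaken[OF e X] extends_weaken[OF e x] VarT)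
      (use w in simp_all)
  from eq_subst2[OF this u, of v v'] v show ?thesis by simp
qed

lemma action_parts:
  assumes n: "\<Gamma> \<turnstile> n \<^bold>: Nat" and X: "\<Gamma> \<turnstile> X \<^bold>: Univ i" and a: "\<Gamma> \<turnstile> a \<^bold>: X"
    and u: "\<Gamma> \<turnstile> u \<^bold>: hgroup i n X a"
  defines "L \<equiv> carrier i (Loops i (Succ Zero) X a)"
  shows "STr L # \<Gamma> \<turnstile> wk 1 (hgroup i n X a) \<^bold>: Univ i"
    and "L # \<Gamma> \<turnstile> App (transport (hgroup_fam i (wk 1 n) (wk 1 X)) (wk 1 a) (wk 1 a)
               (path_inv (wk 1 X) (wk 1 a) (wk 1 a) (Var 0))) (wk 1 u) \<^bold>:
                   (wk 1 (hgroup i n X a))\<langle>SIn (Var 0) \<cdot> sh 1\<rangle>"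
    and "STr L # \<Gamma> \<turnstile> STr_isSet (wk 1 (carrier i (Loops i n X a))) \<^bold>: isSet (wk 1 (hgroup i n X a))"
    and "\<Gamma> \<turnstile> L \<^bold>: Univ i"
proof -
  show L: "\<Gamma> \<turnstile> L \<^bold>: Univ i"
    unfolding L_def by (intro carrierF LoopsT NatIS NatI0 X a has_type_wf[OF X])
  note w = CtxCons[OF L] and s = CtxCons[OF STrF[OF L]]
  note e = wf_extends(1)[OF w] and f = wf_extends(1)[OF s]
  show "STr L # \<Gamma> \<turnstile> wk 1 (hgroup i n X a) \<^bold>: Univ i"
    using Univ_weaken[OF f hgroupF[OF n X a]] by simp
  have "STr L # \<Gamma> \<turnstile> carrier i (Loops i n\<Up> X\<Up> a\<Up>) \<^bold>: Univ i"
    using Univ_weaken[OF f carrierF[OF LoopsT[OF n X a]]] by simp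
  from STr_isSetT[OF this]
  show "STr L # \<Gamma> \<turnstile> STr_isSet (wk 1 (carrier i (Loops i n X a))) \<^bold>: isSet (wk 1 (hgroup i n X a))"
    by (simp add: hgroup_def)
  note n' = extends_weaken[OF e n, of Nat] and X' = Univ_weaken[OF e X]
    and a' = extends_weaken[OF e a refl]
  interpret F: family "L # \<Gamma>" i "X\<Up>" "hgroup i n\<Up>\<Up> X\<Up>\<Up> (Var 0)"
    by (rule hgroup_family[OF n' X']) simp
  have l: "L # \<Gamma> \<turnstile> Var 0 \<^bold>: Eql X\<Up> a\<Up> a\<Up>"
    by (rule Conv[OF VarT carrier_Loops_One[OF X' a']]) (simp_all add: w, simp add: L_def)
  have u': "L # \<Gamma> \<turnstile> u\<Up> \<^bold>: hgroup i n\<Up> X\<Up> a\<Up>"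
    by (rule extends_weaken[OF e u]) simp
  show "L # \<Gamma> \<turnstile> App (transport (hgroup_fam i (wk 1 n) (wk 1 X)) (wk 1 a) (wk 1 a)
               (path_inv (wk 1 X) (wk 1 a) (wk 1 a) (Var 0))) (wk 1 u) \<^bold>:
                   (wk 1 (hgroup i n X a))\<langle>SIn (Var 0) \<cdot> sh 1\<rangle>"
    using F.trT[OF a' a' F.invT[OF a' a' l]] u' by simp
qed

lemma actionT:
  assumes n: "\<Gamma> \<turnstile> n \<^bold>: Nat" and X: "\<Gamma> \<turnstile> X \<^bold>: Univ i" and a: "\<Gamma> \<turnstile> a \<^bold>: X"
    and u: "\<Gamma> \<turnstile> u \<^bold>: hgroup i n X a"
    and q: "\<Gamma> \<turnstile> q \<^bold>: hgroup i (Succ Zero) X a"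
  shows "\<Gamma> \<turnstile> action i n X a q u \<^bold>: hgroup i n X a"
  using STrE[OF action_parts(1-3)[OF n X a u] q[unfolded hgroup_def]] by (simp add: action_def)

lemma action_SIn:
  assumes n: "\<Gamma> \<turnstile> n \<^bold>: Nat" and X: "\<Gamma> \<turnstile> X \<^bold>: Univ i" and a: "\<Gamma> \<turnstile> a \<^bold>: X"
    and u: "\<Gamma> \<turnstile> u \<^bold>: hgroup i n X a"
    and l: "\<Gamma> \<turnstile> l \<^bold>: carrier i (Loops i (Succ Zero) X a)"
  shows "\<Gamma> \<turnstile> action i n X a (SIn l) u \<doteq>
    App (transport (hgroup_fam i n X) a a (path_inv X a a l)) u \<^bold>: hgroup i n X a"
  using STrBeta[OF action_parts(1-3)[OF n X a u] l] by (simp add: action_def)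

section \<open>The action and transport\<close>

locale hgroups =
  fixes \<Gamma> :: "tm list" and i :: nat and n X :: tm
  assumes n: "\<Gamma> \<turnstile> n \<^bold>: Nat" and X: "\<Gamma> \<turnstile> X \<^bold>: Univ i"
begin

sublocale family \<Gamma> i X "hgroup i n\<Up> X\<Up> (Var 0)"
  by (rule hgroup_family[OF n X])

abbreviation "\<pi> \<equiv> hgroup i n\<Up> X\<Up> (Var 0)"

lemma loopsF: "\<Gamma> \<turnstile> a \<^bold>: X \<Longrightarrow> \<Gamma> \<turnstile> carrier i (Loops i n X a) \<^bold>: Univ i"
  by (intro carrierF LoopsT n X)

lemma loopsF1: "\<Gamma> \<turnstile> a \<^bold>: X \<Longrightarrow> \<Gamma> \<turnstile> carrier i (Loops i (Succ Zero) X a) \<^bold>: Univ i"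
  by (intro carrierF LoopsT NatIS NatI0 has_type_wf[OF X] X)

end

lemma hgroups_weaken:
  assumes "hgroups \<Gamma> i n X" and e: "extends k \<Gamma> \<Delta>" and eq: "n' = n\<up>k" "X' = X\<up>k"
  shows "hgroups \<Delta> i n' X'"
proof -
  interpret hgroups \<Gamma> i n X by fact
  show ?thesis unfolding eq
    by unfold_locales (rule extends_weaken[OF e n], simp, rule Univ_weaken[OF e X])
qed

context hgroups
begin

text \<open>
  Induction on the truncated loop \<open>q\<close>. The motive is an equation in a set, so it is a proposition
  and therefore a set. For \<open>q = |l|\<^sub>0\<close> the action is transport along the inverse of \<open>l\<close>.
\<close>

lemma action_trivial:
  assumes triv: "inhabited \<Gamma> (trivial_transport X \<pi> a)" and a: "\<Gamma> \<turnstile> a \<^bold>: X"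
    and q: "\<Gamma> \<turnstile> q \<^bold>: hgroup i (Succ Zero) X a" and u: "\<Gamma> \<turnstile> u \<^bold>: hgroup i n X a"
  shows "inhabited \<Gamma> (Eql (hgroup i n X a) (action i n X a q u) u)"
proof -
  let ?L = "carrier i (Loops i (Succ Zero) X a)"
  note L = loopsF1[OF a]
  let ?G = "hgroup i n\<Up> X\<Up> a\<Up>"
  let ?C = "Eql ?G (action i n\<Up> X\<Up> a\<Up> (Var 0) u\<Up>) u\<Up>"
  note w = CtxCons[OF L] and s = CtxCons[OF STrF[OF L]]
  note e = wf_extends(1)[OF w] and f = wf_extends(1)[OF s]
  interpret S: hgroups "STr ?L # \<Gamma>" i "n\<Up>" "X\<Up>"
    by (rule hgroups_weaken[OF hgroups_axioms f]) simp_all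
  note sa = extends_weaken[OF f a refl]
  have su: "STr ?L # \<Gamma> \<turnstile> u\<Up> \<^bold>: ?G" by (rule extends_weaken[OF f u]) simp
  have sq: "STr ?L # \<Gamma> \<turnstile> Var 0 \<^bold>: hgroup i (Succ Zero) X\<Up> a\<Up>"
    by (rule VarT) (use s in \<open>simp_all add: hgroup_def\<close>)
  note act = actionT[OF S.n S.X sa su sq]
  have C: "STr ?L # \<Gamma> \<turnstile> ?C \<^bold>: Univ i" by (intro EqlF hgroupF S.n S.X sa act su)
  have "inhabited (STr ?L # \<Gamma>) (isProp ?C)"
    using isProp_Eql_STr[OF S.loopsF[OF sa]] act su unfolding hgroup_def by blast
  note h = isSet_of_isProp[OF C this]
  interpret E: hgroups "?L # \<Gamma>" i "n\<Up>" "X\<Up>"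
    by (rule hgroups_weaken[OF hgroups_axioms e]) simp_all
  note ea = extends_weaken[OF e a refl]
  have eu: "?L # \<Gamma> \<turnstile> u\<Up> \<^bold>: ?G" by (rule extends_weaken[OF e u]) simp
  have l: "?L # \<Gamma> \<turnstile> Var 0 \<^bold>: carrier i (Loops i (Succ Zero) X\<Up> a\<Up>)"
    by (rule VarT) (use w in simp_all)
  note l' = Conv[OF l carrier_Loops_One[OF E.X ea]]
  have "inhabited (?L # \<Gamma>) (trivial_transport X\<Up> E.\<pi> a\<Up>)"
    by (rule inhabited_weaken[OF triv e]) simp
  from E.trivial_transportE[OF this E.invT[OF ea ea l'], of "u\<Up>"] eu
  have "inhabited (?L # \<Gamma>) (Eql ?G (App (transport E.\<pi> a\<Up> a\<Up>
      (path_inv X\<Up> a\<Up> a\<Up> (Var 0))) u\<Up>) u\<Up>)"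
    by simp
  then have "inhabited (?L # \<Gamma>) (?C\<langle>SIn (Var 0) \<cdot> sh (Suc 0)\<rangle>)"
    using inhabited_Eql_conv[OF _ hgroupF[OF E.n E.X ea] EqSym[OF action_SIn[OF E.n E.X ea eu l]]
        EqRefl[OF eu]]
    by simp
  from inhabited_SInd[OF C this h q[unfolded hgroup_def]] show ?thesis by simp
qed

lemma trivial_action_parts:
  assumes a: "\<Gamma> \<turnstile> a \<^bold>: X"
  defines "\<Delta> \<equiv> hgroup i n\<Up> X\<Up> a\<Up> # hgroup i (Succ Zero) X a # \<Gamma>"
  shows "\<Gamma> \<turnstile> hgroup i (Succ Zero) X a \<^bold>: Univ i"
    and "hgroup i (Succ Zero) X a # \<Gamma> \<turnstile> hgroup i n\<Up> X\<Up> a\<Up> \<^bold>: Univ i"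
    and "extends 2 \<Gamma> \<Delta>" "hgroups \<Delta> i n\<up>2 X\<up>2" "\<Delta> \<turnstile> a\<up>2 \<^bold>: X\<up>2"
    and "\<Delta> \<turnstile> Var (Suc 0) \<^bold>: hgroup i (Succ Zero) X\<up>2 a\<up>2"
    and "\<Delta> \<turnstile> Var 0 \<^bold>: hgroup i n\<up>2 X\<up>2 a\<up>2"
proof -
  show G: "\<Gamma> \<turnstile> hgroup i (Succ Zero) X a \<^bold>: Univ i"
    by (intro hgroupF NatIS NatI0 has_type_wf[OF X] X a)
  note w1 = CtxCons[OF G] note e1 = wf_extends(1)[OF w1]
  show H: "hgroup i (Succ Zero) X a # \<Gamma> \<turnstile> hgroup i n\<Up> X\<Up> a\<Up> \<^bold>: Univ i"
    using Univ_weaken[OF e1 hgroupF[OF n X a]] by simp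
  note w2 = CtxCons[OF H, folded \<Delta>_def]
  show e2: "extends 2 \<Gamma> \<Delta>" using w2 unfolding \<Delta>_def by (rule wf_extends)
  show "hgroups \<Delta> i n\<up>2 X\<up>2" by (rule hgroups_weaken[OF hgroups_axioms e2]) simp_all
  show "\<Delta> \<turnstile> a\<up>2 \<^bold>: X\<up>2" by (rule extends_weaken[OF e2 a refl])
  show "\<Delta> \<turnstile> Var (Suc 0) \<^bold>: hgroup i (Succ Zero) X\<up>2 a\<up>2"
    "\<Delta> \<turnstile> Var 0 \<^bold>: hgroup i n\<up>2 X\<up>2 a\<up>2"
    by (rule VarT; use w2 in \<open>simp add: \<Delta>_def\<close>)+
qed

lemma trivial_actionF:
  assumes a: "\<Gamma> \<turnstile> a \<^bold>: X"
  shows "\<Gamma> \<turnstile> trivial_action i n X a \<^bold>: Univ i"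
proof -
  note t = trivial_action_parts[OF a]
  interpret D: hgroups "hgroup i n\<Up> X\<Up> a\<Up> # hgroup i (Succ Zero) X a # \<Gamma>"
    i "n\<up>2" "X\<up>2" by (rule t)
  show ?thesis
    using PiF[OF t(1) PiF[OF t(2) EqlF[OF hgroupF[OF D.n D.X t(5)] actionT[OF D.n
        D.X t(5,7,6)] t(7)]]]
    by (simp add: trivial_action_def)
qed

lemma trivial_action_of_transport:
  assumes a: "\<Gamma> \<turnstile> a \<^bold>: X" and triv: "inhabited \<Gamma> (trivial_transport X \<pi> a)"
  shows "inhabited \<Gamma> (trivial_action i n X a)"
proof -
  note t = trivial_action_parts[OF a]
  interpret D: hgroups "hgroup i n\<Up> X\<Up> a\<Up> # hgroup i (Succ Zero) X a # \<Gamma>"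
    i "n\<up>2" "X\<up>2" by (rule t)
  have "inhabited (hgroup i n\<Up> X\<Up> a\<Up> # hgroup i (Succ Zero) X a # \<Gamma>)
      (trivial_transport X\<up>2 D.\<pi> a\<up>2)"
    by (rule inhabited_weaken[OF triv t(3)]) simp
  from inhabited_Pi[OF t(1) inhabited_Pi[OF t(2) D.action_trivial[OF this t(5-7)]]]
  show ?thesis by (simp add: trivial_action_def)
qed

text \<open>
  The action of \<open>|l|\<^sub>0\<close> is transport along \<open>l\<inverse>\<close>; if that fixes \<open>u\<close>, then so does transport along
  \<open>l\<close>.
\<close>

lemma transport_of_trivial_action:
  assumes a: "\<Gamma> \<turnstile> a \<^bold>: X" and triv: "inhabited \<Gamma> (trivial_action i n X a)"
  shows "inhabited \<Gamma> (trivial_transport X \<pi> a)"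
proof -
  note t = trivial_transport_parts[OF a a]
  let ?\<Delta> = "\<pi>\<langle>a\<Up> \<cdot> sh (Suc 0)\<rangle> # Eql X a a # \<Gamma>"
  interpret D: hgroups ?\<Delta> i "n\<up>2" "X\<up>2"
    by (rule hgroups_weaken[OF hgroups_axioms t(2)]) simp_all
  have u: "?\<Delta> \<turnstile> Var 0 \<^bold>: hgroup i n\<up>2 X\<up>2 a\<up>2" using t(6) by simp
  note l = Conv[OF t(5) EqSym[OF carrier_Loops_One[OF D.X t(3)]]]
  have q: "?\<Delta> \<turnstile> SIn (Var (Suc 0)) \<^bold>: hgroup i (Succ Zero) X\<up>2 a\<up>2"
    using STrI[OF l] by (simp add: hgroup_def)
  have "inhabited ?\<Delta> (trivial_action i n\<up>2 X\<up>2 a\<up>2)"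
    by (rule inhabited_weaken[OF triv t(2)]) (simp add: trivial_action_def)
  from inhabited_app[OF inhabited_app[OF this[unfolded trivial_action_def] q refl, simplified]
      u[simplified]]
  have "inhabited ?\<Delta> (Eql (hgroup i n\<up>2 X\<up>2 a\<up>2)
      (action i n\<up>2 X\<up>2 a\<up>2 (SIn (Var (Suc 0))) (Var 0)) (Var 0))" by simp
  from inhabited_Eql_conv[OF this hgroupF[OF D.n D.X t(3)] action_SIn[OF D.n
      D.X t(3) u l] EqRefl[OF u]]
  have "inhabited ?\<Delta> (Eql (D.\<pi>\<langle>a\<up>2 \<cdot> Var\<rangle>) (App (transport D.\<pi> a\<up>2 a\<up>2
      (path_inv X\<up>2 a\<up>2 a\<up>2 (Var (Suc 0)))) (Var 0)) (Var 0))"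
    by simp
  from D.tr_eq[OF t(3,3,5) _ _ this] u
  have "inhabited ?\<Delta> (Eql (D.\<pi>\<langle>a\<up>2 \<cdot> Var\<rangle>) (App (transport D.\<pi> a\<up>2 a\<up>2 (Var (Suc 0)))
      (Var 0)) (Var 0))"
    by simp
  then show ?thesis
    using inhabited_Pi[OF t(7) inhabited_Pi[OF t(8)]] by (simp add: trivial_transport_def)
qed

end

section \<open>Canonical isomorphisms\<close>

text \<open>
  The conditions on the underlying function of a canonical isomorphism, with that function as a
  parameter instead of a bound variable or a projection.
\<close>

definition canonical :: "nat \<Rightarrow> tm \<Rightarrow> tm \<Rightarrow> tm \<Rightarrow> tm \<Rightarrow> tm \<Rightarrow> tm" where
  "canonical i n X a b f = Pi (Eql X a b)
    (Eql (Arr (hgroup i n\<Up> X\<Up> a\<Up>)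
        (hgroup i n\<Up> X\<Up> b\<Up>))
      f\<Up>
      (transport (hgroup i n\<up>2 X\<up>2 (Var 0)) a\<Up> b\<Up> (Var 0)))"

definition preserves_mult :: "nat \<Rightarrow> tm \<Rightarrow> tm \<Rightarrow> tm \<Rightarrow> tm \<Rightarrow> tm \<Rightarrow> tm" where
  "preserves_mult i m X a b f =
    Pi (hgroup i (Succ m) X a) (Pi (hgroup i (Succ m\<Up>) X\<Up> a\<Up>)
      (Eql (hgroup i (Succ m\<up>2) X\<up>2 b\<up>2)
        (App f\<up>2 (hgroup_mult i m\<up>2 X\<up>2 a\<up>2 (Var (Suc 0)) (Var 0)))
        (hgroup_mult i m\<up>2 X\<up>2 b\<up>2 (App f\<up>2 (Var (Suc 0))) (App f\<up>2 (Var 0)))))"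

lemma subst_canonical [simp]:
  "(canonical i n X a b f)\<langle>\<sigma>\<rangle> = canonical i (n\<langle>\<sigma>\<rangle>) (X\<langle>\<sigma>\<rangle>) (a\<langle>\<sigma>\<rangle>) (b\<langle>\<sigma>\<rangle>) (f\<langle>\<sigma>\<rangle>)"
  "(preserves_mult i m X a b f)\<langle>\<sigma>\<rangle> = preserves_mult i (m\<langle>\<sigma>\<rangle>) (X\<langle>\<sigma>\<rangle>) (a\<langle>\<sigma>\<rangle>) (b\<langle>\<sigma>\<rangle>) (f\<langle>\<sigma>\<rangle>)"
  by (simp_all add: canonical_def preserves_mult_def)

lemma hgroup_iso_eq:
  "hgroup_iso i m X a b = Sig (Arr (hgroup i (Succ m) X a) (hgroup i (Succ m) X b))
     (Prod (isEquiv (hgroup i (Succ m\<Up>) X\<Up> a\<Up>)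
         (hgroup i (Succ m\<Up>) X\<Up> b\<Up>) (Var 0))
       (preserves_mult i m\<Up> X\<Up> a\<Up> b\<Up> (Var 0)))"
  by (simp add: hgroup_iso_def preserves_mult_def Let_def)

lemma canonical_iso_eq:
  "canonical_iso i m X a b = Sig (hgroup_iso i m X a b)
     (canonical i (Succ m\<Up>) X\<Up> a\<Up> b\<Up>
       (proj1 (Arr (hgroup i (Succ m\<Up>) X\<Up> a\<Up>)
         (hgroup i (Succ m\<Up>) X\<Up> b\<Up>)) (Var 0)))"
  by (simp add: canonical_iso_def canonical_def Let_def)

context hgroups
begin

lemma groupF: "\<Gamma> \<turnstile> a \<^bold>: X \<Longrightarrow> \<Gamma> \<turnstile> hgroup i n X a \<^bold>: Univ i"
  by (rule hgroupF[OF n X])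

lemma transportArr: "\<Gamma> \<turnstile> a \<^bold>: X \<Longrightarrow> \<Gamma> \<turnstile> b \<^bold>: X \<Longrightarrow> \<Gamma> \<turnstile> p \<^bold>: Eql X a b \<Longrightarrow>
    \<Gamma> \<turnstile> transport \<pi> a b p \<^bold>: Arr (hgroup i n X a) (hgroup i n X b)"
  using transportT[OF X P, of a b p] by simp

lemma canonicalF:
  assumes a: "\<Gamma> \<turnstile> a \<^bold>: X" and b: "\<Gamma> \<turnstile> b \<^bold>: X" and f: "\<Gamma> \<turnstile> f \<^bold>: Arr (hgroup i n X a) (hgroup i n X b)"
  shows "\<Gamma> \<turnstile> canonical i n X a b f \<^bold>: Univ i"
proof -
  have E: "\<Gamma> \<turnstile> Eql X a b \<^bold>: Univ i" by (rule EqlF[OF X a b])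
  note w = CtxCons[OF E] note e = wf_extends(1)[OF w]
  interpret E: hgroups "Eql X a b # \<Gamma>" i "n\<Up>" "X\<Up>"
    by (rule hgroups_weaken[OF hgroups_axioms e]) simp_all
  note a1 = extends_weaken[OF e a refl] and b1 = extends_weaken[OF e b refl]
  have v: "Eql X a b # \<Gamma> \<turnstile> Var 0 \<^bold>: Eql X\<Up> a\<Up> b\<Up>"
    by (rule VarT) (simp_all add: w)
  show ?thesis
    unfolding canonical_def
    using E.transportArr[OF a1 b1 v] extends_weaken[OF e f, of "Arr (hgroup i n\<Up> X\<Up> a\<Up>)
        (hgroup i n\<Up> X\<Up> b\<Up>)"]
    by (intro PiF E EqlF ArrF E.groupF a1 b1) simp_all
qed

lemma canonicalE:
  assumes "inhabited \<Gamma> (canonical i n X a b f)" "\<Gamma> \<turnstile> p \<^bold>: Eql X a b"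
  shows "inhabited \<Gamma> (Eql (Arr (hgroup i n X a) (hgroup i n X b)) f (transport \<pi> a b p))"
  by (rule inhabited_app[OF assms(1)[unfolded canonical_def] assms(2)]) simp

lemma canonical_app:
  assumes h: "inhabited \<Gamma> (canonical i n X a b f)" and a: "\<Gamma> \<turnstile> a \<^bold>: X" and b: "\<Gamma> \<turnstile> b \<^bold>: X"
    and f: "\<Gamma> \<turnstile> f \<^bold>: Arr (hgroup i n X a) (hgroup i n X b)" and p: "\<Gamma> \<turnstile> p \<^bold>: Eql X a b"
    and u: "\<Gamma> \<turnstile> u \<^bold>: hgroup i n X a"
  shows "inhabited \<Gamma> (Eql (hgroup i n X b) (App f u) (App (transport \<pi> a b p) u))"
proof (rule inhabited_happly[OF canonicalE[OF h p, unfolded Arr_def]])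
  show "\<Gamma> \<turnstile> hgroup i n X a \<^bold>: Univ i" by (rule groupF[OF a])
  show "hgroup i n X a # \<Gamma> \<turnstile> wk 1 (hgroup i n X b) \<^bold>: Univ i"
    using Univ_weaken[OF wf_extends(1)[OF CtxCons[OF groupF[OF a]]] groupF[OF b]] by simp
qed (use f transportArr[OF a b p] u in \<open>simp_all add: Arr_def\<close>)

lemma same_transport_of_canonical:
  assumes h: "inhabited \<Gamma> (canonical i n X a b f)" and a: "\<Gamma> \<turnstile> a \<^bold>: X" and b: "\<Gamma> \<turnstile> b \<^bold>: X"
    and f: "\<Gamma> \<turnstile> f \<^bold>: Arr (hgroup i n X a) (hgroup i n X b)" and p: "\<Gamma> \<turnstile> p \<^bold>: Eql X a b"
  shows "inhabited \<Gamma> (same_transport X \<pi> a b p)"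
proof -
  note t = trivial_transport_parts[OF a b]
  let ?\<Delta> = "\<pi>\<langle>a\<Up> \<cdot> sh (Suc 0)\<rangle> # Eql X a b # \<Gamma>"
  interpret D: hgroups ?\<Delta> i "n\<up>2" "X\<up>2"
    by (rule hgroups_weaken[OF hgroups_axioms t(2)]) simp_all
  have h2: "inhabited ?\<Delta> (canonical i n\<up>2 X\<up>2 a\<up>2 b\<up>2 f\<up>2)"
    by (rule inhabited_weaken[OF h t(2)]) simp
  have f2: "?\<Delta> \<turnstile> f\<up>2 \<^bold>: Arr (hgroup i n\<up>2 X\<up>2 a\<up>2) (hgroup i n\<up>2 X\<up>2 b\<up>2)"
    by (rule extends_weaken[OF t(2) f]) simp
  have p2: "?\<Delta> \<turnstile> p\<up>2 \<^bold>: Eql X\<up>2 a\<up>2 b\<up>2"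
    by (rule extends_weaken[OF t(2) p]) simp
  have u: "?\<Delta> \<turnstile> Var 0 \<^bold>: hgroup i n\<up>2 X\<up>2 a\<up>2" using t(6) by simp
  note e1 = D.canonical_app[OF h2 t(3,4) f2 p2 u] and e2 = D.canonical_app[OF h2 t(3,4) f2 t(5) u]
  note G = D.groupF[OF t(4)] and fu = ArrE[OF f2 u]
  note t1 = ArrE[OF D.transportArr[OF t(3,4) p2] u] and t2 = ArrE[OF D.transportArr[OF t(3,4,5)] u]
  from inhabited_trans[OF inhabited_sym[OF e1 G fu t1] e2 G t1 fu t2]
  show ?thesis
    using inhabited_Pi[OF t(7) inhabited_Pi[OF t(8)]] by (simp add: same_transport_def)
qed

text \<open>
  The equations to be proved lie in a set, so the merely inhabited type \<open>a = b\<close> may be assumed to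
  have an element \<open>p\<close>; then all transports from \<open>a\<close> to \<open>b\<close> agree with the one along \<open>p\<close>.
\<close>

lemma trivial_transport_of_canonical:
  assumes h: "inhabited \<Gamma> (canonical i n X a b f)" and a: "\<Gamma> \<turnstile> a \<^bold>: X" and b: "\<Gamma> \<turnstile> b \<^bold>: X"
    and f: "\<Gamma> \<turnstile> f \<^bold>: Arr (hgroup i n X a) (hgroup i n X b)" and t: "inhabited \<Gamma> (PTr (Eql X a b))"
  shows "inhabited \<Gamma> (trivial_transport X \<pi> a)"
proof -
  note c = trivial_transport_parts[OF a a]
  let ?\<Delta> = "\<pi>\<langle>a\<Up> \<cdot> sh (Suc 0)\<rangle> # Eql X a a # \<Gamma>"
  interpret D: hgroups ?\<Delta> i "n\<up>2" "X\<up>2"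
    by (rule hgroups_weaken[OF hgroups_axioms c(2)]) simp_all
  have b2: "?\<Delta> \<turnstile> b\<up>2 \<^bold>: X\<up>2" by (rule extends_weaken[OF c(2) b refl])
  note E = EqlF[OF D.X c(3) b2]
  note w = CtxCons[OF E]
  let ?\<Theta> = "Eql X\<up>2 a\<up>2 b\<up>2 # ?\<Delta>"
  have e: "extends 3 \<Gamma> ?\<Theta>" by (rule wf_extends(3)[OF w])
  interpret E: hgroups ?\<Theta> i "n\<up>3" "X\<up>3"
    by (rule hgroups_weaken[OF hgroups_axioms e]) simp_all
  note a3 = extends_weaken[OF e a refl] and b3 = extends_weaken[OF e b refl]
  have f3: "?\<Theta> \<turnstile> f\<up>3 \<^bold>: Arr (hgroup i n\<up>3 X\<up>3 a\<up>3) (hgroup i n\<up>3 X\<up>3 b\<up>3)"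
    by (rule extends_weaken[OF e f]) simp
  have h3: "inhabited ?\<Theta> (canonical i n\<up>3 X\<up>3 a\<up>3 b\<up>3 f\<up>3)"
    by (rule inhabited_weaken[OF h e]) simp
  have v: "?\<Theta> \<turnstile> Var 0 \<^bold>: Eql X\<up>3 a\<up>3 b\<up>3" "?\<Theta> \<turnstile> Var 2 \<^bold>: Eql X\<up>3 a\<up>3 a\<up>3"
    "?\<Theta> \<turnstile> Var (Suc 0) \<^bold>: E.\<pi>\<langle>a\<up>3 \<cdot> Var\<rangle>"
    by (rule VarT; use w in simp)+
  have triv: "inhabited ?\<Theta> (trivial_transport X\<up>3 E.\<pi> a\<up>3)"
    by (rule inhabited_app_Arr[OF E.trivial_same(1)[OF a3 b3 v(1)]
        E.same_transport_of_canonical[OF h3 a3 b3 f3 v(1)]])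
  note eq = E.trivial_transportE[OF triv v(2,3)]
  have u: "?\<Delta> \<turnstile> Var 0 \<^bold>: STr (carrier i (Loops i n\<up>2 X\<up>2 a\<up>2))" using c(6) by (simp add: hgroup_def)
  have l: "?\<Delta> \<turnstile> App (transport D.\<pi> a\<up>2 a\<up>2 (Var (Suc 0))) (Var 0) \<^bold>:
      STr (carrier i (Loops i n\<up>2 X\<up>2 a\<up>2))"
    using ArrE[OF D.transportArr[OF c(3,3,5)], of "Var 0"] u by (simp add: hgroup_def)
  have t2: "inhabited ?\<Delta> (PTr (Eql X\<up>2 a\<up>2 b\<up>2))" by (rule inhabited_weaken[OF t c(2)]) simp
  have "inhabited ?\<Delta> (Eql (STr (carrier i (Loops i n\<up>2 X\<up>2 a\<up>2)))
      (App (transport D.\<pi> a\<up>2 a\<up>2 (Var (Suc 0))) (Var 0)) (Var 0))"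
    by (rule inhabited_Eql_STr_PTr[OF D.loopsF[OF c(3)] l u E _ t2]) (use eq
        in \<open>simp add: hgroup_def\<close>)
  then show ?thesis
    using inhabited_Pi[OF c(7) inhabited_Pi[OF c(8)]] by (simp add: trivial_transport_def hgroup_def)
qed

end

section \<open>Isomorphisms of homotopy groups\<close>

locale homotopy_groups =
  fixes \<Gamma> :: "tm list" and i :: nat and m X :: tm
  assumes m: "\<Gamma> \<turnstile> m \<^bold>: Nat" and X': "\<Gamma> \<turnstile> X \<^bold>: Univ i"
begin

sublocale hgroups \<Gamma> i "Succ m" X
  by unfold_locales (rule NatIS[OF m], rule X')

abbreviation "G a \<equiv> hgroup i (Succ m) X a"

end

lemma homotopy_groups_weaken:
  assumes "homotopy_groups \<Gamma> i m X" and e: "extends k \<Gamma> \<Delta>" and eq: "m' = m\<up>k" "X' = X\<up>k"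
  shows "homotopy_groups \<Delta> i m' X'"
proof -
  interpret homotopy_groups \<Gamma> i m X by fact
  show ?thesis unfolding eq
    by unfold_locales (rule extends_weaken[OF e m], simp, rule Univ_weaken[OF e X])
qed

context homotopy_groups
begin

lemma two_elements:
  assumes a: "\<Gamma> \<turnstile> a \<^bold>: X"
  defines "\<Delta> \<equiv> (G a)\<Up> # G a # \<Gamma>"
  shows "\<Gamma> \<turnstile> G a \<^bold>: Univ i" "G a # \<Gamma> \<turnstile> (G a)\<Up> \<^bold>: Univ i"
    and "extends 2 \<Gamma> \<Delta>" "homotopy_groups \<Delta> i m\<up>2 X\<up>2" "\<Delta> \<turnstile> a\<up>2 \<^bold>: X\<up>2"
    and "\<Delta> \<turnstile> Var (Suc 0) \<^bold>: hgroup i (Succ m\<up>2) X\<up>2 a\<up>2"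
    and "\<Delta> \<turnstile> Var 0 \<^bold>: hgroup i (Succ m\<up>2) X\<up>2 a\<up>2"
proof -
  show G: "\<Gamma> \<turnstile> G a \<^bold>: Univ i" by (rule groupF[OF a])
  note w = wf_J[OF G]
  show "G a # \<Gamma> \<turnstile> (G a)\<Up> \<^bold>: Univ i" by (rule Univ_weaken[OF wf_extends(1)[OF w(3)] G])
  note w2 = w(2)[folded \<Delta>_def]
  show e2: "extends 2 \<Gamma> \<Delta>" using w2 unfolding \<Delta>_def by (rule wf_extends)
  show "homotopy_groups \<Delta> i m\<up>2 X\<up>2" by (rule homotopy_groups_weaken[OF
      homotopy_groups_axioms e2]) simp_all
  show "\<Delta> \<turnstile> a\<up>2 \<^bold>: X\<up>2" by (rule extends_weaken[OF e2 a refl])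
  show "\<Delta> \<turnstile> Var (Suc 0) \<^bold>: hgroup i (Succ m\<up>2) X\<up>2 a\<up>2"
    "\<Delta> \<turnstile> Var 0 \<^bold>: hgroup i (Succ m\<up>2) X\<up>2 a\<up>2"
    by (rule VarT; use w2 in \<open>simp add: \<Delta>_def\<close>)+
qed

lemma mult: "\<Gamma> \<turnstile> a \<^bold>: X \<Longrightarrow> \<Gamma> \<turnstile> u \<^bold>: G a \<Longrightarrow> \<Gamma> \<turnstile> v \<^bold>: G a \<Longrightarrow> \<Gamma> \<turnstile> hgroup_mult i m X a u v \<^bold>: G a"
  by (rule hgroup_multT[OF m X])

lemma preserves_multF:
  assumes a: "\<Gamma> \<turnstile> a \<^bold>: X" and b: "\<Gamma> \<turnstile> b \<^bold>: X" and f: "\<Gamma> \<turnstile> f \<^bold>: Arr (G a) (G b)"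
  shows "\<Gamma> \<turnstile> preserves_mult i m X a b f \<^bold>: Univ i"
proof -
  note t = two_elements[OF a]
  interpret D: homotopy_groups "(G a)\<Up> # G a # \<Gamma>" i "m\<up>2" "X\<up>2" by (rule t)
  note b2 = extends_weaken[OF t(3) b refl]
  have f2: "(G a)\<Up> # G a # \<Gamma> \<turnstile> f\<up>2 \<^bold>: Arr (D.G a\<up>2) (D.G b\<up>2)"
    by (rule extends_weaken[OF t(3) f]) simp
  show ?thesis
    using PiF[OF t(1) PiF[OF t(2) EqlF[OF D.groupF[OF b2] ArrE[OF f2 D.mult[OF t(5,6,7)]]
      D.mult[OF b2 ArrE[OF f2 t(6)] ArrE[OF f2 t(7)]]]]]
    by (simp add: preserves_mult_def)
qed

lemma preserves_multE:
  assumes "inhabited \<Gamma> (preserves_mult i m X a b f)" and u: "\<Gamma> \<turnstile> u \<^bold>: G a" and v: "\<Gamma> \<turnstile> v \<^bold>: G a"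
  shows "inhabited \<Gamma> (Eql (G b) (App f (hgroup_mult i m X a u v)) (hgroup_mult i m X b
      (App f u) (App f v)))"
  by (rule inhabited_app[OF inhabited_app[OF assms(1)[unfolded preserves_mult_def] u refl,
      simplified] v]) simp

lemma preserves_mult_refl:
  assumes a: "\<Gamma> \<turnstile> a \<^bold>: X"
  shows "inhabited \<Gamma> (preserves_mult i m X a a (transport \<pi> a a (Refl a)))"
proof -
  note t = two_elements[OF a]
  let ?\<Delta> = "(G a)\<Up> # G a # \<Gamma>"
  interpret D: homotopy_groups ?\<Delta> i "m\<up>2" "X\<up>2" by (rule t)
  let ?a = "a\<up>2" let ?id = "transport D.\<pi> ?a ?a (Refl ?a)"
  have id: "?\<Delta> \<turnstile> App ?id u \<doteq> u \<^bold>: D.G ?a" if "?\<Delta> \<turnstile> u \<^bold>: D.G ?a" for u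
    using D.tr_refl[OF t(5), of u] that by simp
  note uv = D.mult[OF t(5-7)]
  have "inhabited ?\<Delta> (Eql (D.G ?a) (App ?id (hgroup_mult i m\<up>2 X\<up>2 ?a (Var (Suc 0)) (Var 0)))
      (hgroup_mult i m\<up>2 X\<up>2 ?a (App ?id (Var (Suc 0))) (App ?id (Var 0))))"
    by (rule inhabited_Eql_conv[OF inhabitedI[OF EqlI[OF uv]] D.groupF[OF t(5)] EqSym[OF id[OF uv]]
      hgroup_mult_cong[OF D.m D.X t(5) EqSym[OF id[OF t(6)]] EqSym[OF id[OF t(7)]]]])
  then show ?thesis
    using inhabited_Pi[OF t(1) inhabited_Pi[OF t(2)]] by (simp add: preserves_mult_def)
qed

text \<open>
  By path induction from the case of \<open>refl\<close>, where transport is judgementally the identity on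
  every element.
\<close>

lemma preserves_mult_transport:
  assumes a: "\<Gamma> \<turnstile> a \<^bold>: X" and b: "\<Gamma> \<turnstile> b \<^bold>: X" and p: "\<Gamma> \<turnstile> p \<^bold>: Eql X a b"
  shows "inhabited \<Gamma> (preserves_mult i m X a b (transport \<pi> a b p))"
proof -
  let ?\<Delta> = "Eql X\<up>2 (Var (Suc 0)) (Var 0) # X\<Up> # X # \<Gamma>"
  note w = wf_J[OF X]
  interpret D: homotopy_groups ?\<Delta> i "m\<up>3" "X\<up>3"
    by (rule homotopy_groups_weaken[OF homotopy_groups_axioms wf_extends(3)[OF w(1)]]) simp_all
  interpret E: homotopy_groups "X # \<Gamma>" i "m\<Up>" "X\<Up>"
    by (rule homotopy_groups_weaken[OF homotopy_groups_axioms wf_extends(1)[OF w(3)]]) simp_all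
  show ?thesis
    by (rule inhabited_J[OF D.preserves_multF[OF path_ctx(3,4)
        D.transportArr[OF path_ctx(3-5)]] _ a b p])
      (use E.preserves_mult_refl[OF point_ctx(3)] in simp_all)
qed

lemma preserves_mult_eq:
  assumes a: "\<Gamma> \<turnstile> a \<^bold>: X" and b: "\<Gamma> \<turnstile> b \<^bold>: X" and f: "\<Gamma> \<turnstile> f \<^bold>: Arr (G a) (G b)"
    and g: "\<Gamma> \<turnstile> g \<^bold>: Arr (G a) (G b)"
    and eq: "inhabited \<Gamma> (Eql (Arr (G a) (G b)) f g)"
    and h: "inhabited \<Gamma> (preserves_mult i m X a b f)"
  shows "inhabited \<Gamma> (preserves_mult i m X a b g)"
proof -
  note F = ArrF[OF groupF[OF a] groupF[OF b]]
  note w = CtxCons[OF F] note e = wf_extends(1)[OF w]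
  interpret E: homotopy_groups "Arr (G a) (G b) # \<Gamma>" i "m\<Up>" "X\<Up>"
    by (rule homotopy_groups_weaken[OF homotopy_groups_axioms e]) simp_all
  have v: "Arr (G a) (G b) # \<Gamma> \<turnstile> Var 0 \<^bold>: Arr (E.G a\<Up>) (E.G b\<Up>)"
    by (rule VarT) (simp_all add: w)
  show ?thesis
    by (rule inhabited_transport[OF eq F E.preserves_multF[OF extends_weaken[OF e a refl]
        extends_weaken[OF e b refl] v] f g])
      (simp_all add: h)
qed

lemma hgroup_iso_parts:
  assumes a: "\<Gamma> \<turnstile> a \<^bold>: X" and b: "\<Gamma> \<turnstile> b \<^bold>: X"
  defines "F \<equiv> Arr (G a) (G b)"
  shows "\<Gamma> \<turnstile> F \<^bold>: Univ i"
    and "F # \<Gamma> \<turnstile> Prod (isEquiv (hgroup i (Succ m\<Up>) X\<Up> a\<Up>)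
         (hgroup i (Succ m\<Up>) X\<Up> b\<Up>) (Var 0))
       (preserves_mult i m\<Up> X\<Up> a\<Up> b\<Up> (Var 0)) \<^bold>: Univ i"
    and "\<Gamma> \<turnstile> hgroup_iso i m X a b \<^bold>: Univ i"
proof -
  show F: "\<Gamma> \<turnstile> F \<^bold>: Univ i" unfolding F_def by (rule ArrF[OF groupF[OF a] groupF[OF b]])
  note w = CtxCons[OF F] note e = wf_extends(1)[OF w]
  interpret E: homotopy_groups "F # \<Gamma>" i "m\<Up>" "X\<Up>"
    by (rule homotopy_groups_weaken[OF homotopy_groups_axioms e]) simp_all
  note a1 = extends_weaken[OF e a refl] and b1 = extends_weaken[OF e b refl]
  have v: "F # \<Gamma> \<turnstile> Var 0 \<^bold>: Arr (E.G a\<Up>) (E.G b\<Up>)"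
    by (rule VarT) (simp_all add: w, simp add: F_def)
  show prod: "F # \<Gamma> \<turnstile> Prod (isEquiv (E.G a\<Up>) (E.G b\<Up>) (Var 0))
       (preserves_mult i m\<Up> X\<Up> a\<Up> b\<Up> (Var 0)) \<^bold>: Univ i"
    by (rule ProdF[OF isEquivF[OF E.groupF[OF a1] E.groupF[OF b1] v] E.preserves_multF[OF a1 b1 v]])
  show "\<Gamma> \<turnstile> hgroup_iso i m X a b \<^bold>: Univ i"
    unfolding hgroup_iso_eq by (rule SigF[OF F[unfolded F_def] prod[unfolded F_def]])
qed

lemma hgroup_iso_fun:
  assumes a: "\<Gamma> \<turnstile> a \<^bold>: X" and b: "\<Gamma> \<turnstile> b \<^bold>: X" and \<phi>: "\<Gamma> \<turnstile> \<phi> \<^bold>: hgroup_iso i m X a b"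
  shows "\<Gamma> \<turnstile> proj1 (Arr (G a) (G b)) \<phi> \<^bold>: Arr (G a) (G b)"
  by (rule proj1T[OF hgroup_iso_parts(1,2)[OF a b] \<phi>[unfolded hgroup_iso_eq]])

end

lemma subst_isos [simp]:
  "(hgroup_iso i m X a b)\<langle>\<sigma>\<rangle> = hgroup_iso i (m\<langle>\<sigma>\<rangle>) (X\<langle>\<sigma>\<rangle>) (a\<langle>\<sigma>\<rangle>) (b\<langle>\<sigma>\<rangle>)"
  "(canonical_iso i m X a b)\<langle>\<sigma>\<rangle> = canonical_iso i (m\<langle>\<sigma>\<rangle>) (X\<langle>\<sigma>\<rangle>) (a\<langle>\<sigma>\<rangle>) (b\<langle>\<sigma>\<rangle>)"
  "(trivial_action i n X a)\<langle>\<sigma>\<rangle> = trivial_action i (n\<langle>\<sigma>\<rangle>) (X\<langle>\<sigma>\<rangle>) (a\<langle>\<sigma>\<rangle>)"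
  by (simp_all add: hgroup_iso_def canonical_iso_def trivial_action_def Let_def)

context homotopy_groups
begin

lemma canonical_iso_part:
  assumes a: "\<Gamma> \<turnstile> a \<^bold>: X" and b: "\<Gamma> \<turnstile> b \<^bold>: X"
  shows "hgroup_iso i m X a b # \<Gamma> \<turnstile> canonical i (Succ m\<Up>) X\<Up> a\<Up> b\<Up>
       (proj1 (Arr (hgroup i (Succ m\<Up>) X\<Up> a\<Up>)
         (hgroup i (Succ m\<Up>) X\<Up> b\<Up>)) (Var 0)) \<^bold>: Univ i"
proof -
  note w = CtxCons[OF hgroup_iso_parts(3)[OF a b]] note e = wf_extends(1)[OF w]
  interpret I: homotopy_groups "hgroup_iso i m X a b # \<Gamma>" i "m\<Up>" "X\<Up>"
    by (rule homotopy_groups_weaken[OF homotopy_groups_axioms e]) simp_all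
  note a1 = extends_weaken[OF e a refl] and b1 = extends_weaken[OF e b refl]
  show ?thesis
    by (rule I.canonicalF[OF a1 b1 I.hgroup_iso_fun[OF a1 b1 VarT]]) (simp_all add: w)
qed

lemma canonical_isoF:
  assumes a: "\<Gamma> \<turnstile> a \<^bold>: X" and b: "\<Gamma> \<turnstile> b \<^bold>: X"
  shows "\<Gamma> \<turnstile> canonical_iso i m X a b \<^bold>: Univ i"
  unfolding canonical_iso_eq by (rule SigF[OF hgroup_iso_parts(3) canonical_iso_part]) fact+

lemma trivial_action_of_canonical_iso:
  assumes a: "\<Gamma> \<turnstile> a \<^bold>: X" and b: "\<Gamma> \<turnstile> b \<^bold>: X" and t: "inhabited \<Gamma> (PTr (Eql X a b))"
    and iso: "inhabited \<Gamma> (canonical_iso i m X a b)"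
  shows "inhabited \<Gamma> (trivial_action i (Succ m) X a)"
proof -
  obtain d where d: "\<Gamma> \<turnstile> d \<^bold>: canonical_iso i m X a b" using iso by (auto simp: inhabited_def)
  note I = hgroup_iso_parts(3)[OF a b] and C = canonical_iso_part[OF a b]
  note p1 = proj1T[OF I C d[unfolded canonical_iso_eq]]
    and p2 = proj2T[OF I C d[unfolded canonical_iso_eq] refl]
  have "inhabited \<Gamma> (canonical i (Succ m) X a b (proj1 (Arr (G a) (G b)) (proj1
      (hgroup_iso i m X a b) d)))"
    using inhabitedI[OF p2] by simp
  from trivial_transport_of_canonical[OF this a b hgroup_iso_fun[OF a b p1] t]
  show ?thesis by (rule trivial_action_of_transport[OF a])
qed

text \<open>
  Both conditions are judgements over the hypotheses \<open>u : G a\<close> (or \<open>v : G b\<close>) and \<open>p : a = b\<close>, so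
  that they can be instantiated in any extension of the context.
\<close>

abbreviation agrees_with_transport :: "tm \<Rightarrow> tm \<Rightarrow> tm \<Rightarrow> bool" where
  "agrees_with_transport a b f \<equiv> inhabited (Eql X\<Up> a\<Up> b\<Up> # G a # \<Gamma>)
      (Eql ((G b)\<up>2) (App f\<up>2 (Var (Suc 0)))
        (App (transport (\<pi>\<langle>Var 0 \<cdot> sh 3\<rangle>) a\<up>2 b\<up>2 (Var 0)) (Var (Suc 0))))"

abbreviation agrees_with_inverse :: "tm \<Rightarrow> tm \<Rightarrow> tm \<Rightarrow> bool" where
  "agrees_with_inverse a b g \<equiv> inhabited (Eql X\<Up> a\<Up> b\<Up> # G b # \<Gamma>)
      (Eql ((G a)\<up>2) (App g\<up>2 (Var (Suc 0)))
        (App (transport (\<pi>\<langle>Var 0 \<cdot> sh 3\<rangle>) b\<up>2 a\<up>2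
          (path_inv X\<up>2 a\<up>2 b\<up>2 (Var 0))) (Var (Suc 0))))"

lemma transport_factors:
  assumes a: "\<Gamma> \<turnstile> a \<^bold>: X" and b: "\<Gamma> \<turnstile> b \<^bold>: X" and t: "inhabited \<Gamma> (PTr (Eql X a b))"
    and triv: "inhabited \<Gamma> (trivial_transport X \<pi> a)"
  obtains f where "\<Gamma> \<turnstile> f \<^bold>: Arr (G a) (G b)"
    "agrees_with_transport a b f"
proof -
  let ?T = "Eql X a b"
  note T = EqlF[OF X a b] and A = groupF[OF a] and L = loopsF[OF b]
  note w1 = CtxCons[OF A] note e1 = wf_extends(1)[OF w1]
  note w2 = CtxCons[OF Univ_weaken[OF e1 T]] note e2 = wf_extends(2)[OF w2]
  note w3 = CtxCons[OF Univ_weaken[OF e2 T]] note e3 = wf_extends(3)[OF w3]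
  let ?\<Gamma>2 = "?T\<Up> # G a # \<Gamma>" and ?\<Gamma>3 = "?T\<up>2 # ?T\<Up> # G a # \<Gamma>"
  interpret D: homotopy_groups ?\<Gamma>2 i "m\<up>2" "X\<up>2"
    by (rule homotopy_groups_weaken[OF homotopy_groups_axioms e2]) simp_all
  interpret E: homotopy_groups ?\<Gamma>3 i "m\<up>3" "X\<up>3"
    by (rule homotopy_groups_weaken[OF homotopy_groups_axioms e3]) simp_all
  note a2 = extends_weaken[OF e2 a refl] and b2 = extends_weaken[OF e2 b refl]
    and a3 = extends_weaken[OF e3 a refl] and b3 = extends_weaken[OF e3 b refl]
  have v2: "?\<Gamma>2 \<turnstile> Var 0 \<^bold>: Eql X\<up>2 a\<up>2 b\<up>2" "?\<Gamma>2 \<turnstile> Var (Suc 0) \<^bold>: D.\<pi>\<langle>a\<up>2 \<cdot> Var\<rangle>"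
    by (rule VarT; use w2 in simp)+
  have v3: "?\<Gamma>3 \<turnstile> Var 0 \<^bold>: Eql X\<up>3 a\<up>3 b\<up>3" "?\<Gamma>3 \<turnstile> Var (Suc 0) \<^bold>: Eql X\<up>3 a\<up>3 b\<up>3"
    "?\<Gamma>3 \<turnstile> Var 2 \<^bold>: E.\<pi>\<langle>a\<up>3 \<cdot> Var\<rangle>"
    by (rule VarT; use w3 in simp)+
  have triv3: "inhabited ?\<Gamma>3 (trivial_transport X\<up>3 E.\<pi> a\<up>3)"
    by (rule inhabited_weaken[OF triv e3]) simp
  show ?thesis
  proof (rule constant_maps_factor[OF A T L _ _ t])
    show "?\<Gamma>2 \<turnstile> App (transport (\<pi>\<langle>Var 0 \<cdot> sh 3\<rangle>) a\<up>2 b\<up>2 (Var 0)) (Var (Suc 0)) \<^bold>: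
        STr ((carrier i (Loops i (Succ m) X b))\<up>2)"
      using D.trT[OF a2 b2 v2 refl] by (simp add: hgroup_def)
    show "inhabited ?\<Gamma>3 (Eql (STr ((carrier i (Loops i (Succ m) X b))\<up>3))
        ((App (transport (\<pi>\<langle>Var 0 \<cdot> sh 3\<rangle>) a\<up>2 b\<up>2 (Var 0)) (Var (Suc 0)))\<Up>)
        ((App (transport (\<pi>\<langle>Var 0 \<cdot> sh 3\<rangle>) a\<up>2 b\<up>2 (Var 0)) (Var (Suc 0)))\<langle>Var 0 \<cdot> sh 2\<rangle>))"
      using E.trivial_tr_eq[OF triv3 a3 b3 v3(2,1,3)] by (simp add: hgroup_def)
  qed (rule that, simp_all add: hgroup_def)
qed

text \<open>
  The candidate for the inverse is produced in the same way as the isomorphism, from transport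
  along inverse paths. This avoids proving that being an equivalence is a proposition.
\<close>

lemma inv_transport_factors:
  assumes a: "\<Gamma> \<turnstile> a \<^bold>: X" and b: "\<Gamma> \<turnstile> b \<^bold>: X" and t: "inhabited \<Gamma> (PTr (Eql X a b))"
    and triv: "inhabited \<Gamma> (trivial_transport X \<pi> a)"
  obtains g where "\<Gamma> \<turnstile> g \<^bold>: Arr (G b) (G a)"
    "agrees_with_inverse a b g"
proof -
  let ?T = "Eql X a b"
  note T = EqlF[OF X a b] and A = groupF[OF b] and L = loopsF[OF a]
  note w1 = CtxCons[OF A] note e1 = wf_extends(1)[OF w1]
  note w2 = CtxCons[OF Univ_weaken[OF e1 T]] note e2 = wf_extends(2)[OF w2]
  note w3 = CtxCons[OF Univ_weaken[OF e2 T]] note e3 = wf_extends(3)[OF w3]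
  let ?\<Gamma>2 = "?T\<Up> # G b # \<Gamma>" and ?\<Gamma>3 = "?T\<up>2 # ?T\<Up> # G b # \<Gamma>"
  interpret D: homotopy_groups ?\<Gamma>2 i "m\<up>2" "X\<up>2"
    by (rule homotopy_groups_weaken[OF homotopy_groups_axioms e2]) simp_all
  interpret E: homotopy_groups ?\<Gamma>3 i "m\<up>3" "X\<up>3"
    by (rule homotopy_groups_weaken[OF homotopy_groups_axioms e3]) simp_all
  note a2 = extends_weaken[OF e2 a refl] and b2 = extends_weaken[OF e2 b refl]
    and a3 = extends_weaken[OF e3 a refl] and b3 = extends_weaken[OF e3 b refl]
  have v2: "?\<Gamma>2 \<turnstile> Var 0 \<^bold>: Eql X\<up>2 a\<up>2 b\<up>2" "?\<Gamma>2 \<turnstile> Var (Suc 0) \<^bold>: D.\<pi>\<langle>b\<up>2 \<cdot> Var\<rangle>"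
    by (rule VarT; use w2 in simp)+
  have v3: "?\<Gamma>3 \<turnstile> Var 0 \<^bold>: Eql X\<up>3 a\<up>3 b\<up>3" "?\<Gamma>3 \<turnstile> Var (Suc 0) \<^bold>: Eql X\<up>3 a\<up>3 b\<up>3"
    "?\<Gamma>3 \<turnstile> Var 2 \<^bold>: E.\<pi>\<langle>b\<up>3 \<cdot> Var\<rangle>"
    by (rule VarT; use w3 in simp)+
  have triv3: "inhabited ?\<Gamma>3 (trivial_transport X\<up>3 E.\<pi> a\<up>3)"
    by (rule inhabited_weaken[OF triv e3]) simp
  let ?k = "App (transport (\<pi>\<langle>Var 0 \<cdot> sh 3\<rangle>) b\<up>2 a\<up>2
          (path_inv X\<up>2 a\<up>2 b\<up>2 (Var 0))) (Var (Suc 0))"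
  show ?thesis
  proof (rule constant_maps_factor[OF A T L _ _ t])
    show "?\<Gamma>2 \<turnstile> ?k \<^bold>: STr ((carrier i (Loops i (Succ m) X a))\<up>2)"
      using D.trT[OF b2 a2 D.invT[OF a2 b2 v2(1)] v2(2) refl] by (simp add: hgroup_def)
    show "inhabited ?\<Gamma>3 (Eql (STr ((carrier i (Loops i (Succ m) X a))\<up>3)) ?k\<Up> (?k\<langle>Var 0 \<cdot> sh 2\<rangle>))"
      using E.trivial_tr_inv_eq[OF triv3 a3 b3 v3(2,1,3)] by (simp add: hgroup_def)
  qed (rule that, simp_all add: hgroup_def)
qed

lemma inhabited_Eql_PTr:
  assumes a: "\<Gamma> \<turnstile> a \<^bold>: X" and u: "\<Gamma> \<turnstile> u \<^bold>: G a" and v: "\<Gamma> \<turnstile> v \<^bold>: G a" and T: "\<Gamma> \<turnstile> T \<^bold>: Univ j"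
    and t: "inhabited \<Gamma> (PTr T)"
    and eq: "inhabited (T # \<Gamma>) (Eql ((G a)\<Up>) u\<Up> v\<Up>)"
  shows "inhabited \<Gamma> (Eql (G a) u v)"
  using inhabited_Eql_STr_PTr[OF loopsF[OF a] u[unfolded hgroup_def] v[unfolded hgroup_def] T _ t] eq
  by (simp add: hgroup_def)

lemma canonical_intro:
  assumes a: "\<Gamma> \<turnstile> a \<^bold>: X" and b: "\<Gamma> \<turnstile> b \<^bold>: X" and f: "\<Gamma> \<turnstile> f \<^bold>: Arr (G a) (G b)"
    and spec: "agrees_with_transport a b f"
  shows "inhabited \<Gamma> (canonical i (Succ m) X a b f)"
proof -
  note T = EqlF[OF X a b]
  note w1 = CtxCons[OF T] note e1 = wf_extends(1)[OF w1]
  let ?\<Delta> = "Eql X a b # \<Gamma>"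
  interpret D: homotopy_groups ?\<Delta> i "m\<Up>" "X\<Up>"
    by (rule homotopy_groups_weaken[OF homotopy_groups_axioms e1]) simp_all
  note a1 = extends_weaken[OF e1 a refl] and b1 = extends_weaken[OF e1 b refl]
  let ?A = "D.G a\<Up>" and ?B = "D.G b\<Up>"
  note A = D.groupF[OF a1]
  note w2 = CtxCons[OF A] note e2 = wf_extends(2)[OF w2]
  have B: "?A # ?\<Delta> \<turnstile> ?B\<Up> \<^bold>: Univ i" by (rule Univ_weaken[OF wf_extends(1)[OF w2] D.groupF[OF b1]])
  have v: "?\<Delta> \<turnstile> Var 0 \<^bold>: Eql X\<Up> a\<Up> b\<Up>"
    by (rule VarT) (simp_all add: w1)
  have f1: "?\<Delta> \<turnstile> f\<Up> \<^bold>: Arr ?A ?B" by (rule extends_weaken[OF e1 f]) simp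
  have s: "sub (?A # ?\<Delta>) (Var (Suc 0) \<cdot> Var 0 \<cdot> sh 2) (Eql X\<Up> a\<Up> b\<Up> # G a # \<Gamma>)"
    by (intro sub_scons extends_sub[OF e2] VarT) (simp_all add: w2)
  have "inhabited ?\<Delta> (Eql (Pi ?A ?B\<Up>) f\<Up>
      (transport D.\<pi> a\<Up> b\<Up> (Var 0)))"
    by (rule inhabited_funext[OF A B])
      (use f1 D.transportArr[OF a1 b1 v] inhabited_subst[OF spec s refl] in \<open>simp_all add: Arr_def\<close>)
  from inhabited_Pi[OF T this] show ?thesis by (simp add: canonical_def Arr_def)
qed

text \<open>
  An equation in a set, so a path \<open>p : a = b\<close> may be chosen. Then \<open>g v = (p\<inverse>)\<^sub>* v\<close>, which gives
  \<open>f (g v) = p\<^sub>* (g v) = v\<close>.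
\<close>

lemma canonical_right_inverse:
  assumes a: "\<Gamma> \<turnstile> a \<^bold>: X" and b: "\<Gamma> \<turnstile> b \<^bold>: X" and t: "inhabited \<Gamma> (PTr (Eql X a b))"
    and f: "\<Gamma> \<turnstile> f \<^bold>: Arr (G a) (G b)" and g: "\<Gamma> \<turnstile> g \<^bold>: Arr (G b) (G a)"
    and can: "inhabited \<Gamma> (canonical i (Succ m) X a b f)" and gspec: "agrees_with_inverse a b g"
  shows "inhabited (G b # \<Gamma>) (Eql ((G b)\<Up>) (App f\<Up> (App g\<Up> (Var 0))) (Var 0))"
proof -
  note T = EqlF[OF X a b]
  note w1 = CtxCons[OF groupF[OF b]] note e1 = wf_extends(1)[OF w1]
  note T1 = Univ_weaken[OF e1 T] note w2 = CtxCons[OF T1] note e2 = wf_extends(2)[OF w2]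
  let ?\<Gamma>1 = "G b # \<Gamma>" and ?\<Gamma>2 = "(Eql X a b)\<Up> # G b # \<Gamma>"
  interpret D: homotopy_groups ?\<Gamma>1 i "m\<Up>" "X\<Up>"
    by (rule homotopy_groups_weaken[OF homotopy_groups_axioms e1]) simp_all
  interpret E: homotopy_groups ?\<Gamma>2 i "m\<up>2" "X\<up>2"
    by (rule homotopy_groups_weaken[OF homotopy_groups_axioms e2]) simp_all
  have v1: "?\<Gamma>1 \<turnstile> Var 0 \<^bold>: D.G b\<Up>" by (rule VarT) (simp_all add: w1)
  have f1: "?\<Gamma>1 \<turnstile> f\<Up> \<^bold>: Arr (D.G a\<Up>) (D.G b\<Up>)"
    by (rule extends_weaken[OF e1 f]) simp
  have g1: "?\<Gamma>1 \<turnstile> g\<Up> \<^bold>: Arr (D.G b\<Up>) (D.G a\<Up>)"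
    by (rule extends_weaken[OF e1 g]) simp
  have f2: "?\<Gamma>2 \<turnstile> f\<up>2 \<^bold>: Arr (E.G a\<up>2) (E.G b\<up>2)" by (rule extends_weaken[OF e2 f]) simp
  have g2: "?\<Gamma>2 \<turnstile> g\<up>2 \<^bold>: Arr (E.G b\<up>2) (E.G a\<up>2)" by (rule extends_weaken[OF e2 g]) simp
  note a2 = extends_weaken[OF e2 a refl] and b2 = extends_weaken[OF e2 b refl]
  have p: "?\<Gamma>2 \<turnstile> Var 0 \<^bold>: Eql X\<up>2 a\<up>2 b\<up>2" and v: "?\<Gamma>2 \<turnstile> Var (Suc 0) \<^bold>: E.G b\<up>2"
    by (rule VarT; use w2 in simp)+
  let ?u = "App g\<up>2 (Var (Suc 0))"
  note u = ArrE[OF g2 v]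
  let ?s = "App (transport E.\<pi> b\<up>2 a\<up>2 (path_inv X\<up>2 a\<up>2 b\<up>2 (Var 0))) (Var (Suc 0))"
  note s = ArrE[OF E.transportArr[OF b2 a2 E.invT[OF a2 b2 p]] v] and fu = ArrE[OF f2 u]
    and tu = ArrE[OF E.transportArr[OF a2 b2 p] u]
  have geq: "inhabited ?\<Gamma>2 (Eql (E.G a\<up>2) ?u ?s)" using gspec by simp
  have can2: "inhabited ?\<Gamma>2 (canonical i (Succ m\<up>2) X\<up>2 a\<up>2 b\<up>2 f\<up>2)"
    by (rule inhabited_weaken[OF can e2]) simp
  note feq = E.canonical_app[OF can2 a2 b2 f2 p u]
  have "inhabited ?\<Gamma>2 (Eql (E.G b\<up>2) (App (transport E.\<pi> a\<up>2 b\<up>2 (Var 0)) ?u) (Var (Suc 0)))"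
    using E.tr_eq[OF a2 b2 p, of ?u "Var (Suc 0)"] u v inhabited_sym[OF geq
        E.groupF[OF a2] u s] by simp
  note eq = inhabited_trans[OF feq this E.groupF[OF b2] fu tu v]
  have t1: "inhabited ?\<Gamma>1 (PTr ((Eql X a b)\<Up>))" by (rule inhabited_weaken[OF t e1]) simp
  from D.inhabited_Eql_PTr[OF extends_weaken[OF e1 b refl] ArrE[OF f1 ArrE[OF g1 v1]] v1 T1 t1] eq
  show ?thesis by simp
qed

lemma canonical_left_inverse:
  assumes a: "\<Gamma> \<turnstile> a \<^bold>: X" and b: "\<Gamma> \<turnstile> b \<^bold>: X" and t: "inhabited \<Gamma> (PTr (Eql X a b))"
    and f: "\<Gamma> \<turnstile> f \<^bold>: Arr (G a) (G b)" and g: "\<Gamma> \<turnstile> g \<^bold>: Arr (G b) (G a)"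
    and can: "inhabited \<Gamma> (canonical i (Succ m) X a b f)" and gspec: "agrees_with_inverse a b g"
  shows "inhabited (G a # \<Gamma>) (Eql ((G a)\<Up>) (App g\<Up> (App f\<Up> (Var 0))) (Var 0))"
proof -
  note T = EqlF[OF X a b]
  note w1 = CtxCons[OF groupF[OF a]] note e1 = wf_extends(1)[OF w1]
  note T1 = Univ_weaken[OF e1 T] note w2 = CtxCons[OF T1] note e2 = wf_extends(2)[OF w2]
  let ?\<Gamma>1 = "G a # \<Gamma>" and ?\<Gamma>2 = "(Eql X a b)\<Up> # G a # \<Gamma>"
  interpret D: homotopy_groups ?\<Gamma>1 i "m\<Up>" "X\<Up>"
    by (rule homotopy_groups_weaken[OF homotopy_groups_axioms e1]) simp_all
  interpret E: homotopy_groups ?\<Gamma>2 i "m\<up>2" "X\<up>2"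
    by (rule homotopy_groups_weaken[OF homotopy_groups_axioms e2]) simp_all
  have v1: "?\<Gamma>1 \<turnstile> Var 0 \<^bold>: D.G a\<Up>" by (rule VarT) (simp_all add: w1)
  have f1: "?\<Gamma>1 \<turnstile> f\<Up> \<^bold>: Arr (D.G a\<Up>) (D.G b\<Up>)"
    by (rule extends_weaken[OF e1 f]) simp
  have g1: "?\<Gamma>1 \<turnstile> g\<Up> \<^bold>: Arr (D.G b\<Up>) (D.G a\<Up>)"
    by (rule extends_weaken[OF e1 g]) simp
  have f2: "?\<Gamma>2 \<turnstile> f\<up>2 \<^bold>: Arr (E.G a\<up>2) (E.G b\<up>2)" by (rule extends_weaken[OF e2 f]) simp
  have g2: "?\<Gamma>2 \<turnstile> g\<up>2 \<^bold>: Arr (E.G b\<up>2) (E.G a\<up>2)" by (rule extends_weaken[OF e2 g]) simp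
  note a2 = extends_weaken[OF e2 a refl] and b2 = extends_weaken[OF e2 b refl]
  have p: "?\<Gamma>2 \<turnstile> Var 0 \<^bold>: Eql X\<up>2 a\<up>2 b\<up>2" and u: "?\<Gamma>2 \<turnstile> Var (Suc 0) \<^bold>: E.G a\<up>2"
    by (rule VarT; use w2 in simp)+
  let ?v = "App f\<up>2 (Var (Suc 0))"
  note v = ArrE[OF f2 u]
  let ?s = "App (transport E.\<pi> b\<up>2 a\<up>2 (path_inv X\<up>2 a\<up>2 b\<up>2 (Var 0))) ?v"
  note s = ArrE[OF E.transportArr[OF b2 a2 E.invT[OF a2 b2 p]] v] and gv = ArrE[OF g2 v]
    and tu = ArrE[OF E.transportArr[OF a2 b2 p] u]
  have "sub ?\<Gamma>2 (Var 0 \<cdot> ?v \<cdot> sh 2) (Eql X\<Up> a\<Up> b\<Up> # G b # \<Gamma>)"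
    by (intro sub_scons extends_sub[OF e2]) (use v p in simp_all)
  from inhabited_subst[OF gspec this refl]
  have geq: "inhabited ?\<Gamma>2 (Eql (E.G a\<up>2) (App g\<up>2 ?v) ?s)" by simp
  have can2: "inhabited ?\<Gamma>2 (canonical i (Succ m\<up>2) X\<up>2 a\<up>2 b\<up>2 f\<up>2)"
    by (rule inhabited_weaken[OF can e2]) simp
  note feq = E.canonical_app[OF can2 a2 b2 f2 p u]
  have "inhabited ?\<Gamma>2 (Eql (E.G a\<up>2) ?s (Var (Suc 0)))"
    using E.tr_inv_eq[OF a2 b2 p, of "Var (Suc 0)" ?v] u v inhabited_sym[OF feq
        E.groupF[OF b2] v tu] by simp
  note eq = inhabited_trans[OF geq this E.groupF[OF a2] gv s u]
  have t1: "inhabited ?\<Gamma>1 (PTr ((Eql X a b)\<Up>))" by (rule inhabited_weaken[OF t e1]) simp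
  from D.inhabited_Eql_PTr[OF extends_weaken[OF e1 a refl] ArrE[OF g1 ArrE[OF f1 v1]] v1 T1 t1] eq
  show ?thesis by simp
qed

text \<open>
  For a chosen path \<open>p : a = b\<close>, the function \<open>f\<close> is equal to transport along \<open>p\<close>, which preserves
  products.
\<close>

lemma canonical_preserves_mult:
  assumes a: "\<Gamma> \<turnstile> a \<^bold>: X" and b: "\<Gamma> \<turnstile> b \<^bold>: X" and t: "inhabited \<Gamma> (PTr (Eql X a b))"
    and f: "\<Gamma> \<turnstile> f \<^bold>: Arr (G a) (G b)" and can: "inhabited \<Gamma> (canonical i (Succ m) X a b f)"
  shows "inhabited \<Gamma> (preserves_mult i m X a b f)"
proof -
  note c = two_elements[OF a]
  let ?\<Delta> = "(G a)\<Up> # G a # \<Gamma>"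
  interpret D: homotopy_groups ?\<Delta> i "m\<up>2" "X\<up>2" by (rule c)
  note b2 = extends_weaken[OF c(3) b refl]
  note E = EqlF[OF D.X c(5) b2]
  note w = CtxCons[OF E]
  let ?\<Theta> = "Eql X\<up>2 a\<up>2 b\<up>2 # ?\<Delta>"
  have e: "extends 3 \<Gamma> ?\<Theta>" by (rule wf_extends(3)[OF w])
  interpret E: homotopy_groups ?\<Theta> i "m\<up>3" "X\<up>3"
    by (rule homotopy_groups_weaken[OF homotopy_groups_axioms e]) simp_all
  note a3 = extends_weaken[OF e a refl] and b3 = extends_weaken[OF e b refl]
  have f2: "?\<Delta> \<turnstile> f\<up>2 \<^bold>: Arr (D.G a\<up>2) (D.G b\<up>2)" by (rule extends_weaken[OF c(3) f]) simp
  have f3: "?\<Theta> \<turnstile> f\<up>3 \<^bold>: Arr (E.G a\<up>3) (E.G b\<up>3)" by (rule extends_weaken[OF e f]) simp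
  have can3: "inhabited ?\<Theta> (canonical i (Succ m\<up>3) X\<up>3 a\<up>3 b\<up>3 f\<up>3)"
    by (rule inhabited_weaken[OF can e]) simp
  have v: "?\<Theta> \<turnstile> Var 0 \<^bold>: Eql X\<up>3 a\<up>3 b\<up>3"
    "?\<Theta> \<turnstile> Var 2 \<^bold>: E.G a\<up>3" "?\<Theta> \<turnstile> Var (Suc 0) \<^bold>: E.G a\<up>3"
    by (rule VarT; use w in simp)+
  note tr3 = E.transportArr[OF a3 b3 v(1)]
  note eq3 = inhabited_sym[OF E.canonicalE[OF can3 v(1)] ArrF[OF E.groupF[OF a3]
      E.groupF[OF b3]] f3 tr3]
  note hom3 = E.preserves_multE[OF E.preserves_mult_eq[OF a3 b3 tr3 f3 eq3
      E.preserves_mult_transport[OF a3 b3 v(1)]] v(2,3)]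
  have t2: "inhabited ?\<Delta> (PTr (Eql X\<up>2 a\<up>2 b\<up>2))" by (rule inhabited_weaken[OF t c(3)]) simp
  from D.inhabited_Eql_PTr[OF b2 ArrE[OF f2 D.mult[OF c(5-7)]] D.mult[OF b2 ArrE[OF f2 c(6)]
      ArrE[OF f2 c(7)]] E t2] hom3
  show ?thesis
    using inhabited_Pi[OF c(1) inhabited_Pi[OF c(2)]] by (simp add: preserves_mult_def)
qed

lemma canonical_iso_of_trivial_action:
  assumes a: "\<Gamma> \<turnstile> a \<^bold>: X" and b: "\<Gamma> \<turnstile> b \<^bold>: X" and t: "inhabited \<Gamma> (PTr (Eql X a b))"
    and act: "inhabited \<Gamma> (trivial_action i (Succ m) X a)"
  shows "inhabited \<Gamma> (canonical_iso i m X a b)"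
proof -
  have triv: "inhabited \<Gamma> (trivial_transport X \<pi> a)" by (rule transport_of_trivial_action[OF a act])
  obtain f where f: "\<Gamma> \<turnstile> f \<^bold>: Arr (G a) (G b)"
    and fspec: "agrees_with_transport a b f"
    by (rule transport_factors[OF a b t triv])
  obtain g where g: "\<Gamma> \<turnstile> g \<^bold>: Arr (G b) (G a)"
    and gspec: "agrees_with_inverse a b g"
    by (rule inv_transport_factors[OF a b t triv])
  have can: "inhabited \<Gamma> (canonical i (Succ m) X a b f)" by (rule canonical_intro[OF a b f fspec])
  have equiv: "inhabited \<Gamma> (isEquiv (G a) (G b) f)"
    by (rule inhabited_isEquiv[OF groupF[OF a] groupF[OF b] f g])
      (rule canonical_right_inverse[OF a b t f g can gspec] canonical_left_inverse[OF a b t f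
          g can gspec])+
  note hom = canonical_preserves_mult[OF a b t f can]
  note I = hgroup_iso_parts[OF a b]
  note F = I(1)
  obtain w where w: "\<Gamma> \<turnstile> w \<^bold>: Prod (isEquiv (G a) (G b) f) (preserves_mult i m X a b f)"
    using inhabited_Prod[OF isEquivF[OF groupF[OF a] groupF[OF b] f] preserves_multF[OF a
        b f] equiv hom]
    by (auto simp: inhabited_def)
  then have w': "\<Gamma> \<turnstile> w \<^bold>: (Prod (isEquiv (hgroup i (Succ m\<Up>) X\<Up> a\<Up>)
         (hgroup i (Succ m\<Up>) X\<Up> b\<Up>) (Var 0))
       (preserves_mult i m\<Up> X\<Up> a\<Up> b\<Up> (Var 0)))\<langle>f \<cdot> Var\<rangle>"
    by simp
  have \<phi>: "\<Gamma> \<turnstile> Tup f w \<^bold>: hgroup_iso i m X a b"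
    unfolding hgroup_iso_eq by (rule SigI[OF I(2) f w'])
  \<comment> \<open>The equation required of the pair \<open>Tup f w\<close> is about its first projection, which is \<open>f\<close> only
    judgementally.\<close>
  note beta = proj1_beta[OF F I(2) f w']
  note wF = CtxCons[OF F] note eF = wf_extends(1)[OF wF]
  interpret F: homotopy_groups "Arr (G a) (G b) # \<Gamma>" i "m\<Up>" "X\<Up>"
    by (rule homotopy_groups_weaken[OF homotopy_groups_axioms eF]) simp_all
  have v: "Arr (G a) (G b) # \<Gamma> \<turnstile> Var 0 \<^bold>: Arr (F.G a\<Up>) (F.G b\<Up>)"
    by (rule VarT) (simp_all add: wF)
  have conv: "\<Gamma> \<turnstile> canonical i (Succ m) X a b f \<doteq>
      canonical i (Succ m) X a b (proj1 (Arr (G a) (G b)) (Tup f w)) \<^bold>: Univ i"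
    using eq_subst1[OF F.canonicalF[OF extends_weaken[OF eF a refl] extends_weaken[OF eF b refl]
        v] EqSym[OF beta]]
    by simp
  show ?thesis
    unfolding canonical_iso_eq
    by (rule inhabited_Sig[OF canonical_iso_part[OF a b] \<phi>]) (use inhabited_conv[OF can conv] in simp)
qed

end

lemma subst_isConn [simp]: "(isConn A)\<langle>\<sigma>\<rangle> = isConn (A\<langle>\<sigma>\<rangle>)"
  by (simp add: isConn_def)

theorem corollary15:
  fixes i :: nat
  shows "\<exists>t. [] \<turnstile> t \<^bold>:
    Pi (Univ i)             \<comment> \<open>X\<close>
   (Pi (isConn (Var 0))     \<comment> \<open>X is connected\<close>
   (Pi (Var 1)              \<comment> \<open>a : X\<close>
   (Pi (Var 2)              \<comment> \<open>b : X\<close>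
   (Pi Nat                  \<comment> \<open>m, with n = m + 1\<close>
     (let X = Var 4; a = Var 2; b = Var 1; m = Var 0
      in Iff (canonical_iso i m X a b) (trivial_action i (Succ m) X a))))))"
proof -
  have U: "[] \<turnstile> Univ i \<^bold>: Univ (Suc i)" by (rule UnivF[OF CtxNil])
  note w1 = CtxCons[OF U]
  have X1: "[Univ i] \<turnstile> Var 0 \<^bold>: Univ i" by (rule VarT) (simp_all add: w1)
  have C: "[Univ i] \<turnstile> isConn (Var 0) \<^bold>: Univ i"
  proof -
    note J = wf_J[OF X1]
    have "[Var (Suc 0), Var 0, Univ i] \<turnstile> PTr (Eql (Var 2) (Var (Suc 0)) (Var 0)) \<^bold>: Univ i"
      by (rule PTrF, rule EqlF; rule VarT) (use J(2) in simp_all)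
    moreover have "[Var 0, Univ i] \<turnstile> Var (Suc 0) \<^bold>: Univ i" by (rule VarT) (simp_all add: J)
    ultimately show ?thesis using PiF[OF X1 PiF] by (simp add: isConn_def)
  qed
  note w2 = CtxCons[OF C]
  have X2: "[isConn (Var 0), Univ i] \<turnstile> Var (Suc 0) \<^bold>: Univ i" by (rule VarT) (simp_all add: w2)
  note w3 = CtxCons[OF X2]
  have X3: "[Var (Suc 0), isConn (Var 0), Univ i] \<turnstile> Var 2 \<^bold>: Univ i" by (rule VarT) (simp_all add: w3)
  note w4 = CtxCons[OF X3]
  have N: "[Var 2, Var (Suc 0), isConn (Var 0), Univ i] \<turnstile> Nat \<^bold>: Univ i" by (rule NatF[OF w4])
  note w5 = CtxCons[OF N]
  let ?\<Gamma> = "[Nat, Var 2, Var (Suc 0), isConn (Var 0), Univ i]"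
  have m: "?\<Gamma> \<turnstile> Var 0 \<^bold>: Nat" and b: "?\<Gamma> \<turnstile> Var (Suc 0) \<^bold>: Var 4" and a: "?\<Gamma> \<turnstile> Var 2 \<^bold>: Var 4"
    and c: "?\<Gamma> \<turnstile> Var 3 \<^bold>: isConn (Var 4)" and X: "?\<Gamma> \<turnstile> Var 4 \<^bold>: Univ i"
    by (rule VarT; simp add: w5)+
  have t: "inhabited ?\<Gamma> (PTr (Eql (Var 4) (Var 2) (Var (Suc 0))))"
  proof -
    have "inhabited ?\<Gamma> (Pi (Var 4) (Pi (Var 5) (PTr (Eql (Var 6) (Var (Suc 0)) (Var 0)))))"
      using inhabitedI[OF c] by (simp add: isConn_def[of "Var 4"])
    from inhabited_app[OF this a refl]
    have "inhabited ?\<Gamma> (Pi (Var 4) (PTr (Eql (Var 5) (Var 3) (Var 0))))" by simp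
    from inhabited_app[OF this b refl] show ?thesis by simp
  qed
  interpret homotopy_groups ?\<Gamma> i "Var 0" "Var 4" using m X by unfold_locales
  let ?I = "canonical_iso i (Var 0) (Var 4) (Var 2) (Var (Suc 0))" and ?T = "trivial_action i
      (Succ (Var 0)) (Var 4) (Var 2)"
  have iff1: "inhabited ?\<Gamma> (Arr ?I ?T)"
  proof (rule inhabited_Arr_generic[OF canonical_isoF[OF a b]])
    fix \<Delta> n
    assume e: "extends n ?\<Gamma> \<Delta>" and h: "inhabited \<Delta> ?I\<up>n"
    interpret D: homotopy_groups \<Delta> i "(Var 0)\<up>n" "(Var 4)\<up>n"
      by (rule homotopy_groups_weaken[OF homotopy_groups_axioms e]) simp_all
    show "inhabited \<Delta> ?T\<up>n"
      using D.trivial_action_of_canonical_iso[OF extends_weaken[OF e a refl]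
          extends_weaken[OF e b refl]]
        inhabited_weaken[OF t e refl] h by simp
  qed
  have iff2: "inhabited ?\<Gamma> (Arr ?T ?I)"
  proof (rule inhabited_Arr_generic[OF trivial_actionF[OF a]])
    fix \<Delta> n
    assume e: "extends n ?\<Gamma> \<Delta>" and h: "inhabited \<Delta> ?T\<up>n"
    interpret D: homotopy_groups \<Delta> i "(Var 0)\<up>n" "(Var 4)\<up>n"
      by (rule homotopy_groups_weaken[OF homotopy_groups_axioms e]) simp_all
    show "inhabited \<Delta> ?I\<up>n"
      using D.canonical_iso_of_trivial_action[OF extends_weaken[OF e a refl]
          extends_weaken[OF e b refl]]
        inhabited_weaken[OF t e refl] h by simp
  qed
  have "inhabited ?\<Gamma> (Iff ?I ?T)"
    unfolding Iff_def
    by (rule inhabited_Prod[OF ArrF[OF canonical_isoF[OF a b] trivial_actionF[OF a]]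
      ArrF[OF trivial_actionF[OF a] canonical_isoF[OF a b]] iff1 iff2])
  from inhabited_Pi[OF U inhabited_Pi[OF C inhabited_Pi[OF X2 inhabited_Pi[OF
      X3 inhabited_Pi[OF N this]]]]]
  show ?thesis by (simp add: inhabited_def Let_def)
qed

end
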